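(* The operator $\Delta_0=d\,d^*$ is self-adjoint with respect to $\mu_0$, and the operator $d^*d$ is self-adjoint with respect to $\mu_1$. That is, $\langle dd^*\nu,\nu'\rangle_{X_0}=\langle\nu,dd^*\nu'\rangle_{X_0}$ for all square-summable signed measures $\nu,\nu'$ on $X_0$, and $\langle d^*d\,\nu,\nu'\rangle_{X_1}=\langle\nu,d^*d\,\nu'\rangle_{X_1}$ for all square-summable signed measures $\nu,\nu'$ on $X_1$.
   Context: Fix a prime $p$. $X_0$ is the set of isomorphism classes of finite abelian $p$-groups; $X_1$ is the set of isomorphism classes of finitely generated $\mathbb{Z}_p$-modules of $\mathbb{Q}_p$-rank $1$. The random operator $d$ from $X_1$ to $X_0$: $d(H)$ is the quotient of $H$ by (the submodule generated by) a Haar-random element of $H$ (almost surely finite). The random operator $d^*$ from $X_0$ to $X_1$: $d^*(G)$ is the middle term of the extension $0\to\mathbb{Z}_p\to H\to G\to 0$ corresponding to a uniformly random element of the finite group $\mathrm{Ext}(G,\mathbb{Z}_p)$. A random operator $T$ acts linearly on signed measures by $(T\nu)(y)=\sum_x\nu(x)\,\mathbb{P}(T(x)\cong y)$; $dd^*$ means first $d^*$, then $d$ (independent choices), and similarly for $d^*d$. $\mu_0(G)=c_0/|\mathrm{Aut}(G)|$ on $X_0$, with $c_0=\prod_{i\ge1}(1-p^{-i})$; $\mu_1(H)=c_1/(|H_{tors}||\mathrm{Aut}(H_{tors})|)$ on $X_1$, with $c_1=\prod_{i\ge2}(1-p^{-i})$ and $H_{tors}$ the torsion submodule of $H$. For $j=0,1$,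 $\langle\nu,\nu'\rangle_{X_j}=\sum_{x\in X_j}\nu(x)\nu'(x)/\mu_j(x)$; $\nu$ is square-summable if $\langle\nu,\nu\rangle_{X_j}<\infty$. "Self-adjoint with respect to $\mu_j$" means self-adjoint for $\langle\cdot,\cdot\rangle_{X_j}$. *)

theory Defs
  imports "HOL-Probability.Probability" "HOL-Algebra.Algebra"
begin

hide_const (open) Multiset.mult Wellorder_Constructions.zero Divisibility.prime

section \<open>The ring of p-adic integers\<close>

text \<open>
  The inverse limit of the rings of integers modulo \<open>p ^ n\<close>: an element is the sequence of its
  residues, each taken in \<open>{0..<p ^ n}\<close> (the case \<open>m = n\<close> of the compatibility condition).
\<close>

type_synonym padic = "nat \<Rightarrow> int"

definition Zp :: "nat \<Rightarrow> padic ring" where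
  "Zp p = \<lparr>carrier = {a. \<forall>m n. m \<le> n \<longrightarrow> a n mod int p ^ m = a m},
           mult = (\<lambda>a b n. (a n * b n) mod int p ^ n),
           one = (\<lambda>n. 1 mod int p ^ n),
           zero = (\<lambda>n. 0),
           add = (\<lambda>a b n. (a n + b n) mod int p ^ n)\<rparr>"

lemma Zp_carrierD:
  assumes "a \<in> carrier (Zp p)" "m \<le> n"
  shows "a n mod int p ^ m = a m"
  using assms by (simp add: Zp_def)

lemma Zp_mod_self [simp]:
  assumes "a \<in> carrier (Zp p)"
  shows "a n mod int p ^ n = a n"
  using Zp_carrierD[OF assms order.refl] .

lemma Zp_cring: "cring (Zp p)"
proof (intro cringI abelian_groupI comm_monoidI)
  show "x \<otimes>\<^bsub>Zp p\<^esub> y \<in> carrier (Zp p)" if "x \<in> carrier (Zp p)" "y \<in> carrier (Zp p)" for x y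
    using that by (auto simp: Zp_def mod_mod_cancel le_imp_power_dvd) (metis mod_mult_eq)
  show "x \<oplus>\<^bsub>Zp p\<^esub> y \<in> carrier (Zp p)" if "x \<in> carrier (Zp p)" "y \<in> carrier (Zp p)" for x y
    using that by (auto simp: Zp_def mod_mod_cancel le_imp_power_dvd) (metis mod_add_eq)
  show "\<one>\<^bsub>Zp p\<^esub> \<in> carrier (Zp p)"
    by (auto simp: Zp_def mod_mod_cancel le_imp_power_dvd)
  show "\<zero>\<^bsub>Zp p\<^esub> \<in> carrier (Zp p)"
    by (auto simp: Zp_def)
  show "\<one>\<^bsub>Zp p\<^esub> \<otimes>\<^bsub>Zp p\<^esub> x = x" if "x \<in> carrier (Zp p)" for x
    using Zp_mod_self[OF that] by (auto simp: Zp_def mod_mult_left_eq)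
  show "\<zero>\<^bsub>Zp p\<^esub> \<oplus>\<^bsub>Zp p\<^esub> x = x" if "x \<in> carrier (Zp p)" for x
    using Zp_mod_self[OF that] by (auto simp: Zp_def)
  show "\<exists>y\<in>carrier (Zp p). y \<oplus>\<^bsub>Zp p\<^esub> x = \<zero>\<^bsub>Zp p\<^esub>" if "x \<in> carrier (Zp p)" for x
  proof (rule bexI)
    show "(\<lambda>n. (- x n) mod int p ^ n) \<oplus>\<^bsub>Zp p\<^esub> x = \<zero>\<^bsub>Zp p\<^esub>"
      by (simp add: Zp_def mod_add_left_eq)
    show "(\<lambda>n. (- x n) mod int p ^ n) \<in> carrier (Zp p)"
      using that by (auto simp: Zp_def mod_mod_cancel le_imp_power_dvd) (metis mod_minus_eq)
  qed
  show "x \<otimes>\<^bsub>Zp p\<^esub> y = y \<otimes>\<^bsub>Zp p\<^esub> x" for x y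
    by (simp add: Zp_def mult.commute)
  show "x \<oplus>\<^bsub>Zp p\<^esub> y = y \<oplus>\<^bsub>Zp p\<^esub> x" for x y
    by (simp add: Zp_def add.commute)
  show "x \<otimes>\<^bsub>Zp p\<^esub> y \<otimes>\<^bsub>Zp p\<^esub> z = x \<otimes>\<^bsub>Zp p\<^esub> (y \<otimes>\<^bsub>Zp p\<^esub> z)" for x y z
    by (simp add: Zp_def mod_mult_left_eq mod_mult_right_eq mult.assoc)
  show "x \<oplus>\<^bsub>Zp p\<^esub> y \<oplus>\<^bsub>Zp p\<^esub> z = x \<oplus>\<^bsub>Zp p\<^esub> (y \<oplus>\<^bsub>Zp p\<^esub> z)" for x y z
    by (simp add: Zp_def mod_add_left_eq mod_add_right_eq add.assoc)
  show "(x \<oplus>\<^bsub>Zp p\<^esub> y) \<otimes>\<^bsub>Zp p\<^esub> z = x \<otimes>\<^bsub>Zp p\<^esub> z \<oplus>\<^bsub>Zp p\<^esub> y \<otimes>\<^bsub>Zp p\<^esub> z" for x y z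
    by (simp add: Zp_def mod_mult_left_eq mod_add_eq distrib_right)
qed

section \<open>Modules over a commutative ring\<close>

text \<open>The record type of modules extends that of rings; the fields \<open>mult\<close> and \<open>one\<close> play no role.\<close>

definition module_hom ::
    "('a, 'r) ring_scheme \<Rightarrow> ('a, 'b, 'm) module_scheme \<Rightarrow> ('a, 'c, 'n) module_scheme \<Rightarrow> ('b \<Rightarrow> 'c) set"
  where "module_hom R M N =
    {h \<in> hom (add_monoid M) (add_monoid N).
       \<forall>a\<in>carrier R. \<forall>x\<in>carrier M. h (a \<odot>\<^bsub>M\<^esub> x) = a \<odot>\<^bsub>N\<^esub> h x}"

definition module_iso ::
    "('a, 'r) ring_scheme \<Rightarrow> ('a, 'b, 'm) module_scheme \<Rightarrow> ('a, 'c, 'n) module_scheme \<Rightarrow> ('b \<Rightarrow> 'c) set"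
  where "module_iso R M N = {h \<in> module_hom R M N. bij_betw h (carrier M) (carrier N)}"

definition module_span ::
    "('a, 'r) ring_scheme \<Rightarrow> ('a, 'b, 'm) module_scheme \<Rightarrow> 'b set \<Rightarrow> 'b set"
  where "module_span R M S = \<Inter>{N. submodule N R M \<and> S \<subseteq> N}"

definition finitely_generated_module ::
    "('a, 'r) ring_scheme \<Rightarrow> ('a, 'b, 'm) module_scheme \<Rightarrow> bool"
  where "finitely_generated_module R M \<longleftrightarrow>
    (\<exists>S. finite S \<and> S \<subseteq> carrier M \<and> module_span R M S = carrier M)"

definition lin_indep ::
    "('a, 'r) ring_scheme \<Rightarrow> ('a, 'b, 'm) module_scheme \<Rightarrow> 'b set \<Rightarrow> bool"
  where "lin_indep R M S \<longleftrightarrow> finite S \<and> S \<subseteq> carrier M \<and>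
    (\<forall>c \<in> S \<rightarrow> carrier R. (\<Oplus>\<^bsub>M\<^esub>x\<in>S. c x \<odot>\<^bsub>M\<^esub> x) = \<zero>\<^bsub>M\<^esub> \<longrightarrow> (\<forall>x\<in>S. c x = \<zero>\<^bsub>R\<^esub>))"

text \<open>
  Over a domain with fraction field \<open>K\<close>, the maximal number of linearly independent elements of
  \<open>M\<close> is the dimension over \<open>K\<close> of the tensor product of \<open>M\<close> with \<open>K\<close>.
\<close>

definition has_rank ::
    "('a, 'r) ring_scheme \<Rightarrow> ('a, 'b, 'm) module_scheme \<Rightarrow> nat \<Rightarrow> bool"
  where "has_rank R M n \<longleftrightarrow>
    (\<exists>S. lin_indep R M S \<and> card S = n) \<and> (\<forall>S. lin_indep R M S \<longrightarrow> card S \<le> n)"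

definition torsion_part ::
    "('a, 'r) ring_scheme \<Rightarrow> ('a, 'b, 'm) module_scheme \<Rightarrow> 'b set"
  where "torsion_part R M =
    {x \<in> carrier M. \<exists>a\<in>carrier R. a \<noteq> \<zero>\<^bsub>R\<^esub> \<and> a \<odot>\<^bsub>M\<^esub> x = \<zero>\<^bsub>M\<^esub>}"

definition self_module :: "('a, 'r) ring_scheme \<Rightarrow> ('a, 'a) module"
  where "self_module R =
    \<lparr>carrier = carrier R, mult = mult R, one = one R, zero = zero R, add = add R, smult = mult R\<rparr>"

section \<open>The sets of isomorphism classes\<close>

text \<open>
  Isomorphism classes are taken within a fixed type of elements that is large enough to contain
  a copy of every structure in question: \<open>nat\<close> for finite groups, and \<open>padic \<times> nat\<close>, which has
  the cardinality of the continuum, for finitely generated modules over \<open>Zp p\<close>.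
\<close>

definition is_finite_abelian_p_group :: "nat \<Rightarrow> ('a, 'm) monoid_scheme \<Rightarrow> bool"
  where "is_finite_abelian_p_group p G \<longleftrightarrow>
    comm_group G \<and> finite (carrier G) \<and> (\<exists>n. card (carrier G) = p ^ n)"

definition X0 :: "nat \<Rightarrow> nat monoid set set"
  where "X0 p = {G. is_finite_abelian_p_group p G} //
    {(G, G'). is_finite_abelian_p_group p G \<and> is_finite_abelian_p_group p G' \<and> G \<cong> G'}"

definition is_fg_Zp_module_of_rank_1 :: "nat \<Rightarrow> (padic, 'b, 'm) module_scheme \<Rightarrow> bool"
  where "is_fg_Zp_module_of_rank_1 p H \<longleftrightarrow>
    module (Zp p) H \<and> finitely_generated_module (Zp p) H \<and> has_rank (Zp p) H 1"

type_synonym zp_module = "(padic, padic \<times> nat) module"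

definition X1 :: "nat \<Rightarrow> zp_module set set"
  where "X1 p = {H. is_fg_Zp_module_of_rank_1 p H} //
    {(H, H'). is_fg_Zp_module_of_rank_1 p H \<and> is_fg_Zp_module_of_rank_1 p H' \<and>
              module_iso (Zp p) H H' \<noteq> {}}"

definition rep :: "'a set \<Rightarrow> 'a"
  where "rep A = (SOME x. x \<in> A)"

section \<open>The random operator from X1 to X0\<close>

text \<open>The cosets of the \<open>p ^ n H\<close> form a basis of the p-adic topology on \<open>H\<close>.\<close>

definition padic_open :: "nat \<Rightarrow> (padic, 'b, 'm) module_scheme \<Rightarrow> 'b set \<Rightarrow> bool"
  where "padic_open p H U \<longleftrightarrow> U \<subseteq> carrier H \<and>
    (\<forall>x\<in>U. \<exists>n. \<forall>y\<in>carrier H. x \<oplus>\<^bsub>H\<^esub> [(p ^ n)] \<cdot>\<^bsub>H\<^esub> y \<in> U)"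

definition is_haar_prob :: "nat \<Rightarrow> (padic, 'b, 'm) module_scheme \<Rightarrow> 'b measure \<Rightarrow> bool"
  where "is_haar_prob p H \<mu> \<longleftrightarrow>
    space \<mu> = carrier H \<and> sets \<mu> = sigma_sets (carrier H) {U. padic_open p H U} \<and>
    prob_space \<mu> \<and>
    (\<forall>x\<in>carrier H. \<forall>A\<in>sets \<mu>. emeasure \<mu> (x <+\<^bsub>H\<^esub> A) = emeasure \<mu> A)"

text \<open>For a finitely generated module there is exactly one such measure.\<close>

definition haar :: "nat \<Rightarrow> (padic, 'b, 'm) module_scheme \<Rightarrow> 'b measure"
  where "haar p H = (SOME \<mu>. is_haar_prob p H \<mu>)"

text \<open>A random operator is given by its transition probabilities \<open>x \<mapsto> y \<mapsto> P(T(x) \<cong> y)\<close>.\<close>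

definition d_op :: "nat \<Rightarrow> zp_module set \<Rightarrow> nat monoid set \<Rightarrow> real"
  where "d_op p h g =
    measure (haar p (rep h))
      {x \<in> carrier (rep h). rep h A_Mod module_span (Zp p) (rep h) {x} \<cong> rep g}"

section \<open>The random operator from X0 to X1\<close>

text \<open>
  The unique structure of a module over \<open>Zp p\<close> on a finite abelian \<open>p\<close>-group \<open>G\<close> of order
  \<open>p ^ n\<close>: a \<open>p\<close>-adic integer acts through its residue modulo \<open>p ^ n\<close>.
\<close>

definition p_group_module :: "nat \<Rightarrow> ('b, 'm) monoid_scheme \<Rightarrow> (padic, 'b) module"
  where "p_group_module p G =
    \<lparr>carrier = carrier G, mult = mult G, one = one G, zero = one G, add = mult G,
     smult = (\<lambda>a g. g [^]\<^bsub>G\<^esub> a (multiplicity p (card (carrier G))))\<rparr>"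

lemma p_group_module_is_module:
  assumes "prime p" and G: "is_finite_abelian_p_group p G"
  shows "module (Zp p) (p_group_module p G)"
proof -
  interpret G: comm_group G
    using G by (simp add: is_finite_abelian_p_group_def)
  obtain k where k: "card (carrier G) = p ^ k"
    using G by (auto simp: is_finite_abelian_p_group_def)
  have mult_k: "multiplicity p (card (carrier G)) = k"
    using \<open>prime p\<close> k by (simp add: not_prime_unit multiplicity_same_power)
  have pow_mod: "g [^]\<^bsub>G\<^esub> (z mod int p ^ k) = g [^]\<^bsub>G\<^esub> z"
    if g: "g \<in> carrier G" for g and z :: int
  proof -
    have "g [^]\<^bsub>G\<^esub> (int p ^ k) = \<one>\<^bsub>G\<^esub>"
      using G.pow_order_eq_1[OF g] k by (metis Coset.order_def int_pow_int of_nat_power)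
    then have "g [^]\<^bsub>G\<^esub> (int p ^ k * (z div int p ^ k)) = \<one>\<^bsub>G\<^esub>"
      using g by (metis G.int_pow_one G.int_pow_pow)
    then show ?thesis
      using g by (metis G.int_pow_closed G.int_pow_mult G.l_one mult_div_mod_eq)
  qed
  show ?thesis
  proof (rule moduleI[OF Zp_cring])
    show "abelian_group (p_group_module p G)"
    proof (rule abelian_groupI)
      show "\<exists>y\<in>carrier (p_group_module p G).
          y \<oplus>\<^bsub>p_group_module p G\<^esub> x = \<zero>\<^bsub>p_group_module p G\<^esub>"
        if "x \<in> carrier (p_group_module p G)" for x
        using that G.l_inv_ex by (simp add: p_group_module_def)
    qed (simp_all add: p_group_module_def G.m_ac)
  qed (simp_all add: p_group_module_def mult_k pow_mod Zp_def G.int_pow_mult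
        G.int_pow_distrib G.int_pow_pow mult.commute)
qed

text \<open>
  An extension \<open>0 \<rightarrow> Zp \<rightarrow> E \<rightarrow> G \<rightarrow> 0\<close> is a triple \<open>(E, i, q)\<close>, and \<open>Ext(G, Zp)\<close> is the set of
  equivalence classes of extensions. Its group structure does not enter, because only the uniform
  distribution on it is used.
\<close>

type_synonym extension = "zp_module \<times> (padic \<Rightarrow> padic \<times> nat) \<times> (padic \<times> nat \<Rightarrow> nat)"

definition extensions :: "nat \<Rightarrow> nat monoid \<Rightarrow> extension set"
  where "extensions p G = {(E, i, q).
    module (Zp p) E \<and>
    i \<in> module_hom (Zp p) (self_module (Zp p)) E \<and>
    q \<in> module_hom (Zp p) E (p_group_module p G) \<and>
    inj_on i (carrier (Zp p)) \<and>
    i ` carrier (Zp p) = a_kernel E (p_group_module p G) q \<and>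
    q ` carrier E = carrier G}"

definition equivalent_extensions :: "nat \<Rightarrow> extension \<Rightarrow> extension \<Rightarrow> bool"
  where "equivalent_extensions p = (\<lambda>(E, i, q) (E', i', q').
    \<exists>\<phi>\<in>module_iso (Zp p) E E'.
      (\<forall>a\<in>carrier (Zp p). \<phi> (i a) = i' a) \<and> (\<forall>x\<in>carrier E. q' (\<phi> x) = q x))"

definition Ext :: "nat \<Rightarrow> nat monoid \<Rightarrow> extension set set"
  where "Ext p G = extensions p G //
    {(e, e'). e \<in> extensions p G \<and> e' \<in> extensions p G \<and> equivalent_extensions p e e'}"

definition dstar_op :: "nat \<Rightarrow> nat monoid set \<Rightarrow> zp_module set \<Rightarrow> real"
  where "dstar_op p g h =
    measure_pmf.prob (pmf_of_set (Ext p (rep g)))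
      {\<epsilon>. module_iso (Zp p) (fst (rep \<epsilon>)) (rep h) \<noteq> {}}"

section \<open>Measures, composition and self-adjointness\<close>

text \<open>Transition probabilities of first \<open>S\<close>, then (independently) \<open>T\<close>, with intermediate set \<open>Y\<close>.\<close>

definition op_comp ::
    "'b set \<Rightarrow> ('b \<Rightarrow> 'c \<Rightarrow> real) \<Rightarrow> ('a \<Rightarrow> 'b \<Rightarrow> real) \<Rightarrow> 'a \<Rightarrow> 'c \<Rightarrow> real"
  where "op_comp Y T S x z = (\<Sum>\<^sub>\<infinity>y\<in>Y. S x y * T y z)"

text \<open>The signed measure \<open>T \<nu>\<close>; a signed measure on a countable set is given by its point masses.\<close>

definition op_apply :: "'a set \<Rightarrow> ('a \<Rightarrow> 'b \<Rightarrow> real) \<Rightarrow> ('a \<Rightarrow> real) \<Rightarrow> 'b \<Rightarrow> real"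
  where "op_apply A T \<nu> y = (\<Sum>\<^sub>\<infinity>x\<in>A. \<nu> x * T x y)"

definition dd_star :: "nat \<Rightarrow> nat monoid set \<Rightarrow> nat monoid set \<Rightarrow> real"
  where "dd_star p = op_comp (X1 p) (d_op p) (dstar_op p)"

definition d_star_d :: "nat \<Rightarrow> zp_module set \<Rightarrow> zp_module set \<Rightarrow> real"
  where "d_star_d p = op_comp (X0 p) (dstar_op p) (d_op p)"

definition mu0 :: "nat \<Rightarrow> nat monoid set \<Rightarrow> real"
  where "mu0 p g = prodinf (\<lambda>i. 1 - 1 / real p ^ (i + 1)) / real (card (auto (rep g)))"

definition mu1 :: "nat \<Rightarrow> zp_module set \<Rightarrow> real"
  where "mu1 p h =
    (let T = torsion_part (Zp p) (rep h)
     in prodinf (\<lambda>i. 1 - 1 / real p ^ (i + 2)) /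
        (real (card T) * real (card (auto (add_monoid (rep h\<lparr>carrier := T\<rparr>))))))"

definition signed_measure_on :: "'a set \<Rightarrow> ('a \<Rightarrow> real) \<Rightarrow> bool"
  where "signed_measure_on A \<nu> \<longleftrightarrow> (\<lambda>x. \<bar>\<nu> x\<bar>) summable_on A"

definition inner_on :: "'a set \<Rightarrow> ('a \<Rightarrow> real) \<Rightarrow> ('a \<Rightarrow> real) \<Rightarrow> ('a \<Rightarrow> real) \<Rightarrow> real"
  where "inner_on A \<mu> \<nu> \<nu>' = (\<Sum>\<^sub>\<infinity>x\<in>A. \<nu> x * \<nu>' x / \<mu> x)"

definition inner_converges :: "'a set \<Rightarrow> ('a \<Rightarrow> real) \<Rightarrow> ('a \<Rightarrow> real) \<Rightarrow> ('a \<Rightarrow> real) \<Rightarrow> bool"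
  where "inner_converges A \<mu> \<nu> \<nu>' \<longleftrightarrow> (\<lambda>x. \<nu> x * \<nu>' x / \<mu> x) summable_on A"

definition square_summable :: "'a set \<Rightarrow> ('a \<Rightarrow> real) \<Rightarrow> ('a \<Rightarrow> real) \<Rightarrow> bool"
  where "square_summable A \<mu> \<nu> \<longleftrightarrow> signed_measure_on A \<nu> \<and> inner_converges A \<mu> \<nu> \<nu>"

text \<open>
  Since \<open>infsum\<close> of a non-summable family is \<open>0\<close>, the convergence of both sides is stated
  separately.
\<close>

definition self_adjoint_wrt :: "'a set \<Rightarrow> ('a \<Rightarrow> real) \<Rightarrow> ('a \<Rightarrow> 'a \<Rightarrow> real) \<Rightarrow> bool"
  where "self_adjoint_wrt A \<mu> T \<longleftrightarrow>
    (\<forall>\<nu> \<nu>'. square_summable A \<mu> \<nu> \<and> square_summable A \<mu> \<nu>' \<longrightarrow>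
       inner_converges A \<mu> (op_apply A T \<nu>) \<nu>' \<and>
       inner_converges A \<mu> \<nu> (op_apply A T \<nu>') \<and>
       inner_on A \<mu> (op_apply A T \<nu>) \<nu>' = inner_on A \<mu> \<nu> (op_apply A T \<nu>'))"

end

theory Submission
  imports Defs
begin

text \<open>
  The transition kernels satisfy detailed balance,
  \<open>\<mu>\<^sub>0(G) P(d\<^sup>*(G) \<cong> H) = \<mu>\<^sub>1(H) P(d(H) \<cong> G)\<close>, because both sides count the surjections from \<open>H\<close>
  to \<open>G\<close> with cyclic kernel. On the one hand, the generators of such a kernel have Haar measure
  \<open>(1 - 1/p) / |G|\<close>, and each kernel belongs to \<open>|Aut(G)|\<close> surjections. On the other hand, if the
  generator of the kernel is normalized, extensions with middle term \<open>H\<close> correspond to orbits of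
  surjections under the automorphisms of \<open>H\<close> that are the identity modulo the torsion submodule \<open>T\<close>.
  There are \<open>|T| |Aut(T)|\<close> of these, and they act freely. Finally \<open>|Ext(G, Zp)| = |G|\<close>: with
  \<open>p ^ n = |G|\<close>, every extension is the pullback of \<open>0 \<rightarrow> Zp \<rightarrow> Zp \<rightarrow> Zp / p ^ n \<rightarrow> 0\<close> along a unique
  character of \<open>G\<close> with values in \<open>Zp / p ^ n\<close>.

  A composition of two sub-stochastic kernels in detailed balance is a reversible sub-stochastic
  kernel. Then \<open>2fg \<le> f\<^sup>2 + g\<^sup>2\<close> makes the double sum behind the inner products absolutely convergent
  for square-summable measures, and it may be summed in either order.
\<close>

section \<open>Reversible sub-stochastic kernels\<close>

text \<open>An extension carries more than a surjection from \<open>H\<close> to \<open>G\<close>: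
  it also fixes a generator of the kernel, and the automorphisms of \<open>H\<close> act on both.
  Every automorphism preserves the torsion, so it scales the free coordinate by a unit; requiring
  the free coordinate of the generator to be a power of p uses up exactly this unit, which is why
  only automorphisms trivial modulo torsion remain. They act freely because the kernel is
  torsion-free and of finite index: two automorphisms with the same composite agree on the
  generator, and any difference between them would be a torsion element of the kernel. The factor 1
  - 1/p lost in passing from a cyclic kernel to its generators is the quotient
  \<open>c_0 / c_1\<close>, and the index \<open>|G|\<close> of the kernel is matched by
  \<open>|Ext(G, Zp)|\<close>. Finiteness of the set of surjections is itself a result; it is
  inherited from Ext. The free coordinate depends on a chosen splitting, the torsion does not. As
  \<open>haar\<close> is given by a choice operator, its values are derived from invariance alone,
  after one explicit model has shown that the choice is not void.\<close>

lemma summable_on_product_kernel: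
  fixes T :: "'a \<Rightarrow> 'b \<Rightarrow> real"
  assumes f: "f summable_on A" "\<And>x. x \<in> A \<Longrightarrow> f x \<ge> 0"
    and nonneg: "\<And>x y. x \<in> A \<Longrightarrow> y \<in> B \<Longrightarrow> T x y \<ge> 0"
    and row: "\<And>x. x \<in> A \<Longrightarrow> T x summable_on B" "\<And>x. x \<in> A \<Longrightarrow> infsum (T x) B \<le> 1"
  shows "(\<lambda>(x, y). f x * T x y) summable_on A \<times> B"
proof (rule summable_on_SigmaI)
  show "((\<lambda>y. case (x, y) of (x, y) \<Rightarrow> f x * T x y) has_sum f x * infsum (T x) B) B"
    if "x \<in> A" for x
    using row(1)[OF that] by (simp add: has_sum_cmult_right)
  show "(\<lambda>x. f x * infsum (T x) B) summable_on A"
  proof (rule summable_on_comparison_test[OF f(1)])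
    show "f x * infsum (T x) B \<le> f x" if "x \<in> A" for x
      using row(2)[OF that] f(2)[OF that] by (simp add: mult_left_le)
    show "0 \<le> f x * infsum (T x) B" if "x \<in> A" for x
      using f(2)[OF that] nonneg[OF that] by (simp add: infsum_nonneg)
  qed
qed (use f nonneg in auto)

text \<open>Both inner products are iterated sums of one family \<open>F\<close>, with
  \<open>x\<close> or \<open>y\<close> as the inner variable; \<open>balance\<close> moves the
  denominator from \<open>\<mu> y\<close> to \<open>\<mu> x\<close>. Absolute convergence on
  \<open>A \<times> A\<close> permits the exchange and also yields the convergence of both
  sides.\<close>

lemma self_adjoint_wrtI:
  fixes T :: "'a \<Rightarrow> 'a \<Rightarrow> real"
  assumes pos: "\<And>x. x \<in> A \<Longrightarrow> \<mu> x > 0"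
    and nonneg: "\<And>x y. x \<in> A \<Longrightarrow> y \<in> A \<Longrightarrow> T x y \<ge> 0"
    and row: "\<And>x. x \<in> A \<Longrightarrow> T x summable_on A" "\<And>x. x \<in> A \<Longrightarrow> infsum (T x) A \<le> 1"
    and balance: "\<And>x y. x \<in> A \<Longrightarrow> y \<in> A \<Longrightarrow> \<mu> x * T x y = \<mu> y * T y x"
  shows "self_adjoint_wrt A \<mu> T"
  unfolding self_adjoint_wrt_def
proof (intro allI impI, elim conjE)
  fix \<nu> \<nu>' :: "'a \<Rightarrow> real"
  assume \<nu>: "square_summable A \<mu> \<nu>" and \<nu>': "square_summable A \<mu> \<nu>'"
  define F where "F x y = \<nu> x * T x y * \<nu>' y / \<mu> y" for x y
  \<comment> \<open>The dominating family: row sums are at most 1, so square-summability of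
    \<open>\<xi>\<close> suffices.\<close>
  have weight: "(\<lambda>(x, y). \<xi> x * \<xi> x / \<mu> x * T x y) summable_on A \<times> A"
    if "square_summable A \<mu> \<xi>" for \<xi>
    using that pos nonneg row
    by (intro summable_on_product_kernel)
      (auto simp: square_summable_def inner_converges_def less_imp_le)
  have "(\<lambda>z. (case z of (x, y) \<Rightarrow> \<nu> x * \<nu> x / \<mu> x * T x y)
      + (case z of (x, y) \<Rightarrow> \<nu>' y * \<nu>' y / \<mu> y * T y x)) summable_on A \<times> A"
    using weight[OF \<nu>] weight[OF \<nu>', THEN summable_on_swap[THEN iffD1]]
    by (intro summable_on_add) (simp_all add: case_prod_unfold)
  moreover have "norm (case z of (x, y) \<Rightarrow> F x y) \<le>
      (case z of (x, y) \<Rightarrow> \<nu> x * \<nu> x / \<mu> x * T x y) + (case z of (x, y) \<Rightarrow> \<nu>' y * \<nu>' y / \<mu> y * T y x)"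
    if "z \<in> A \<times> A" for z
  proof -
    obtain x y where z: "z = (x, y)" "x \<in> A" "y \<in> A"
      using \<open>z \<in> A \<times> A\<close> by blast
    \<comment> \<open>\<open>m\<close> is the symmetric edge weight of the reversible kernel,
      \<open>f\<close> and \<open>g\<close> are absolute densities with respect to
      \<open>\<mu>\<close>; in these terms the bound is the arithmetic-geometric mean
      inequality.\<close>
    define m f g where "m = \<mu> x * T x y" and "f = \<bar>\<nu> x\<bar> / \<mu> x" and "g = \<bar>\<nu>' y\<bar> / \<mu> y"
    have m: "m \<ge> 0" "m = \<mu> y * T y x"
      using z pos[of x] nonneg[of x y] balance[of x y] by (simp_all add: m_def flip: balance)
    have "\<bar>F x y\<bar> = m * (f * g)"
      using z pos[of x] pos[of y] nonneg[of x y]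
      by (simp add: F_def m_def f_def g_def abs_mult abs_divide field_simps)
    also have "\<dots> \<le> m * (f * f + g * g)"
    proof (rule mult_left_mono[OF _ m(1)])
      have "f * g \<ge> 0"
        using pos z by (simp add: f_def g_def less_imp_le)
      with sum_squares_ge_zero[of "f - g" 0] show "f * g \<le> f * f + g * g"
        by (simp add: algebra_simps)
    qed
    also have "\<dots> = m * f * f + m * g * g"
      by (simp add: algebra_simps)
    also have "m * f * f = \<nu> x * \<nu> x / \<mu> x * T x y"
      using pos z by (simp add: m_def f_def)
    also have "m * g * g = \<nu>' y * \<nu>' y / \<mu> y * T y x"
      using pos z by (simp add: m(2) g_def)
    finally show ?thesis
      by (simp add: z)
  qed
  ultimately have "(\<lambda>z. norm (case z of (x, y) \<Rightarrow> F x y)) summable_on A \<times> A"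
    by (rule summable_on_comparison_test) auto
  then have F: "(\<lambda>(x, y). F x y) summable_on A \<times> A"
    by (rule abs_summable_summable)
  then have F': "(\<lambda>(y, x). F x y) summable_on A \<times> A"
    using summable_on_swap[THEN iffD1] by fastforce
  have 1: "op_apply A T \<nu> y * \<nu>' y / \<mu> y = (\<Sum>\<^sub>\<infinity>x\<in>A. F x y)" for y
    using infsum_cmult_left'[of "\<lambda>x. \<nu> x * T x y" "\<nu>' y / \<mu> y" A] by (simp add: op_apply_def F_def)
  have 2: "\<nu> x * op_apply A T \<nu>' x / \<mu> x = (\<Sum>\<^sub>\<infinity>y\<in>A. F x y)" if "x \<in> A" for x
  proof -
    have "F x y = \<nu> x / \<mu> x * (\<nu>' y * T y x)" if "y \<in> A" for y
      using balance[of x y] pos[of x] pos[of y] \<open>x \<in> A\<close> that by (simp add: F_def field_simps)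
    then have "(\<Sum>\<^sub>\<infinity>y\<in>A. F x y) = (\<Sum>\<^sub>\<infinity>y\<in>A. \<nu> x / \<mu> x * (\<nu>' y * T y x))"
      by (intro infsum_cong) auto
    then show ?thesis
      by (subst (asm) infsum_cmult_right') (simp add: op_apply_def)
  qed
  have 3: "(\<lambda>x. \<nu> x * op_apply A T \<nu>' x / \<mu> x) summable_on A"
    using summable_on_Sigma_banach[OF F] by (simp add: 2 cong: summable_on_cong)
  have 4: "(\<lambda>x. op_apply A T \<nu> x * \<nu>' x / \<mu> x) summable_on A"
    using summable_on_Sigma_banach[OF F'] by (simp add: 1)
  show "inner_converges A \<mu> (op_apply A T \<nu>) \<nu>' \<and>
       inner_converges A \<mu> \<nu> (op_apply A T \<nu>') \<and>
       inner_on A \<mu> (op_apply A T \<nu>) \<nu>' = inner_on A \<mu> \<nu> (op_apply A T \<nu>')"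
    using 3 4 infsum_swap_banach[OF F]
    by (simp add: inner_converges_def inner_on_def 1 2 cong: infsum_cong)
qed

text \<open>By \<open>balance\<close>, \<open>\<mu> x\<close> times the weight of the path from
  \<open>x\<close> through \<open>y\<close> to \<open>x'\<close> becomes
  \<open>m y * L y x * L y x'\<close>, which is symmetric in the endpoints. The two halves of the
  theorem are the two ways of assigning the roles of \<open>K\<close> and \<open>L\<close>.\<close>

lemma self_adjoint_wrt_op_comp:
  fixes K :: "'a \<Rightarrow> 'b \<Rightarrow> real" and L :: "'b \<Rightarrow> 'a \<Rightarrow> real"
  assumes pos: "\<And>x. x \<in> A \<Longrightarrow> \<mu> x > 0" "\<And>y. y \<in> B \<Longrightarrow> m y > 0"
    and nonneg: "\<And>x y. K x y \<ge> 0" "\<And>y x. L y x \<ge> 0"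
    and K: "\<And>x. x \<in> A \<Longrightarrow> K x summable_on B" "\<And>x. x \<in> A \<Longrightarrow> infsum (K x) B \<le> 1"
    and L: "\<And>y. y \<in> B \<Longrightarrow> L y summable_on A" "\<And>y. y \<in> B \<Longrightarrow> infsum (L y) A \<le> 1"
    and balance: "\<And>x y. x \<in> A \<Longrightarrow> y \<in> B \<Longrightarrow> \<mu> x * K x y = m y * L y x"
  shows "self_adjoint_wrt A \<mu> (op_comp B L K)"
proof (rule self_adjoint_wrtI)
  have KL: "(\<lambda>(y, x'). K x y * L y x') summable_on B \<times> A" if "x \<in> A" for x
    using that nonneg K L by (intro summable_on_product_kernel) auto
  then have LK: "(\<lambda>(x', y). K x y * L y x') summable_on A \<times> B" if "x \<in> A" for x
    using that by (subst summable_on_swap) simp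
  show "op_comp B L K x summable_on A" if "x \<in> A" for x
    using summable_on_Sigma_banach[OF LK[OF that]] unfolding op_comp_def .
  show "infsum (op_comp B L K x) A \<le> 1" if "x \<in> A" for x
  proof -
    have "infsum (op_comp B L K x) A = (\<Sum>\<^sub>\<infinity>y\<in>B. \<Sum>\<^sub>\<infinity>x'\<in>A. K x y * L y x')"
      unfolding op_comp_def using infsum_swap_banach[OF LK[OF that]] .
    also have "\<dots> \<le> infsum (K x) B"
    proof (rule infsum_mono)
      show "(\<lambda>y. \<Sum>\<^sub>\<infinity>x'\<in>A. K x y * L y x') summable_on B"
        using summable_on_Sigma_banach[OF KL[OF that]] .
      show "(\<Sum>\<^sub>\<infinity>x'\<in>A. K x y * L y x') \<le> K x y" if "y \<in> B" for y
        using L(2)[OF that] nonneg(1) by (simp add: infsum_cmult_right' mult_left_le)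
    qed (use K that in auto)
    finally show ?thesis
      using K(2)[OF that] by linarith
  qed
  show "\<mu> x * op_comp B L K x x' = \<mu> x' * op_comp B L K x' x" if "x \<in> A" "x' \<in> A" for x x'
  proof -
    have "\<mu> x * (K x y * L y x') = \<mu> x' * (K x' y * L y x)" if "y \<in> B" for y
    proof -
      have "\<mu> x * (K x y * L y x') = m y * L y x * L y x'"
        using balance[OF \<open>x \<in> A\<close> that] by simp
      also have "\<dots> = \<mu> x' * (K x' y * L y x)"
        using balance[OF \<open>x' \<in> A\<close> that, symmetric] by (simp add: mult_ac)
      finally show ?thesis .
    qed
    then show ?thesis
      unfolding op_comp_def by (simp flip: infsum_cmult_right' cong: infsum_cong)
  qed
qed (auto simp: op_comp_def nonneg pos intro!: infsum_nonneg)

text \<open>This bounds the rows of both kernels: their entries are probabilities of pairwise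
  disjoint events, one for each isomorphism class.\<close>

lemma
  fixes A :: "'i \<Rightarrow> 'b set"
  assumes "prob_space M"
    and disj: "disjoint_family_on A I"
  shows summable_on_measure_disjoint: "(\<lambda>i. measure M (A i)) summable_on I"
    and infsum_measure_disjoint_le_1: "(\<Sum>\<^sub>\<infinity>i\<in>I. measure M (A i)) \<le> 1"
proof -
  interpret prob_space M by fact
  have *: "(\<Sum>i\<in>F. measure M (A i)) \<le> 1" if "finite F" "F \<subseteq> I" for F
  proof -
    \<comment> \<open>Non-measurable sets have \<open>measure\<close> 0 by convention, so they drop
      out of the sum.\<close>
    define F' where "F' = {i \<in> F. A i \<in> sets M}"
    have "(\<Sum>i\<in>F. measure M (A i)) = (\<Sum>i\<in>F'. measure M (A i))"
      using \<open>finite F\<close> unfolding F'_def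
      by (intro sum.mono_neutral_right) (auto simp: measure_notin_sets)
    also have "\<dots> = measure M (\<Union>i\<in>F'. A i)"
      using that disj by (intro finite_measure_finite_Union[symmetric])
        (auto simp: F'_def disjoint_family_on_def)
    also have "\<dots> \<le> 1"
      by simp
    finally show ?thesis .
  qed
  show summable: "(\<lambda>i. measure M (A i)) summable_on I"
    by (rule nonneg_bdd_above_summable_on) (auto intro!: bdd_aboveI2[of _ _ 1] *)
  show "(\<Sum>\<^sub>\<infinity>i\<in>I. measure M (A i)) \<le> 1"
    using summable * by (rule infsum_le_finite_sums)
qed

text \<open>The second claim is \<open>c_0 = (1 - 1/p) c_1\<close>; the ratio reappears as the Haar
  share of the generators in a cyclic kernel. Positivity: the partial products are nonnegative, and
  a convergent product with nonzero factors has a nonzero limit.\<close>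

lemma prodinf_one_minus_inverse_powers:
  assumes "p \<ge> 2"
  shows "prodinf (\<lambda>i. 1 - 1 / real p ^ (i + 2)) > 0"
    and "prodinf (\<lambda>i. 1 - 1 / real p ^ (i + 1)) =
      (1 - 1 / real p) * prodinf (\<lambda>i. 1 - 1 / real p ^ (i + 2))"
proof -
  have lt: "1 / real p ^ (i + 1) < 1" for i
    using assms one_less_power[of "real p" "i + 1"] by (simp del: power_Suc)
  have "summable (\<lambda>i. (1 / real p) ^ (i + 1))"
    using assms by (intro summable_ignore_initial_segment summable_geometric) simp
  then have "abs_convergent_prod (\<lambda>i. 1 + - (1 / real p ^ (i + 1)))"
    by (subst abs_convergent_prod_conv_summable) (simp_all add: power_divide del: power_Suc)
  then have conv: "convergent_prod (\<lambda>i. 1 - 1 / real p ^ (i + 1))"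
    using abs_convergent_prod_imp_convergent_prod by fastforce
  have "(\<lambda>i. 1 - 1 / real p ^ (i + 1)) has_prod prodinf (\<lambda>i. 1 - 1 / real p ^ (i + 1))"
    using conv convergent_prod_has_prod by blast
  show "prodinf (\<lambda>i. 1 - 1 / real p ^ (i + 1)) =
      (1 - 1 / real p) * prodinf (\<lambda>i. 1 - 1 / real p ^ (i + 2))"
    using prodinf_split_head[OF conv] lt[of 0] assms by (simp add: field_simps)
  have "convergent_prod (\<lambda>i. 1 - 1 / real p ^ (Suc i + 1))"
    using conv by (subst convergent_prod_Suc_iff)
  then have conv': "convergent_prod (\<lambda>i. 1 - 1 / real p ^ (i + 2))"
    by simp
  have pos: "1 - 1 / real p ^ (i + 2) > 0" for i
    using lt[of "Suc i"] by simp
  have "prodinf (\<lambda>i. 1 - 1 / real p ^ (i + 2)) \<noteq> 0"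
    using pos by (intro prodinf_nonzero[OF conv']) (metis less_irrefl)
  moreover have "prodinf (\<lambda>i. 1 - 1 / real p ^ (i + 2)) \<ge> 0"
    using pos by (intro LIMSEQ_le_const[OF convergent_prod_LIMSEQ[OF conv']] exI allI impI prod_nonneg)
      (metis less_imp_le)
  ultimately show "prodinf (\<lambda>i. 1 - 1 / real p ^ (i + 2)) > 0"
    by simp
qed

section \<open>Arithmetic of the p-adic integers\<close>

definition zp_of_int :: "nat \<Rightarrow> int \<Rightarrow> padic"
  where "zp_of_int p z = (\<lambda>n. z mod int p ^ n)"

abbreviation zp_power :: "nat \<Rightarrow> nat \<Rightarrow> padic"
  where "zp_power p n \<equiv> zp_of_int p (int p ^ n)"

lemma zp_of_int_apply: "zp_of_int p z n = z mod int p ^ n"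
  by (simp add: zp_of_int_def)

lemma zp_of_int_closed [simp, intro]: "zp_of_int p z \<in> carrier (Zp p)"
  by (auto simp: zp_of_int_def Zp_def mod_mod_cancel le_imp_power_dvd)

lemma zp_of_int_add: "zp_of_int p x \<oplus>\<^bsub>Zp p\<^esub> zp_of_int p y = zp_of_int p (x + y)"
  by (simp add: zp_of_int_def Zp_def mod_add_eq)

lemma zp_of_int_mult: "zp_of_int p x \<otimes>\<^bsub>Zp p\<^esub> zp_of_int p y = zp_of_int p (x * y)"
  by (simp add: zp_of_int_def Zp_def mod_mult_eq)

lemma zp_of_int_0: "zp_of_int p 0 = \<zero>\<^bsub>Zp p\<^esub>"
  by (simp add: zp_of_int_def Zp_def)

lemma zp_of_int_1: "zp_of_int p 1 = \<one>\<^bsub>Zp p\<^esub>"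
  by (simp add: zp_of_int_def Zp_def)

text \<open>At a level \<open>n\<close> with \<open>p ^ n\<close> larger than
  \<open>\<bar>x - y\<bar>\<close>, congruence already forces equality.\<close>

lemma zp_of_int_eq_iff:
  assumes "p \<ge> 2"
  shows "zp_of_int p x = zp_of_int p y \<longleftrightarrow> x = y"
proof
  assume eq: "zp_of_int p x = zp_of_int p y"
  obtain n where "\<bar>x - y\<bar> < int 2 ^ n"
    by (metis of_nat_numeral nat_int of_nat_less_two_power of_nat_power zabs_less_one_iff nat_0_le abs_ge_zero)
  also have "\<dots> \<le> int p ^ n"
    using assms by (intro power_mono) auto
  finally have "\<bar>x - y\<bar> < int p ^ n" .
  moreover have "int p ^ n dvd x - y"
    using fun_cong[OF eq, of n] by (simp add: zp_of_int_apply mod_eq_dvd_iff)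
  ultimately show "x = y"
    by (metis dvd_imp_le_int abs_of_nat eq_iff_diff_eq_0 not_le of_nat_power)
qed simp

context
  fixes p :: nat
  assumes prime_p: "prime p"
begin

interpretation R: cring "Zp p"
  by (rule Zp_cring)

lemma Zp_apply_0:
  assumes "a \<in> carrier (Zp p)"
  shows "a 0 = 0"
  using Zp_mod_self[OF assms, of 0] by simp

lemma Zp_apply_bounds:
  assumes "a \<in> carrier (Zp p)"
  shows "0 \<le> a n" "a n < int p ^ n"
proof -
  have "a n mod int p ^ n = a n" "int p ^ n > 0"
    using Zp_mod_self[OF assms] prime_gt_0_nat[OF prime_p] by auto
  then show "0 \<le> a n" "a n < int p ^ n"
    by (metis pos_mod_sign, metis pos_mod_bound)
qed

text \<open>Division by \<open>p ^ n\<close> shifts the residue sequence: the quotient modulo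
  \<open>p ^ m\<close> is read off from the residue of \<open>a\<close> modulo
  \<open>p ^ (n + m)\<close>.\<close>

lemma Zp_dividesE:
  assumes a: "a \<in> carrier (Zp p)" and "a n = 0"
  obtains b where "b \<in> carrier (Zp p)" "a = zp_power p n \<otimes>\<^bsub>Zp p\<^esub> b"
proof
  define b where "b m = a (n + m) div int p ^ n" for m
  have p: "int p ^ k > 0" for k
    using prime_gt_0_nat[OF prime_p] by simp
  show "b \<in> carrier (Zp p)"
  proof -
    have "b m' mod int p ^ m = b m" if "m \<le> m'" for m m'
    proof -
      have "a (n + m) = a (n + m') mod (int p ^ n * int p ^ m)"
        using Zp_carrierD[OF a, of "n + m" "n + m'"] that by (simp add: power_add)
      then show ?thesis
        using p by (simp add: b_def zmod_zmult2_eq)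
    qed
    then show ?thesis
      by (simp add: Zp_def)
  qed
  have "int p ^ n * b m = a (n + m)" for m
    using Zp_carrierD[OF a, of n "n + m"] \<open>a n = 0\<close>
    by (metis b_def le_add1 dvd_mult_div_cancel dvd_eq_mod_eq_0)
  then show "a = zp_power p n \<otimes>\<^bsub>Zp p\<^esub> b"
    using Zp_carrierD[OF a] by (auto simp: Zp_def zp_of_int_def mod_mult_left_eq)
qed

lemma Zp_approxE:
  assumes a: "a \<in> carrier (Zp p)"
  obtains b where "b \<in> carrier (Zp p)"
    "a = zp_of_int p (a n) \<oplus>\<^bsub>Zp p\<^esub> zp_power p n \<otimes>\<^bsub>Zp p\<^esub> b"
proof -
  define c where "c = a \<oplus>\<^bsub>Zp p\<^esub> zp_of_int p (- a n)"
  have "c \<in> carrier (Zp p)" "c n = 0"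
    using a by (auto simp: c_def) (simp add: Zp_def zp_of_int_def mod_add_right_eq)
  then obtain b where b: "b \<in> carrier (Zp p)" "c = zp_power p n \<otimes>\<^bsub>Zp p\<^esub> b"
    by (rule Zp_dividesE)
  have "zp_of_int p (a n) \<oplus>\<^bsub>Zp p\<^esub> c = a \<oplus>\<^bsub>Zp p\<^esub> (zp_of_int p (a n) \<oplus>\<^bsub>Zp p\<^esub> zp_of_int p (- a n))"
    using a by (simp add: c_def R.a_ac)
  then have "a = zp_of_int p (a n) \<oplus>\<^bsub>Zp p\<^esub> c"
    using a by (simp add: zp_of_int_add zp_of_int_0)
  with b show ?thesis
    using that by blast
qed

lemma zp_power_nonzero: "zp_power p n \<noteq> \<zero>\<^bsub>Zp p\<^esub>"
  using zp_of_int_eq_iff[OF prime_ge_2_nat[OF prime_p], of "int p ^ n" 0] prime_gt_0_nat[OF prime_p]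
  by (auto simp: zp_of_int_0)

lemma Zp_congE:
  assumes a: "a \<in> carrier (Zp p)" and b: "b \<in> carrier (Zp p)" and "a n = b n"
  obtains c where "c \<in> carrier (Zp p)" "a = b \<oplus>\<^bsub>Zp p\<^esub> zp_power p n \<otimes>\<^bsub>Zp p\<^esub> c"
proof -
  let ?z = "zp_of_int p (a n)"
  obtain s where s: "s \<in> carrier (Zp p)" "a = ?z \<oplus>\<^bsub>Zp p\<^esub> zp_power p n \<otimes>\<^bsub>Zp p\<^esub> s"
    using Zp_approxE[OF a] by blast
  obtain t where t: "t \<in> carrier (Zp p)" "b = ?z \<oplus>\<^bsub>Zp p\<^esub> zp_power p n \<otimes>\<^bsub>Zp p\<^esub> t"
    using Zp_approxE[OF b] \<open>a n = b n\<close> by metis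
  have "zp_power p n \<otimes>\<^bsub>Zp p\<^esub> t \<oplus>\<^bsub>Zp p\<^esub> zp_power p n \<otimes>\<^bsub>Zp p\<^esub> (\<ominus>\<^bsub>Zp p\<^esub> t \<oplus>\<^bsub>Zp p\<^esub> s) = zp_power p n \<otimes>\<^bsub>Zp p\<^esub> s"
    using s(1) t(1) by (simp add: R.r_distr R.r_minus R.r_neg2)
  then have "b \<oplus>\<^bsub>Zp p\<^esub> zp_power p n \<otimes>\<^bsub>Zp p\<^esub> (\<ominus>\<^bsub>Zp p\<^esub> t \<oplus>\<^bsub>Zp p\<^esub> s) = ?z \<oplus>\<^bsub>Zp p\<^esub> zp_power p n \<otimes>\<^bsub>Zp p\<^esub> s"
    using s(1) t(1) by (subst t(2)) (simp add: R.a_assoc)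
  then show ?thesis
    using s t(1) that[of "\<ominus>\<^bsub>Zp p\<^esub> t \<oplus>\<^bsub>Zp p\<^esub> s"] by simp
qed

text \<open>The factor \<open>p ^ n\<close> costs exactly \<open>n\<close> levels of precision:
  level \<open>n + m\<close> of the product controls level \<open>m\<close> of
  \<open>a\<close>.\<close>

lemma Zp_power_mult_eq_0:
  assumes a: "a \<in> carrier (Zp p)" and 0: "zp_power p n \<otimes>\<^bsub>Zp p\<^esub> a = \<zero>\<^bsub>Zp p\<^esub>"
  shows "a = \<zero>\<^bsub>Zp p\<^esub>"
proof -
  have "a m = 0" for m
  proof -
    have "int p ^ (n + m) dvd int p ^ n * a (n + m)"
      using fun_cong[OF 0, of "n + m"] by (simp add: Zp_def zp_of_int_def mod_mult_left_eq dvd_eq_mod_eq_0)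
    then have "int p ^ m dvd a (n + m)"
      using prime_gt_0_nat[OF prime_p] by (simp add: power_add)
    then show ?thesis
      using Zp_carrierD[OF a, of m "n + m"] by (simp add: dvd_eq_mod_eq_0)
  qed
  then show ?thesis
    by (auto simp: Zp_def)
qed

text \<open>A nonzero residue modulo \<open>p\<close> makes all residues of positive level coprime
  to \<open>p\<close>, so Bezout gives an inverse at each level. The inverses are compatible because
  an inverse modulo \<open>p ^ m\<close> is unique.\<close>

lemma Zp_UnitsI:
  assumes a: "a \<in> carrier (Zp p)" and "a 1 \<noteq> 0"
  shows "a \<in> Units (Zp p)"
proof -
  have "\<exists>x. (a n * x) mod int p ^ n = 1 mod int p ^ n" for n
  proof (cases n)
    case (Suc m)
    have "a n mod int p = a 1"
      using Zp_carrierD[OF a, of 1 n] Suc by simp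
    with \<open>a 1 \<noteq> 0\<close> have "\<not> int p dvd a n"
      by (auto simp: dvd_eq_mod_eq_0)
    then have "coprime (a n) (int p ^ n)"
      using prime_p by (simp add: prime_imp_coprime coprime_commute)
    then obtain u v where "a n * u + int p ^ n * v = 1"
      by (metis coprime_imp_gcd_eq_1 bezout_int mult.commute)
    then have "(a n * u) mod int p ^ n = 1 mod int p ^ n"
      by (metis mod_mult_self2)
    then show ?thesis ..
  qed simp
  then obtain f where f: "\<And>n. (a n * f n) mod int p ^ n = 1 mod int p ^ n"
    by metis
  define b where "b n = f n mod int p ^ n" for n
  have ab: "(a n * b n) mod int p ^ n = 1 mod int p ^ n" for n
    using f by (simp add: b_def mod_mult_right_eq)
  have "b n mod int p ^ m = b m" if "m \<le> n" for m n
  proof -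
    have dvd: "int p ^ m dvd int p ^ n"
      using that by (rule le_imp_power_dvd)
    have "(a m * b n) mod int p ^ m = (a n * b n) mod int p ^ n mod int p ^ m"
      using Zp_carrierD[OF a that] mod_mod_cancel[OF dvd] by (metis mod_mult_left_eq)
    also have "\<dots> = 1 mod int p ^ m"
      using ab mod_mod_cancel[OF dvd] by metis
    finally have 1: "(a m * b n) mod int p ^ m = 1 mod int p ^ m" .
    have "b n mod int p ^ m = (b n * (a m * b m)) mod int p ^ m"
      using ab by (metis mod_mult_right_eq mult_1_right)
    also have "\<dots> = (b m * (a m * b n)) mod int p ^ m"
      by (simp add: mult_ac)
    also have "\<dots> = b m mod int p ^ m"
      using 1 by (metis mod_mult_right_eq mult_1_right)
    finally show ?thesis
      by (simp add: b_def)
  qed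
  then have "b \<in> carrier (Zp p)"
    by (simp add: Zp_def)
  moreover have "a \<otimes>\<^bsub>Zp p\<^esub> b = \<one>\<^bsub>Zp p\<^esub>"
    using ab by (simp add: Zp_def)
  ultimately show ?thesis
    using a R.m_comm unfolding Units_def by force
qed

text \<open>The exponent is one less than the first level with a nonzero residue. If the cofactor
  had zero residue modulo \<open>p\<close>, another \<open>p\<close> could be extracted and that
  level would have residue zero too.\<close>

lemma Zp_factorE:
  assumes a: "a \<in> carrier (Zp p)" and "a \<noteq> \<zero>\<^bsub>Zp p\<^esub>"
  obtains k u where "u \<in> Units (Zp p)" "a = zp_power p k \<otimes>\<^bsub>Zp p\<^esub> u"
proof -
  have "\<exists>n. a n \<noteq> 0"
    using \<open>a \<noteq> \<zero>\<^bsub>Zp p\<^esub>\<close> by (auto simp: Zp_def)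
  then obtain n where n: "a n \<noteq> 0" "\<And>m. m < n \<Longrightarrow> a m = 0"
    using exists_least_iff[of "\<lambda>n. a n \<noteq> 0"] by auto
  then obtain k where k: "n = Suc k"
    using Zp_apply_0[OF a] by (cases n) auto
  obtain u where u: "u \<in> carrier (Zp p)" "a = zp_power p k \<otimes>\<^bsub>Zp p\<^esub> u"
    using Zp_dividesE[OF a, of k] n k by auto
  have "u 1 \<noteq> 0"
  proof
    assume "u 1 = 0"
    then obtain v where v: "v \<in> carrier (Zp p)" "u = zp_power p 1 \<otimes>\<^bsub>Zp p\<^esub> v"
      using Zp_dividesE[OF u(1)] by blast
    have "a = zp_power p n \<otimes>\<^bsub>Zp p\<^esub> v"
      using u v k by (simp add: R.m_assoc[symmetric] zp_of_int_mult mult.commute)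
    then have "a n = 0"
      by (simp add: Zp_def zp_of_int_def)
    with n show False
      by simp
  qed
  with u that show ?thesis
    using Zp_UnitsI by blast
qed

lemma Zp_domain: "domain (Zp p)"
proof (rule domain.intro[OF Zp_cring], unfold_locales)
  have "\<one>\<^bsub>Zp p\<^esub> 1 \<noteq> \<zero>\<^bsub>Zp p\<^esub> 1"
    using prime_gt_1_nat[OF prime_p] by (simp add: Zp_def)
  then show "\<one>\<^bsub>Zp p\<^esub> \<noteq> \<zero>\<^bsub>Zp p\<^esub>"
    by metis
  fix a b assume ab: "a \<otimes>\<^bsub>Zp p\<^esub> b = \<zero>\<^bsub>Zp p\<^esub>" "a \<in> carrier (Zp p)" "b \<in> carrier (Zp p)"
  show "a = \<zero>\<^bsub>Zp p\<^esub> \<or> b = \<zero>\<^bsub>Zp p\<^esub>"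
  proof (rule disj_imp[THEN iffD2, rule_format])
    assume "a \<noteq> \<zero>\<^bsub>Zp p\<^esub>"
    then obtain k u where u: "u \<in> Units (Zp p)" "a = zp_power p k \<otimes>\<^bsub>Zp p\<^esub> u"
      using Zp_factorE ab by metis
    then have "u \<otimes>\<^bsub>Zp p\<^esub> b = \<zero>\<^bsub>Zp p\<^esub>"
      using ab Zp_power_mult_eq_0[of "u \<otimes>\<^bsub>Zp p\<^esub> b" k] by (simp add: R.m_assoc R.Units_closed)
    then have "inv\<^bsub>Zp p\<^esub> u \<otimes>\<^bsub>Zp p\<^esub> (u \<otimes>\<^bsub>Zp p\<^esub> b) = \<zero>\<^bsub>Zp p\<^esub>"
      using u by simp
    then show "b = \<zero>\<^bsub>Zp p\<^esub>"
      using u ab by (simp add: R.m_assoc[symmetric] R.Units_closed)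
  qed
qed

text \<open>Uniqueness of the p-adic valuation: if the exponents differed, cancelling the smaller
  power would make a multiple of \<open>p\<close> invertible. This is the source of the uniqueness
  of normalized generators and of the rigidity of maps between them.\<close>

lemma Zp_power_eq_Units_mult:
  assumes u: "u \<in> carrier (Zp p)" "v \<in> carrier (Zp p)" "u \<otimes>\<^bsub>Zp p\<^esub> v = \<one>\<^bsub>Zp p\<^esub>"
    and eq: "zp_power p k \<otimes>\<^bsub>Zp p\<^esub> u = zp_power p l"
  shows "u = \<one>\<^bsub>Zp p\<^esub>" "k = l"
proof -
  interpret domain "Zp p"
    by (rule Zp_domain)
  have apply1: "(zp_power p (Suc n) \<otimes>\<^bsub>Zp p\<^esub> a) 1 = 0" for n a
    by (simp add: Zp_def zp_of_int_def)
  have split: "zp_power p (m + n) = zp_power p m \<otimes>\<^bsub>Zp p\<^esub> zp_power p n" for m n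
    by (simp add: zp_of_int_mult power_add)
  have one1: "\<one>\<^bsub>Zp p\<^esub> 1 = 1"
    using prime_ge_2_nat[OF prime_p] by (simp add: Zp_def)
  consider "k = l" | n where "l = k + Suc n" | n where "k = l + Suc n"
    by (metis less_imp_Suc_add add_Suc_right linorder_neqE_nat)
  then have "u = \<one>\<^bsub>Zp p\<^esub> \<and> k = l"
  proof cases
    case 1
    then have "zp_power p k \<otimes>\<^bsub>Zp p\<^esub> u = zp_power p k \<otimes>\<^bsub>Zp p\<^esub> \<one>\<^bsub>Zp p\<^esub>"
      using eq by simp
    then show ?thesis
      using m_lcancel[of "zp_power p k" u "\<one>\<^bsub>Zp p\<^esub>"] u zp_power_nonzero[of k] 1 by simp
  next
    case 2
    then have "zp_power p k \<otimes>\<^bsub>Zp p\<^esub> u = zp_power p k \<otimes>\<^bsub>Zp p\<^esub> zp_power p (Suc n)"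
      using eq split[of k "Suc n"] by (simp del: power_Suc)
    then have "u = zp_power p (Suc n)"
      using m_lcancel[of "zp_power p k" u "zp_power p (Suc n)"] u zp_power_nonzero[of k] by (simp del: power_Suc)
    then show ?thesis
      using apply1[of n v] one1 u(3) by simp
  next
    case 3
    then have "zp_power p l \<otimes>\<^bsub>Zp p\<^esub> (zp_power p (Suc n) \<otimes>\<^bsub>Zp p\<^esub> u) = zp_power p l \<otimes>\<^bsub>Zp p\<^esub> \<one>\<^bsub>Zp p\<^esub>"
      using eq split[of l "Suc n"] u by (simp add: R.m_assoc del: power_Suc)
    then have "zp_power p (Suc n) \<otimes>\<^bsub>Zp p\<^esub> u = \<one>\<^bsub>Zp p\<^esub>"
      using m_lcancel[of "zp_power p l" "zp_power p (Suc n) \<otimes>\<^bsub>Zp p\<^esub> u" "\<one>\<^bsub>Zp p\<^esub>"] u zp_power_nonzero[of l]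
      by (simp del: power_Suc)
    then show ?thesis
      using apply1[of n u] one1 by simp
  qed
  then show "u = \<one>\<^bsub>Zp p\<^esub>" "k = l"
    by auto
qed

end

section \<open>Modules over the p-adic integers\<close>

lemma module_homI:
  assumes "\<And>x. x \<in> carrier M \<Longrightarrow> h x \<in> carrier N"
    and "\<And>x y. x \<in> carrier M \<Longrightarrow> y \<in> carrier M \<Longrightarrow> h (x \<oplus>\<^bsub>M\<^esub> y) = h x \<oplus>\<^bsub>N\<^esub> h y"
    and "\<And>a x. a \<in> carrier R \<Longrightarrow> x \<in> carrier M \<Longrightarrow> h (a \<odot>\<^bsub>M\<^esub> x) = a \<odot>\<^bsub>N\<^esub> h x"
  shows "h \<in> module_hom R M N"
  using assms by (auto simp: module_hom_def hom_def)

lemma module_homD: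
  assumes "h \<in> module_hom R M N"
  shows "x \<in> carrier M \<Longrightarrow> h x \<in> carrier N"
    and "x \<in> carrier M \<Longrightarrow> y \<in> carrier M \<Longrightarrow> h (x \<oplus>\<^bsub>M\<^esub> y) = h x \<oplus>\<^bsub>N\<^esub> h y"
    and "a \<in> carrier R \<Longrightarrow> x \<in> carrier M \<Longrightarrow> h (a \<odot>\<^bsub>M\<^esub> x) = a \<odot>\<^bsub>N\<^esub> h x"
  using assms by (auto simp: module_hom_def hom_def)

lemma module_hom_zero:
  assumes "module R M" "module R N" "h \<in> module_hom R M N"
  shows "h \<zero>\<^bsub>M\<^esub> = \<zero>\<^bsub>N\<^esub>"
proof -
  interpret M: module R M by fact
  interpret N: module R N by fact
  have "h (\<zero>\<^bsub>R\<^esub> \<odot>\<^bsub>M\<^esub> \<zero>\<^bsub>M\<^esub>) = \<zero>\<^bsub>R\<^esub> \<odot>\<^bsub>N\<^esub> h \<zero>\<^bsub>M\<^esub>"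
    by (intro module_homD(3)[OF assms(3)]) simp_all
  then show ?thesis
    using module_homD(1)[OF assms(3)] by simp
qed

lemma module_hom_compose:
  assumes "f \<in> module_hom R L M" "g \<in> module_hom R M N"
  shows "(\<lambda>x. g (f x)) \<in> module_hom R L N"
  using module_homD[OF assms(1)] module_homD[OF assms(2)] by (intro module_homI) simp_all

lemma module_iso_refl: "(\<lambda>x. x) \<in> module_iso R M M"
  by (simp add: module_iso_def module_hom_def hom_def bij_betw_def inj_on_def)

lemma module_iso_compose:
  assumes "f \<in> module_iso R L M" "g \<in> module_iso R M N"
  shows "(\<lambda>x. g (f x)) \<in> module_iso R L N"
proof -
  have "bij_betw (g \<circ> f) (carrier L) (carrier N)"
    using assms by (auto simp: module_iso_def intro: bij_betw_trans)
  then show ?thesis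
    using assms module_hom_compose[of f R L M g N] by (simp add: module_iso_def comp_def)
qed

lemma module_iso_inv_into:
  assumes "module R M" and f: "f \<in> module_iso R M N"
  shows "inv_into (carrier M) f \<in> module_iso R N M"
proof -
  interpret M: module R M by fact
  have hom: "f \<in> module_hom R M N" and bij: "bij_betw f (carrier M) (carrier N)"
    using f by (auto simp: module_iso_def)
  define g where "g = inv_into (carrier M) f"
  have g: "g y \<in> carrier M" "f (g y) = y" if "y \<in> carrier N" for y
    using that bij by (auto simp: g_def bij_betw_def inv_into_into f_inv_into_f)
  have gf: "g (f x) = x" if "x \<in> carrier M" for x
    using that bij by (simp add: g_def bij_betw_def)
  have "g \<in> module_hom R N M"
  proof (rule module_homI)
    show "g (x \<oplus>\<^bsub>N\<^esub> y) = g x \<oplus>\<^bsub>M\<^esub> g y" if "x \<in> carrier N" "y \<in> carrier N" for x y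
      using that g gf[of "g x \<oplus>\<^bsub>M\<^esub> g y"] by (simp add: module_homD[OF hom])
    show "g (a \<odot>\<^bsub>N\<^esub> x) = a \<odot>\<^bsub>M\<^esub> g x" if "a \<in> carrier R" "x \<in> carrier N" for a x
      using that g gf[of "a \<odot>\<^bsub>M\<^esub> g x"] by (simp add: module_homD[OF hom])
  qed (use g in auto)
  then show ?thesis
    using bij_betw_inv_into[OF bij] by (simp add: module_iso_def g_def)
qed

context module
begin

definition cyclic_submodule :: "'c \<Rightarrow> 'c set"
  where "cyclic_submodule x = (\<lambda>a. a \<odot>\<^bsub>M\<^esub> x) ` carrier R"

lemma cyclic_submodule_is_submodule:
  assumes "x \<in> carrier M"
  shows "submodule (cyclic_submodule x) R M"
proof (rule submoduleI)
  show "\<zero>\<^bsub>M\<^esub> \<in> cyclic_submodule x"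
    using assms R.zero_closed smult_l_null unfolding cyclic_submodule_def by (metis image_eqI)
  fix y assume "y \<in> cyclic_submodule x"
  then obtain a where a: "a \<in> carrier R" "y = a \<odot>\<^bsub>M\<^esub> x"
    by (auto simp: cyclic_submodule_def)
  then show "\<ominus>\<^bsub>M\<^esub> y \<in> cyclic_submodule x"
    using assms by (auto simp: cyclic_submodule_def smult_l_minus[symmetric])
  show "b \<odot>\<^bsub>M\<^esub> y \<in> cyclic_submodule x" if "b \<in> carrier R" for b
    using assms a that by (auto simp: cyclic_submodule_def smult_assoc1[symmetric])
  show "y \<oplus>\<^bsub>M\<^esub> z \<in> cyclic_submodule x" if "z \<in> cyclic_submodule x" for z
    using assms a that by (auto simp: cyclic_submodule_def smult_l_distr[symmetric])
qed (use assms in \<open>auto simp: cyclic_submodule_def\<close>)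

lemma mem_cyclic_submodule:
  assumes "x \<in> carrier M"
  shows "x \<in> cyclic_submodule x"
  using assms smult_one R.one_closed unfolding cyclic_submodule_def by (metis image_eqI)

lemma module_span_singleton:
  assumes "x \<in> carrier M"
  shows "module_span R M {x} = cyclic_submodule x"
proof
  show "module_span R M {x} \<subseteq> cyclic_submodule x"
    using cyclic_submodule_is_submodule[OF assms] mem_cyclic_submodule[OF assms]
    by (auto simp: module_span_def)
  show "cyclic_submodule x \<subseteq> module_span R M {x}"
    by (auto simp: module_span_def cyclic_submodule_def intro: submodule.smult_closed)
qed

lemma cyclic_submodule_subset_iff:
  assumes "x \<in> carrier M" "submodule N R M"
  shows "cyclic_submodule x \<subseteq> N \<longleftrightarrow> x \<in> N"
  using mem_cyclic_submodule[OF assms(1)] submodule.smult_closed[OF assms(2)]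
  by (auto simp: cyclic_submodule_def)

end

locale padic_module = module "Zp p" M for p :: nat and M (structure) +
  assumes prime_p: "prime p"
begin

text \<open>Bridge between two notations for integer multiples: \<open>padic_open\<close> and group
  exponents speak of \<open>add_pow\<close>, the linear algebra of scalars.\<close>

lemma smult_zp_of_int:
  assumes "x \<in> carrier M"
  shows "zp_of_int p (int n) \<odot> x = add_pow M n x"
proof (induction n)
  case 0
  then show ?case
    using assms by (simp add: zp_of_int_0)
next
  case (Suc n)
  have "zp_of_int p (int (Suc n)) = zp_of_int p (int n) \<oplus>\<^bsub>Zp p\<^esub> \<one>\<^bsub>Zp p\<^esub>"
    by (simp add: zp_of_int_add add.commute flip: zp_of_int_1)
  then show ?case
    using assms Suc by (simp add: smult_l_distr)
qed

text \<open>
  Modulo \<open>p ^ n\<close>, every scalar is an integer, so additive maps into a module killed by \<open>p ^ n\<close>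
  are linear.
\<close>

lemma additive_imp_module_hom:
  assumes "module (Zp p) N"
    and closed: "\<And>x. x \<in> carrier M \<Longrightarrow> h x \<in> carrier N"
    and add: "\<And>x y. x \<in> carrier M \<Longrightarrow> y \<in> carrier M \<Longrightarrow> h (x \<oplus> y) = h x \<oplus>\<^bsub>N\<^esub> h y"
    and torsion: "\<And>x. x \<in> carrier M \<Longrightarrow> zp_power p n \<odot>\<^bsub>N\<^esub> h x = \<zero>\<^bsub>N\<^esub>"
  shows "h \<in> module_hom (Zp p) M N"
proof (rule module_homI[OF closed add])
  interpret N: padic_module p N
    using assms(1) prime_p by (simp add: padic_module_def padic_module_axioms_def)
  have h0: "h \<zero> = \<zero>\<^bsub>N\<^esub>"
    using add[of \<zero> \<zero>] closed[of \<zero>] by (simp add: N.M.add.r_cancel_one')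
  have nat: "h (add_pow M k x) = add_pow N k (h x)" if "x \<in> carrier M" for k :: nat and x
    by (induction k) (use that h0 add in \<open>auto\<close>)
  fix a x assume a: "a \<in> carrier (Zp p)" and x: "x \<in> carrier M"
  obtain b where b: "b \<in> carrier (Zp p)"
    "a = zp_of_int p (a n) \<oplus>\<^bsub>Zp p\<^esub> zp_power p n \<otimes>\<^bsub>Zp p\<^esub> b"
    using Zp_approxE[OF prime_p a] by blast
  obtain k where k: "a n = int k"
    using Zp_apply_bounds(1)[OF prime_p a, of n] nonneg_int_cases by blast
  have "a \<odot> x = add_pow M k x \<oplus> add_pow M (p ^ n) (b \<odot> x)"
    using b x k by (subst b(2)) (simp add: smult_l_distr smult_assoc1 flip: smult_zp_of_int)
  then have "h (a \<odot> x) = add_pow N k (h x) \<oplus>\<^bsub>N\<^esub> zp_power p n \<odot>\<^bsub>N\<^esub> h (b \<odot> x)"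
    using b x closed by (simp add: add nat flip: N.smult_zp_of_int)
  also have "\<dots> = zp_of_int p (a n) \<odot>\<^bsub>N\<^esub> h x"
    using b x closed torsion k by (simp add: N.smult_zp_of_int)
  also have "\<dots> = zp_of_int p (a n) \<odot>\<^bsub>N\<^esub> h x \<oplus>\<^bsub>N\<^esub> b \<odot>\<^bsub>N\<^esub> (zp_power p n \<odot>\<^bsub>N\<^esub> h x)"
    using b x closed torsion by simp
  also have "\<dots> = (zp_of_int p (a n) \<oplus>\<^bsub>Zp p\<^esub> zp_power p n \<otimes>\<^bsub>Zp p\<^esub> b) \<odot>\<^bsub>N\<^esub> h x"
    using b(1) x closed R.m_comm[of b "zp_power p n"]
    by (simp add: N.smult_l_distr N.smult_assoc1[symmetric])
  finally show "h (a \<odot> x) = a \<odot>\<^bsub>N\<^esub> h x"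
    using b(2) by simp
qed

text \<open>By Lagrange, \<open>card T\<close> kills \<open>T\<close>; as a scalar it is a power of
  \<open>p\<close> times a unit, and the unit can be cancelled.\<close>

lemma finite_submodule_torsion:
  assumes "submodule T (Zp p) M" "finite T"
  obtains k where "\<And>x. x \<in> T \<Longrightarrow> zp_power p k \<odot> x = \<zero>"
proof -
  interpret T: submodule T "Zp p" M by fact
  have T: "T \<subseteq> carrier M"
    using T.subset by simp
  have "group (add_monoid M\<lparr>carrier := T\<rparr>)"
    by (rule T.subgroup_is_group) (rule M.a_group)
  then have "x [^]\<^bsub>add_monoid M\<lparr>carrier := T\<rparr>\<^esub> card T = \<zero>" if "x \<in> T" for x
    using group.pow_order_eq_1[of "add_monoid M\<lparr>carrier := T\<rparr>" x] that by (simp add: order_def)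
  then have card: "add_pow M (card T) x = \<zero>" if "x \<in> T" for x
    using that by (simp add: nat_pow_def add_pow_def)
  have "zp_of_int p (int (card T)) \<noteq> \<zero>\<^bsub>Zp p\<^esub>"
    using zp_of_int_eq_iff[of p "int (card T)" 0] prime_ge_2_nat[OF prime_p] assms(2) T.one_closed
    by (auto simp: zp_of_int_0)
  then obtain k u where u: "u \<in> Units (Zp p)" "zp_of_int p (int (card T)) = zp_power p k \<otimes>\<^bsub>Zp p\<^esub> u"
    using Zp_factorE[OF prime_p] by blast
  have "zp_power p k \<odot> x = \<zero>" if "x \<in> T" for x
  proof -
    have "zp_power p k = inv\<^bsub>Zp p\<^esub> u \<otimes>\<^bsub>Zp p\<^esub> zp_of_int p (int (card T))"
      using u by (simp add: R.Units_closed R.m_lcomm[of "inv\<^bsub>Zp p\<^esub> u"])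
    then have "zp_power p k \<odot> x = inv\<^bsub>Zp p\<^esub> u \<odot> (zp_of_int p (int (card T)) \<odot> x)"
      using u(1) T that by (simp add: smult_assoc1 subsetD)
    then show ?thesis
      using u(1) T that by (simp add: subsetD smult_zp_of_int card)
  qed
  then show ?thesis
    using that by blast
qed

end

section \<open>Splitting off the torsion\<close>

context padic_module
begin

lemma smult_zp_power_mono:
  assumes "submodule N (Zp p) M" "x \<in> carrier M" "zp_power p n \<odot> x \<in> N" "n \<le> m"
  shows "zp_power p m \<odot> x \<in> N"
proof -
  have "zp_power p m = zp_power p (m - n) \<otimes>\<^bsub>Zp p\<^esub> zp_power p n"
    using \<open>n \<le> m\<close> by (simp add: zp_of_int_mult flip: power_add)
  then show ?thesis
    using assms submodule.smult_closed[OF assms(1)] by (simp add: smult_assoc1)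
qed

text \<open>Adjoining a generator \<open>s\<close> keeps the number of cosets finite: since
  \<open>p ^ n\<close> moves \<open>s\<close> into \<open>C\<close>, only the residue modulo
  \<open>p ^ n\<close> of the coefficient of \<open>s\<close> matters for the coset.\<close>

lemma finitely_many_cosets_mod_torsion:
  assumes "finite S" "S \<subseteq> carrier M" and C: "submodule C (Zp p) M"
    and torsion: "\<And>s. s \<in> S \<Longrightarrow> \<exists>n. zp_power p n \<odot> s \<in> C"
  shows "\<exists>N F. submodule N (Zp p) M \<and> S \<union> C \<subseteq> N \<and> finite F \<and> F \<subseteq> carrier M \<and>
    (\<forall>y\<in>N. \<exists>f\<in>F. \<exists>c\<in>C. y = f \<oplus> c)"
  using assms(1,2,4)
proof (induction S rule: finite_induct)
  case empty
  have "C \<subseteq> carrier M"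
    using C submoduleE(1) by blast
  then have "\<forall>y\<in>C. \<exists>f\<in>{\<zero>}. \<exists>c\<in>C. y = f \<oplus> c"
    by force
  with C have "submodule C (Zp p) M \<and> {} \<union> C \<subseteq> C \<and> finite {\<zero>} \<and> {\<zero>} \<subseteq> carrier M \<and>
      (\<forall>y\<in>C. \<exists>f\<in>{\<zero>}. \<exists>c\<in>C. y = f \<oplus> c)"
    by simp
  then show ?case
    by (intro exI)
next
  case (insert s S)
  then obtain N F where N: "submodule N (Zp p) M" "S \<union> C \<subseteq> N"
    and F: "finite F" "F \<subseteq> carrier M" "\<forall>y\<in>N. \<exists>f\<in>F. \<exists>c\<in>C. y = f \<oplus> c"
    by auto
  have s: "s \<in> carrier M"
    using insert by auto
  obtain n where n: "zp_power p n \<odot> s \<in> C"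
    using insert.prems by blast
  note C_subset = submoduleE(1)[OF C] and N_subset = submoduleE(1)[OF N(1)]
  define N' where "N' = {y \<oplus> b \<odot> s |y b. y \<in> N \<and> b \<in> carrier (Zp p)}"
  define F' where "F' = (\<lambda>(f, j). f \<oplus> zp_of_int p j \<odot> s) ` (F \<times> {0..<int p ^ n})"
  have N_closed: "y \<oplus> z \<in> N" "\<ominus> y \<in> N" "a \<odot> y \<in> N"
    if "y \<in> N" "z \<in> N" "a \<in> carrier (Zp p)" for y z a
    using submoduleE[OF N(1)] that by auto
  have zero_N: "\<zero> \<in> N"
    using subgroup.one_closed[OF submodule.axioms(1)[OF N(1)]] by simp
  have "submodule N' (Zp p) M"
  proof (rule submoduleI)
    show "N' \<subseteq> carrier M"
      using N_subset s by (auto simp: N'_def)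
    have "\<zero> = \<zero> \<oplus> \<zero>\<^bsub>Zp p\<^esub> \<odot> s"
      using s by simp
    then show "\<zero> \<in> N'"
      unfolding N'_def using zero_N R.zero_closed by blast
  next
    fix x assume "x \<in> N'"
    then obtain y b where x: "x = y \<oplus> b \<odot> s" "y \<in> N" "b \<in> carrier (Zp p)"
      by (auto simp: N'_def)
    have y: "y \<in> carrier M"
      using x N_subset by blast
    have "\<ominus> x = \<ominus> y \<oplus> (\<ominus>\<^bsub>Zp p\<^esub> b) \<odot> s"
      using x y s by (simp add: M.minus_add smult_l_minus)
    then show "\<ominus> x \<in> N'"
      unfolding N'_def using N_closed(2)[OF x(2) x(2,3)] R.a_inv_closed[OF x(3)] by blast
    show "a \<odot> x \<in> N'" if a: "a \<in> carrier (Zp p)" for a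
    proof -
      have "a \<odot> x = a \<odot> y \<oplus> (a \<otimes>\<^bsub>Zp p\<^esub> b) \<odot> s"
        using x y s a by (simp add: smult_r_distr smult_assoc1)
      then show ?thesis
        unfolding N'_def using N_closed(3)[OF x(2) x(2) a] R.m_closed[OF a x(3)] by blast
    qed
    show "x \<oplus> x' \<in> N'" if "x' \<in> N'" for x'
    proof -
      obtain y' b' where x': "x' = y' \<oplus> b' \<odot> s" "y' \<in> N" "b' \<in> carrier (Zp p)"
        using \<open>x' \<in> N'\<close> by (auto simp: N'_def)
      have y': "y' \<in> carrier M"
        using x' N_subset by blast
      have "x \<oplus> x' = (y \<oplus> y') \<oplus> (b \<oplus>\<^bsub>Zp p\<^esub> b') \<odot> s"
        using x x' y y' s by (simp add: smult_l_distr M.a_ac)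
      then show ?thesis
        unfolding N'_def using N_closed(1)[OF x(2) x'(2) x(3)] R.a_closed[OF x(3) x'(3)] by blast
    qed
  qed
  moreover have "insert s S \<union> C \<subseteq> N'"
  proof -
    have "y \<in> N'" if "y \<in> N" for y
    proof -
      have "y = y \<oplus> \<zero>\<^bsub>Zp p\<^esub> \<odot> s"
        using that N_subset s by (simp add: subsetD)
      then show ?thesis
        unfolding N'_def using that R.zero_closed by blast
    qed
    moreover have "s \<in> N'"
    proof -
      have "s = \<zero> \<oplus> \<one>\<^bsub>Zp p\<^esub> \<odot> s"
        using s by simp
      then show ?thesis
        unfolding N'_def using zero_N R.one_closed by blast
    qed
    ultimately show ?thesis
      using N by blast
  qed
  moreover have "finite F'" "F' \<subseteq> carrier M"
    using F s by (auto simp: F'_def)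
  moreover have "\<exists>f\<in>F'. \<exists>c\<in>C. x = f \<oplus> c" if "x \<in> N'" for x
  proof -
    obtain y b where x: "x = y \<oplus> b \<odot> s" "y \<in> N" "b \<in> carrier (Zp p)"
      using \<open>x \<in> N'\<close> by (auto simp: N'_def)
    obtain f c where f: "f \<in> F" "c \<in> C" "y = f \<oplus> c"
      using F x by blast
    obtain b' where b': "b' \<in> carrier (Zp p)" "b = zp_of_int p (b n) \<oplus>\<^bsub>Zp p\<^esub> zp_power p n \<otimes>\<^bsub>Zp p\<^esub> b'"
      using Zp_approxE[OF prime_p x(3)] by blast
    have closed: "f \<in> carrier M" "c \<in> carrier M"
      using f F C_subset by auto
    have "b \<odot> s = zp_of_int p (b n) \<odot> s \<oplus> b' \<odot> (zp_power p n \<odot> s)"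
      using b'(1) s R.m_comm[of b' "zp_power p n"]
      by (subst b'(2)) (simp add: smult_l_distr flip: smult_assoc1)
    then have "x = (f \<oplus> zp_of_int p (b n) \<odot> s) \<oplus> (c \<oplus> b' \<odot> (zp_power p n \<odot> s))"
      using x f b' s closed by (simp add: M.a_ac)
    moreover have "f \<oplus> zp_of_int p (b n) \<odot> s \<in> F'"
      using f Zp_apply_bounds[OF prime_p x(3), of n] by (auto simp: F'_def)
    moreover have "c \<oplus> b' \<odot> (zp_power p n \<odot> s) \<in> C"
      using f n b' submoduleE[OF C] by simp
    ultimately show ?thesis
      by blast
  qed
  ultimately have "submodule N' (Zp p) M \<and> insert s S \<union> C \<subseteq> N' \<and> finite F' \<and>
      F' \<subseteq> carrier M \<and> (\<forall>y\<in>N'. \<exists>f\<in>F'. \<exists>c\<in>C. y = f \<oplus> c)"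
    by simp
  then show ?case
    by (intro exI)
qed

text \<open>Rank 1 gives an independent \<open>w\<close>, and any further \<open>s\<close> satisfies
  a relation with \<open>w\<close> in which the coefficient of \<open>s\<close> is nonzero. Up to a
  unit this coefficient is a power of \<open>p\<close>, so \<open>M\<close> is torsion modulo
  \<open>w\<close>, and finite generation makes the quotient finite.\<close>

lemma rank_1_imp_cofinite_cyclic:
  assumes "finitely_generated_module (Zp p) M" "has_rank (Zp p) M 1"
  obtains w F where "w \<in> carrier M"
    and "\<And>a. a \<in> carrier (Zp p) \<Longrightarrow> a \<odot> w = \<zero> \<Longrightarrow> a = \<zero>\<^bsub>Zp p\<^esub>"
    and "finite F" "F \<subseteq> carrier M" "\<And>y. y \<in> carrier M \<Longrightarrow> \<exists>f\<in>F. \<exists>c\<in>cyclic_submodule w. y = f \<oplus> c"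
    and "\<And>f. f \<in> F \<Longrightarrow> \<exists>n. zp_power p n \<odot> f \<in> cyclic_submodule w"
proof -
  obtain w where "lin_indep (Zp p) M {w}"
    using assms(2) by (auto simp: has_rank_def card_1_singleton_iff)
  then have w: "w \<in> carrier M"
    by (simp add: lin_indep_def)
  have indep: "a = \<zero>\<^bsub>Zp p\<^esub>" if "a \<in> carrier (Zp p)" "a \<odot> w = \<zero>" for a
  proof -
    have "(\<Oplus>x\<in>{w}. a \<odot> x) = \<zero>"
      using that w by simp
    then show ?thesis
      using \<open>lin_indep (Zp p) M {w}\<close> that(1) by (auto simp: lin_indep_def dest!: bspec[of _ _ "\<lambda>_. a"])
  qed
  have torsion: "\<exists>n. zp_power p n \<odot> s \<in> cyclic_submodule w" if s: "s \<in> carrier M" for s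
  \<comment> \<open>For \<open>s = w\<close> the set \<open>{w, s}\<close> has only one element and
    the rank bound gives no relation.\<close>
  proof (cases "s = w")
    case True
    then show ?thesis
      by (auto simp: cyclic_submodule_def)
  next
    case False
    then have "\<not> lin_indep (Zp p) M {w, s}"
      using assms(2) by (auto simp: has_rank_def dest!: spec[of _ "{w, s}"])
    then obtain c where c: "c w \<in> carrier (Zp p)" "c s \<in> carrier (Zp p)"
      "(\<Oplus>x\<in>{w, s}. c x \<odot> x) = \<zero>" "c w \<noteq> \<zero>\<^bsub>Zp p\<^esub> \<or> c s \<noteq> \<zero>\<^bsub>Zp p\<^esub>"
      using w s by (auto simp: lin_indep_def)
    then have sum: "c w \<odot> w \<oplus> c s \<odot> s = \<zero>"
      using w s False by simp
    have "c s \<noteq> \<zero>\<^bsub>Zp p\<^esub>"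
    proof
      assume "c s = \<zero>\<^bsub>Zp p\<^esub>"
      with sum c w s have "c w \<odot> w = \<zero>"
        by simp
      with indep c \<open>c s = \<zero>\<^bsub>Zp p\<^esub>\<close> show False
        by blast
    qed
    then obtain k u where u: "u \<in> Units (Zp p)" "c s = zp_power p k \<otimes>\<^bsub>Zp p\<^esub> u"
      using Zp_factorE[OF prime_p c(2)] by blast
    have "zp_power p k \<odot> s = inv\<^bsub>Zp p\<^esub> u \<odot> (c s \<odot> s)"
      using u s R.m_lcomm[of "inv\<^bsub>Zp p\<^esub> u"] by (simp add: R.Units_closed flip: smult_assoc1)
    also have "c s \<odot> s = \<ominus> (c w \<odot> w)"
      using sum c w s by (simp add: M.minus_equality M.a_comm)
    also have "inv\<^bsub>Zp p\<^esub> u \<odot> \<dots> = (\<ominus>\<^bsub>Zp p\<^esub> (inv\<^bsub>Zp p\<^esub> u \<otimes>\<^bsub>Zp p\<^esub> c w)) \<odot> w"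
      using c w u by (simp add: smult_l_minus smult_r_minus smult_assoc1)
    finally show ?thesis
      using c(1) u(1) by (intro exI[of _ k]) (auto simp: cyclic_submodule_def)
  qed
  obtain S where S: "finite S" "S \<subseteq> carrier M" "module_span (Zp p) M S = carrier M"
    using assms(1) by (auto simp: finitely_generated_module_def)
  obtain N F where N: "submodule N (Zp p) M" "S \<union> cyclic_submodule w \<subseteq> N"
    and F: "finite F" "F \<subseteq> carrier M" "\<forall>y\<in>N. \<exists>f\<in>F. \<exists>c\<in>cyclic_submodule w. y = f \<oplus> c"
    using finitely_many_cosets_mod_torsion[OF S(1,2) cyclic_submodule_is_submodule[OF w] torsion] S(2)
    by blast
  have "carrier M \<subseteq> N"
    using N S(3) by (auto simp: module_span_def)
  then have "\<And>y. y \<in> carrier M \<Longrightarrow> \<exists>f\<in>F. \<exists>c\<in>cyclic_submodule w. y = f \<oplus> c"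
    "\<And>f. f \<in> F \<Longrightarrow> \<exists>n. zp_power p n \<odot> f \<in> cyclic_submodule w"
    using F torsion by auto
  with w indep F(1,2) show ?thesis
    by (rule that)
qed

end

text \<open>A splitting of \<open>M\<close> into \<open>Zp e\<close> and a finite module, encoded by
  the coordinate function \<open>\<rho>\<close> of \<open>e\<close> instead of an explicit direct
  sum. It depends on choices; the kernel of \<open>\<rho>\<close> turns out to be canonical
  (\<open>torsion_part_eq\<close>).\<close>

locale split_module = padic_module p M for p :: nat and M (structure) +
  fixes e and \<rho> :: "_ \<Rightarrow> padic"
  assumes e_closed [simp]: "e \<in> carrier M"
    and rho_closed [simp]: "x \<in> carrier M \<Longrightarrow> \<rho> x \<in> carrier (Zp p)"
    and rho_add: "x \<in> carrier M \<Longrightarrow> y \<in> carrier M \<Longrightarrow> \<rho> (x \<oplus> y) = \<rho> x \<oplus>\<^bsub>Zp p\<^esub> \<rho> y"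
    and rho_smult: "a \<in> carrier (Zp p) \<Longrightarrow> x \<in> carrier M \<Longrightarrow> \<rho> (a \<odot> x) = a \<otimes>\<^bsub>Zp p\<^esub> \<rho> x"
    and rho_e [simp]: "\<rho> e = \<one>\<^bsub>Zp p\<^esub>"
    and finite_kernel: "finite {x \<in> carrier M. \<rho> x = \<zero>\<^bsub>Zp p\<^esub>}"

text \<open>Some \<open>p ^ n\<close> maps \<open>M\<close> into \<open>Zp w\<close>, which defines
  a linear functional \<open>r\<close> by \<open>p ^ n x = r(x) w\<close>. Its image is an ideal of
  a valuation ring, hence generated by some \<open>p ^ k\<close>, and \<open>r / p ^ k\<close> is a
  functional onto \<open>Zp\<close>, split by a preimage \<open>e\<close> of 1.\<close>

theorem (in padic_module) rank_1_imp_split: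
  assumes "finitely_generated_module (Zp p) M" "has_rank (Zp p) M 1"
  obtains e \<rho> where "split_module p M e \<rho>"
proof -
  interpret R: domain "Zp p"
    by (rule Zp_domain[OF prime_p])
  obtain w F where w: "w \<in> carrier M"
    and indep: "\<And>a. a \<in> carrier (Zp p) \<Longrightarrow> a \<odot> w = \<zero> \<Longrightarrow> a = \<zero>\<^bsub>Zp p\<^esub>"
    and F: "finite F" "F \<subseteq> carrier M" "\<And>y. y \<in> carrier M \<Longrightarrow> \<exists>f\<in>F. \<exists>c\<in>cyclic_submodule w. y = f \<oplus> c"
    and torsion: "\<And>f. f \<in> F \<Longrightarrow> \<exists>n. zp_power p n \<odot> f \<in> cyclic_submodule w"
    by (rule rank_1_imp_cofinite_cyclic[OF assms]) (rule that; assumption)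
  have C: "submodule (cyclic_submodule w) (Zp p) M"
    using w by (rule cyclic_submodule_is_submodule)
  from torsion obtain N where N: "\<And>f. f \<in> F \<Longrightarrow> zp_power p (N f) \<odot> f \<in> cyclic_submodule w"
    by metis
  \<comment> \<open>One exponent for all representatives; the inserted 0 keeps \<open>Max\<close>
    away from an empty set.\<close>
  define n where "n = Max (insert 0 (N ` F))"
  have "zp_power p n \<odot> f \<in> cyclic_submodule w" if "f \<in> F" for f
    using smult_zp_power_mono[OF C _ N[OF that]] F that by (auto simp: n_def)
  then have n: "zp_power p n \<odot> y \<in> cyclic_submodule w" if "y \<in> carrier M" for y
  proof -
    obtain f c where "f \<in> F" "c \<in> cyclic_submodule w" "y = f \<oplus> c"
      using F(3)[OF \<open>y \<in> carrier M\<close>] by blast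
    with F(2) submoduleE[OF C] \<open>\<And>f. f \<in> F \<Longrightarrow> zp_power p n \<odot> f \<in> cyclic_submodule w\<close>
    show ?thesis
      by (simp add: smult_r_distr subsetD)
  qed
  then have "\<forall>y\<in>carrier M. \<exists>a\<in>carrier (Zp p). zp_power p n \<odot> y = a \<odot> w"
    by (auto simp: cyclic_submodule_def)
  then obtain r where r: "\<And>y. y \<in> carrier M \<Longrightarrow> r y \<in> carrier (Zp p)"
    "\<And>y. y \<in> carrier M \<Longrightarrow> zp_power p n \<odot> y = r y \<odot> w"
    by metis
  have cancel: "a = b" if "a \<odot> w = b \<odot> w" "a \<in> carrier (Zp p)" "b \<in> carrier (Zp p)" for a b
  proof -
    have "(a \<ominus>\<^bsub>Zp p\<^esub> b) \<odot> w = \<zero>"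
      using that w by (simp add: R.minus_eq smult_l_distr smult_l_minus M.r_neg)
    then show ?thesis
      using indep[of "a \<ominus>\<^bsub>Zp p\<^esub> b"] that by (simp add: R.r_right_minus_eq)
  qed
  have r_add: "r (x \<oplus> y) = r x \<oplus>\<^bsub>Zp p\<^esub> r y" if "x \<in> carrier M" "y \<in> carrier M" for x y
    using that r w by (intro cancel) (simp_all add: smult_l_distr smult_r_distr flip: r(2))
  have r_smult: "r (a \<odot> x) = a \<otimes>\<^bsub>Zp p\<^esub> r x" if "a \<in> carrier (Zp p)" "x \<in> carrier M" for a x
  proof (rule cancel)
    have "r (a \<odot> x) \<odot> w = (zp_power p n \<otimes>\<^bsub>Zp p\<^esub> a) \<odot> x"
      using that by (simp add: smult_assoc1 flip: r(2))
    also have "\<dots> = a \<odot> (zp_power p n \<odot> x)"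
      using that R.m_comm[of a "zp_power p n"] by (simp flip: smult_assoc1)
    also have "\<dots> = (a \<otimes>\<^bsub>Zp p\<^esub> r x) \<odot> w"
      using that r w by (simp add: smult_assoc1)
    finally show "r (a \<odot> x) \<odot> w = (a \<otimes>\<^bsub>Zp p\<^esub> r x) \<odot> w" .
  qed (use that r in auto)
  have r_w: "r w = zp_power p n"
    using w r by (intro cancel) (simp_all flip: r(2))
  \<comment> \<open>An element of least valuation in the image of \<open>r\<close> generates it,
    hence the minimal \<open>k\<close> chosen below.\<close>
  define V where "V k \<longleftrightarrow> (\<exists>y\<in>carrier M. \<exists>u\<in>Units (Zp p). r y = zp_power p k \<otimes>\<^bsub>Zp p\<^esub> u)" for k
  have "V n"
    using w r_w unfolding V_def by (intro bexI[of _ w] bexI[of _ "\<one>\<^bsub>Zp p\<^esub>"]) auto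
  then obtain k where k: "V k" "\<And>l. l < k \<Longrightarrow> \<not> V l"
    using exists_least_iff[of V] by auto
  from k(1) obtain y u where yu: "y \<in> carrier M" "u \<in> Units (Zp p)" "r y = zp_power p k \<otimes>\<^bsub>Zp p\<^esub> u"
    by (auto simp: V_def)
  define e where "e = inv\<^bsub>Zp p\<^esub> u \<odot> y"
  have e: "e \<in> carrier M"
    using yu by (simp add: e_def)
  have r_e: "r e = zp_power p k"
    using yu R.m_lcomm[of "inv\<^bsub>Zp p\<^esub> u" "zp_power p k" u] by (simp add: e_def r_smult R.Units_closed)
  have divides: "\<exists>b\<in>carrier (Zp p). r x = zp_power p k \<otimes>\<^bsub>Zp p\<^esub> b" if x: "x \<in> carrier M" for x
  proof (cases "r x = \<zero>\<^bsub>Zp p\<^esub>")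
    case True
    then show ?thesis
      by (intro bexI[of _ "\<zero>\<^bsub>Zp p\<^esub>"]) auto
  next
    case False
    then obtain l v where v: "v \<in> Units (Zp p)" "r x = zp_power p l \<otimes>\<^bsub>Zp p\<^esub> v"
      using Zp_factorE[OF prime_p r(1)[OF x]] by metis
    then have "V l"
      using x by (auto simp: V_def)
    with k(2) have "k \<le> l"
      using not_less by blast
    then have "zp_power p l = zp_power p k \<otimes>\<^bsub>Zp p\<^esub> zp_power p (l - k)"
      by (simp add: zp_of_int_mult flip: power_add)
    with v show ?thesis
      by (auto simp: R.m_assoc R.Units_closed intro!: bexI[of _ "zp_power p (l - k) \<otimes>\<^bsub>Zp p\<^esub> v"])
  qed
  then obtain \<rho> where \<rho>: "\<And>x. x \<in> carrier M \<Longrightarrow> \<rho> x \<in> carrier (Zp p)"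
    "\<And>x. x \<in> carrier M \<Longrightarrow> r x = zp_power p k \<otimes>\<^bsub>Zp p\<^esub> \<rho> x"
    by metis
  have cancel_power: "a = b"
    if "zp_power p k \<otimes>\<^bsub>Zp p\<^esub> a = zp_power p k \<otimes>\<^bsub>Zp p\<^esub> b" "a \<in> carrier (Zp p)" "b \<in> carrier (Zp p)" for a b
    using that zp_power_nonzero[OF prime_p, of k] R.m_lcancel[of "zp_power p k" a b] by simp
  have "split_module p M e \<rho>"
  proof unfold_locales
    show "\<rho> (x \<oplus> y) = \<rho> x \<oplus>\<^bsub>Zp p\<^esub> \<rho> y" if "x \<in> carrier M" "y \<in> carrier M" for x y
      by (rule cancel_power) (use that \<rho>(1) in \<open>simp_all add: R.r_distr r_add flip: \<rho>(2)\<close>)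
    show "\<rho> (a \<odot> x) = a \<otimes>\<^bsub>Zp p\<^esub> \<rho> x" if "a \<in> carrier (Zp p)" "x \<in> carrier M" for a x
    proof (rule cancel_power)
      show "zp_power p k \<otimes>\<^bsub>Zp p\<^esub> \<rho> (a \<odot> x) = zp_power p k \<otimes>\<^bsub>Zp p\<^esub> (a \<otimes>\<^bsub>Zp p\<^esub> \<rho> x)"
        using that \<rho>(1) R.m_lcomm[of "zp_power p k" a "\<rho> x"] by (simp add: r_smult flip: \<rho>(2))
    qed (use that \<rho>(1) in auto)
    show "\<rho> e = \<one>\<^bsub>Zp p\<^esub>"
      by (rule cancel_power) (use e \<rho>(1) r_e in \<open>simp_all flip: \<rho>(2)\<close>)
    let ?T = "{x \<in> carrier M. \<rho> x = \<zero>\<^bsub>Zp p\<^esub>}"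
    have r_T: "r x = \<zero>\<^bsub>Zp p\<^esub>" if "x \<in> ?T" for x
      using that \<rho>(2)[of x] by simp
    obtain \<kappa> where \<kappa>: "\<And>y. y \<in> carrier M \<Longrightarrow> \<kappa> y \<in> F"
      "\<And>y. y \<in> carrier M \<Longrightarrow> \<exists>c\<in>cyclic_submodule w. y = \<kappa> y \<oplus> c"
      using F(3) by metis
    \<comment> \<open>Kernel elements in the same coset of \<open>Zp w\<close> differ by a multiple
      of \<open>w\<close> on which \<open>r\<close> vanishes; as \<open>r w = p ^ n\<close> is
      nonzero, they coincide. So the kernel is no larger than \<open>F\<close>.\<close>
    have "inj_on \<kappa> ?T"
    proof (rule inj_onI)
      fix x y assume xy: "x \<in> ?T" "y \<in> ?T" "\<kappa> x = \<kappa> y"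
      obtain a where a: "a \<in> carrier (Zp p)" "x = \<kappa> x \<oplus> a \<odot> w"
        using \<kappa>(2)[of x] xy by (auto simp: cyclic_submodule_def)
      obtain b where b: "b \<in> carrier (Zp p)" "y = \<kappa> y \<oplus> b \<odot> w"
        using \<kappa>(2)[of y] xy by (auto simp: cyclic_submodule_def)
      have \<kappa>_closed: "\<kappa> x \<in> carrier M" "\<kappa> y \<in> carrier M"
        using \<kappa>(1) F(2) xy by auto
      have "r (\<kappa> x) \<oplus>\<^bsub>Zp p\<^esub> a \<otimes>\<^bsub>Zp p\<^esub> zp_power p n = r x"
        using a(1) \<kappa>_closed w by (subst a(2)) (simp add: r_add r_smult r_w)
      moreover have "r (\<kappa> y) \<oplus>\<^bsub>Zp p\<^esub> b \<otimes>\<^bsub>Zp p\<^esub> zp_power p n = r y"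
        using b(1) \<kappa>_closed w by (subst b(2)) (simp add: r_add r_smult r_w)
      ultimately have "r (\<kappa> x) \<oplus>\<^bsub>Zp p\<^esub> a \<otimes>\<^bsub>Zp p\<^esub> zp_power p n = r (\<kappa> x) \<oplus>\<^bsub>Zp p\<^esub> b \<otimes>\<^bsub>Zp p\<^esub> zp_power p n"
        using xy r_T by simp
      then have "a \<otimes>\<^bsub>Zp p\<^esub> zp_power p n = b \<otimes>\<^bsub>Zp p\<^esub> zp_power p n"
        using a(1) b(1) \<kappa>_closed r(1) R.add.l_cancel[of "r (\<kappa> x)"] by simp
      then have "a = b"
        using R.m_rcancel[of "zp_power p n" a b] zp_power_nonzero[OF prime_p, of n] a(1) b(1) by simp
      with a b xy show "x = y"
        by simp
    qed
    moreover have "\<kappa> ` ?T \<subseteq> F"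
      using \<kappa>(1) by auto
    ultimately show "finite ?T"
      using F(1) finite_subset finite_imageD by metis
  qed (use e \<rho>(1) prime_p in auto)
  then show ?thesis
    using that by blast
qed

section \<open>Haar measure\<close>

definition zp_cylinder :: "nat \<Rightarrow> nat \<Rightarrow> int \<Rightarrow> padic set"
  where "zp_cylinder p n r = {a \<in> carrier (Zp p). a n = r}"

abbreviation digit_measure :: "nat \<Rightarrow> (nat \<Rightarrow> int) measure"
  where "digit_measure p \<equiv> \<Pi>\<^sub>M k\<in>UNIV. uniform_count_measure {0..<int p}"

abbreviation digit_sum :: "nat \<Rightarrow> (nat \<Rightarrow> int) \<Rightarrow> padic"
  where "digit_sum p d \<equiv> \<lambda>n. \<Sum>k<n. d k * int p ^ k"

text \<open>The law of a random base-\<open>p\<close> expansion with independent uniform digits.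
  Countable additivity comes from the infinite product measure; the cylinders are the residue
  classes modulo the powers \<open>p ^ n\<close>.\<close>

definition zp_haar :: "nat \<Rightarrow> padic measure"
  where "zp_haar p = distr (digit_measure p)
    (sigma (carrier (Zp p)) (range (case_prod (zp_cylinder p)))) (digit_sum p)"

lemma space_zp_haar: "space (zp_haar p) = carrier (Zp p)"
  by (auto simp: zp_haar_def zp_cylinder_def intro!: space_measure_of)

lemma sets_zp_haar:
  "sets (zp_haar p) = sigma_sets (carrier (Zp p)) (range (case_prod (zp_cylinder p)))"
  by (auto simp: zp_haar_def zp_cylinder_def intro!: sets_measure_of)

lemma digit_sum_bounds:
  fixes d :: "nat \<Rightarrow> int"
  assumes "\<And>k. d k \<in> {0..<int p}"
  shows "(\<Sum>k<n. d k * int p ^ k) \<in> {0..<int p ^ n}"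
proof (induction n)
  case (Suc n)
  have "d n * int p ^ n \<le> (int p - 1) * int p ^ n"
    using assms[of n] by (intro mult_right_mono) auto
  moreover have "0 \<le> d n * int p ^ n"
    using assms[of n] by simp
  ultimately show ?case
    using Suc by (simp add: algebra_simps)
qed simp

text \<open>Uniqueness of base-\<open>p\<close> expansions, in a form that turns a condition on the
  sum into separate conditions on the digits.\<close>

lemma digit_sum_eq_iff:
  fixes d :: "nat \<Rightarrow> int"
  assumes p: "p \<ge> 2" and d: "\<And>k. d k \<in> {0..<int p}"
  shows "r \<in> {0..<int p ^ n} \<Longrightarrow>
    (\<Sum>k<n. d k * int p ^ k) = r \<longleftrightarrow> (\<forall>k<n. d k = r div int p ^ k mod int p)"
proof (induction n arbitrary: r)
  case (Suc n)
  define s where "s = (\<Sum>k<n. d k * int p ^ k)"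
  have pos: "int p ^ n > 0"
    using p by simp
  have s: "s \<in> {0..<int p ^ n}"
    unfolding s_def using d by (rule digit_sum_bounds)
  have "s + d n * int p ^ n = r \<longleftrightarrow> s = r mod int p ^ n \<and> d n = r div int p ^ n"
  proof
    assume r: "s + d n * int p ^ n = r"
    show "s = r mod int p ^ n \<and> d n = r div int p ^ n"
      using s pos by (simp add: div_pos_pos_trivial mod_pos_pos_trivial flip: r)
  next
    assume "s = r mod int p ^ n \<and> d n = r div int p ^ n"
    then show "s + d n * int p ^ n = r"
      using mod_div_mult_eq[of r "int p ^ n"] by simp
  qed
  \<comment> \<open>Since \<open>r < p ^ Suc n\<close>, the quotient is already the leading digit;
    reducing it modulo \<open>p\<close> brings it into the uniform shape of the claim.\<close>
  also have "r div int p ^ n = r div int p ^ n mod int p"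
  proof (rule mod_pos_pos_trivial[symmetric])
    show "0 \<le> r div int p ^ n"
      using Suc.prems pos by (simp add: pos_imp_zdiv_nonneg_iff)
    have "int p ^ n * (r div int p ^ n) \<le> r"
      using mult_div_mod_eq[of "int p ^ n" r] pos_mod_sign[OF pos, of r] by linarith
    also have "r < int p ^ n * int p"
      using Suc.prems by (simp add: mult.commute)
    finally show "r div int p ^ n < int p"
      using pos by (simp add: mult_less_cancel_left_pos)
  qed
  also have "s = r mod int p ^ n \<longleftrightarrow> (\<forall>k<n. d k = r mod int p ^ n div int p ^ k mod int p)"
    unfolding s_def by (rule Suc.IH) (use pos in simp)
  also have "\<dots> \<longleftrightarrow> (\<forall>k<n. d k = r div int p ^ k mod int p)"
  proof -
    have "r mod int p ^ n div int p ^ k mod int p = r div int p ^ k mod int p" if "k < n" for k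
    proof -
      obtain m where m: "n = k + Suc m"
        using \<open>k < n\<close> less_iff_Suc_add by auto
      have "r mod int p ^ n = int p ^ k * (r div int p ^ k mod int p ^ Suc m) + r mod int p ^ k"
        unfolding m power_add by (rule zmod_zmult2_eq) simp
      then have "r mod int p ^ n div int p ^ k = r div int p ^ k mod int p ^ Suc m"
        using div_mult_self4[of "int p ^ k" "r div int p ^ k mod int p ^ Suc m" "r mod int p ^ k"] p
        by (simp only: mod_div_trivial) simp
      then show ?thesis
        using mod_mod_cancel[of "int p" "int p ^ Suc m"] by (simp only: dvd_triv_left power_Suc)
    qed
    then show ?thesis
      by simp
  qed
  finally show ?case
    unfolding s_def sum.lessThan_Suc All_less_Suc by blast
qed simp

context
  fixes p :: nat
  assumes prime_p: "prime p"
begin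

interpretation R: cring "Zp p"
  by (rule Zp_cring)

interpretation digits: product_prob_space "\<lambda>k::nat. uniform_count_measure {0..<int p}" UNIV
  using prime_gt_0_nat[OF prime_p]
  by (intro product_prob_spaceI prob_space_uniform_count_measure) auto

lemma digit_sum_closed:
  assumes d: "\<And>k. d k \<in> {0..<int p}"
  shows "(\<lambda>n. \<Sum>k<n. d k * int p ^ k) \<in> carrier (Zp p)"
proof -
  have "(\<Sum>k<n. d k * int p ^ k) mod int p ^ m = (\<Sum>k<m. d k * int p ^ k)" if "m \<le> n" for m n
  proof -
    have "(\<Sum>k<n. d k * int p ^ k) = (\<Sum>k<m. d k * int p ^ k) + (\<Sum>k\<in>{m..<n}. d k * int p ^ k)"
      using that by (subst sum.union_disjoint[symmetric]) (auto intro!: sum.cong)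
    moreover have "int p ^ m dvd (\<Sum>k\<in>{m..<n}. d k * int p ^ k)"
      by (intro dvd_sum) (auto intro: dvd_mult le_imp_power_dvd)
    moreover have "(\<Sum>k<m. d k * int p ^ k) \<in> {0..<int p ^ m}"
      using d by (rule digit_sum_bounds)
    ultimately show ?thesis
      by (auto simp: dvd_eq_mod_eq_0 mod_add_right_eq[symmetric] mod_pos_pos_trivial)
  qed
  then show ?thesis
    by (simp add: Zp_def)
qed

lemma space_digits: "d \<in> space (digit_measure p) \<longleftrightarrow> (\<forall>k. d k \<in> {0..<int p})"
  by (auto simp: space_PiM space_uniform_count_measure PiE_iff)

lemma digit_cylinder:
  assumes "r \<in> {0..<int p ^ n}"
  shows "(digit_sum p) -` zp_cylinder p n r \<inter> space (digit_measure p)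
    = {d \<in> space (digit_measure p). \<forall>k\<in>{..<n}. d k \<in> {r div int p ^ k mod int p}}"
  (is "?f -` _ \<inter> ?D = ?R")
proof -
  have "?f d \<in> zp_cylinder p n r \<longleftrightarrow> d \<in> ?R" if "d \<in> ?D" for d
  proof -
    have d: "d k \<in> {0..<int p}" for k
      using that[unfolded space_digits] by simp
    show ?thesis
      using digit_sum_closed[of d, OF d] digit_sum_eq_iff[of p d, OF prime_ge_2_nat[OF prime_p] d assms] that
      by (simp add: zp_cylinder_def Ball_def)
  qed
  then show ?thesis
    by blast
qed

lemma zp_cylinder_empty:
  assumes "r \<notin> {0..<int p ^ n}"
  shows "zp_cylinder p n r = {}"
  using Zp_apply_bounds[OF prime_p] assms by (auto simp: zp_cylinder_def)

lemma measurable_digit_sum: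
  "digit_sum p \<in> measurable (digit_measure p)
    (sigma (carrier (Zp p)) (range (case_prod (zp_cylinder p))))"
proof (rule measurable_measure_of)
  show "range (case_prod (zp_cylinder p)) \<subseteq> Pow (carrier (Zp p))"
    by (auto simp: zp_cylinder_def)
  show "digit_sum p \<in> space (digit_measure p) \<rightarrow> carrier (Zp p)"
    using digit_sum_closed by (auto simp: space_digits)
  fix Y assume "Y \<in> range (case_prod (zp_cylinder p))"
  then obtain n r where Y: "Y = zp_cylinder p n r"
    by auto
  show "(digit_sum p) -` Y \<inter> space (digit_measure p)
      \<in> sets (digit_measure p)"
  proof (cases "r \<in> {0..<int p ^ n}")
    case True
    have "r div int p ^ k mod int p \<in> {0..<int p}" for k
      using prime_gt_0_nat[OF prime_p] by simp
    then have "{d \<in> space (digit_measure p). \<forall>k\<in>{..<n}. d k \<in> {r div int p ^ k mod int p}}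
        = prod_emb UNIV (\<lambda>k. uniform_count_measure {0..<int p}) {..<n} (\<Pi>\<^sub>E k\<in>{..<n}. {r div int p ^ k mod int p})"
      by (auto simp: prod_emb_def space_PiM PiE_iff)
    moreover have "\<dots> \<in> sets (digit_measure p)"
      using \<open>\<And>k. r div int p ^ k mod int p \<in> {0..<int p}\<close>
      by (intro sets_PiM_I) (auto simp: sets_uniform_count_measure)
    ultimately show ?thesis
      unfolding Y digit_cylinder[OF True] by simp
  next
    case False
    then show ?thesis
      by (simp add: Y zp_cylinder_empty)
  qed
qed

lemma sets_zp_haar_cylinder: "zp_cylinder p n r \<in> sets (zp_haar p)"
  by (auto simp: sets_zp_haar)

text \<open>A residue class modulo \<open>p ^ n\<close> prescribes \<open>n\<close> independent
  digits, each with probability \<open>1 / p\<close>.\<close>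

lemma emeasure_zp_cylinder:
  assumes "r \<in> {0..<int p ^ n}"
  shows "emeasure (zp_haar p) (zp_cylinder p n r) = ennreal ((1 / real p) ^ n)"
proof -
  have "r div int p ^ k mod int p \<in> {0..<int p}" for k
    using prime_gt_0_nat[OF prime_p] by simp
  then have "emeasure (digit_measure p)
      {d \<in> space (digit_measure p). \<forall>k\<in>{..<n}. d k \<in> {r div int p ^ k mod int p}}
    = (\<Prod>k<n. emeasure (uniform_count_measure {0..<int p}) {r div int p ^ k mod int p})"
    by (intro digits.emeasure_PiM_Collect) (auto simp: sets_uniform_count_measure)
  also have "\<dots> = (\<Prod>k<n. ennreal (1 / real p))"
    using \<open>\<And>k. r div int p ^ k mod int p \<in> {0..<int p}\<close>
    by (intro prod.cong) (simp_all add: emeasure_uniform_count_measure)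
  also have "\<dots> = ennreal ((1 / real p) ^ n)"
    by (simp add: ennreal_power)
  also note digit_cylinder[OF assms, symmetric]
  finally show ?thesis
    using sets_zp_haar_cylinder[of n r] emeasure_distr[OF measurable_digit_sum, of "zp_cylinder p n r"]
    by (simp add: zp_haar_def)
qed

lemma prob_space_zp_haar: "prob_space (zp_haar p)"
  unfolding zp_haar_def using measurable_digit_sum by (rule digits.prob_space_distr)

lemma zp_cylinder_translate:
  assumes b: "b \<in> carrier (Zp p)" and r: "r \<in> {0..<int p ^ n}"
  shows "(\<lambda>a. b \<oplus>\<^bsub>Zp p\<^esub> a) -` zp_cylinder p n r \<inter> carrier (Zp p) = zp_cylinder p n ((r - b n) mod int p ^ n)"
proof -
  have "(b n + a n) mod int p ^ n = r \<longleftrightarrow> a n = (r - b n) mod int p ^ n" if a: "a \<in> carrier (Zp p)" for a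
  proof -
    have "(b n + a n) mod int p ^ n = r \<longleftrightarrow> (b n + a n) mod int p ^ n = r mod int p ^ n"
      using r by simp
    also have "\<dots> \<longleftrightarrow> a n mod int p ^ n = (r - b n) mod int p ^ n"
      by (simp add: mod_eq_dvd_iff algebra_simps)
    finally show ?thesis
      using Zp_mod_self[OF a, of n] by simp
  qed
  moreover have "(b \<oplus>\<^bsub>Zp p\<^esub> a) n = (b n + a n) mod int p ^ n" for a
    by (simp add: Zp_def)
  ultimately show ?thesis
    using b by (auto simp: zp_cylinder_def)
qed

lemma measurable_zp_translate:
  assumes b: "b \<in> carrier (Zp p)"
  shows "(\<lambda>a. b \<oplus>\<^bsub>Zp p\<^esub> a) \<in> measurable (zp_haar p) (zp_haar p)"
proof (rule measurable_sigma_sets[OF sets_zp_haar])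
  show "(\<lambda>a. b \<oplus>\<^bsub>Zp p\<^esub> a) -` Y \<inter> space (zp_haar p) \<in> sets (zp_haar p)"
    if Y: "Y \<in> range (case_prod (zp_cylinder p))" for Y
  proof -
    obtain n r where Y: "Y = zp_cylinder p n r"
      using Y by auto
    show ?thesis
    proof (cases "r \<in> {0..<int p ^ n}")
      case True
      then show ?thesis
        unfolding Y space_zp_haar zp_cylinder_translate[OF b True] sets_zp_haar
        by (intro sigma_sets.Basic) auto
    next
      case False
      then show ?thesis
        by (simp add: Y zp_cylinder_empty)
    qed
  qed
qed (use b in \<open>auto simp: zp_cylinder_def space_zp_haar\<close>)

text \<open>The two measures agree on cylinders, since translation permutes the residue classes of a
  given level, which all have the same measure. Cylinders are closed under intersection because two
  of them are nested or disjoint.\<close>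

lemma zp_haar_translate:
  assumes b: "b \<in> carrier (Zp p)"
  shows "distr (zp_haar p) (zp_haar p) (\<lambda>a. b \<oplus>\<^bsub>Zp p\<^esub> a) = zp_haar p"
proof (rule measure_eqI_generator_eq[where E = "range (case_prod (zp_cylinder p))" and \<Omega> = "carrier (Zp p)"
      and A = "\<lambda>_. zp_cylinder p 0 0"])
  let ?E = "range (case_prod (zp_cylinder p))"
  have int: "zp_cylinder p m r \<inter> zp_cylinder p n s \<in> ?E" if "m \<le> n" for m n r s
  proof (cases "s mod int p ^ m = r")
    case True
    then have "zp_cylinder p m r \<inter> zp_cylinder p n s = zp_cylinder p n s"
      using Zp_carrierD[OF _ that] by (auto simp: zp_cylinder_def)
    then show ?thesis
      by auto
  next
    case False
    \<comment> \<open>At level 0 every element has residue 0, so \<open>zp_cylinder p 0 1\<close> is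
      a name for the empty set within the generating family.\<close>
    then have "zp_cylinder p m r \<inter> zp_cylinder p n s = zp_cylinder p 0 1"
      using Zp_carrierD[OF _ that] Zp_apply_0[OF prime_p] by (fastforce simp: zp_cylinder_def)
    then show ?thesis
      by auto
  qed
  show "Int_stable ?E"
  proof (rule Int_stableI)
    fix A B assume "A \<in> ?E" "B \<in> ?E"
    then obtain m r n s where AB: "A = zp_cylinder p m r" "B = zp_cylinder p n s"
      by auto
    show "A \<inter> B \<in> ?E"
      using int[of m n r s] int[of n m s r] unfolding AB by (cases "m \<le> n") (auto simp: Int_commute)
  qed
  show "emeasure (distr (zp_haar p) (zp_haar p) (\<lambda>a. b \<oplus>\<^bsub>Zp p\<^esub> a)) C = emeasure (zp_haar p) C" if C_in: "C \<in> ?E" for C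
  proof -
    obtain n r where C: "C = zp_cylinder p n r"
      using C_in by auto
    show ?thesis
    proof (cases "r \<in> {0..<int p ^ n}")
      case True
      have "C \<in> sets (zp_haar p)"
        using C_in by (auto simp: sets_zp_haar)
      then have "emeasure (distr (zp_haar p) (zp_haar p) (\<lambda>a. b \<oplus>\<^bsub>Zp p\<^esub> a)) C
          = emeasure (zp_haar p) (zp_cylinder p n ((r - b n) mod int p ^ n))"
        using zp_cylinder_translate[OF b True] measurable_zp_translate[OF b]
        by (simp add: emeasure_distr C space_zp_haar)
      then show ?thesis
        using True prime_gt_0_nat[OF prime_p] by (simp add: C emeasure_zp_cylinder)
    next
      case False
      then show ?thesis
        by (simp add: C zp_cylinder_empty)
    qed
  qed
  show "emeasure (distr (zp_haar p) (zp_haar p) (\<lambda>a. b \<oplus>\<^bsub>Zp p\<^esub> a)) (zp_cylinder p 0 0) \<noteq> \<infinity>" for i :: nat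
    using prob_space.prob_space_distr[OF prob_space_zp_haar measurable_zp_translate[OF b]]
    by (simp add: prob_space_def finite_measure.emeasure_finite)
  show "(\<Union>i::nat. zp_cylinder p 0 0) = carrier (Zp p)"
    using Zp_apply_0[OF prime_p] by (auto simp: zp_cylinder_def)
  show "?E \<subseteq> Pow (carrier (Zp p))"
    by (auto simp: zp_cylinder_def)
qed (auto simp: sets_zp_haar)

text \<open>There are only countably many cylinders, so an open set is a countable union of
  them.\<close>

lemma sets_zp_haarI:
  assumes "V \<subseteq> carrier (Zp p)" and "\<And>a. a \<in> V \<Longrightarrow> \<exists>n. zp_cylinder p n (a n) \<subseteq> V"
  shows "V \<in> sets (zp_haar p)"
proof -
  let ?B = "{C \<in> range (case_prod (zp_cylinder p)). C \<subseteq> V}"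
  have "V = \<Union>?B"
  proof
    show "V \<subseteq> \<Union>?B"
    proof
      fix a assume a: "a \<in> V"
      then obtain n where "zp_cylinder p n (a n) \<subseteq> V"
        using assms(2) by blast
      moreover have "a \<in> zp_cylinder p n (a n)"
        using a assms(1) by (auto simp: zp_cylinder_def)
      ultimately show "a \<in> \<Union>?B"
        by auto
    qed
  qed auto
  moreover have "countable ?B"
    by (rule countable_subset[of _ "range (case_prod (zp_cylinder p))"]) auto
  then have "\<Union>?B \<in> sets (zp_haar p)"
    unfolding sets_zp_haar by (rule sigma_sets_UNION) (auto intro: sigma_sets.Basic)
  ultimately show ?thesis
    by simp
qed

end

context padic_module
begin

lemma padic_open_translate:
  assumes "padic_open p M U" "x \<in> carrier M"
  shows "padic_open p M (x <+\<^bsub>M\<^esub> U)"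
  unfolding padic_open_def
proof (intro conjI ballI)
  have U: "U \<subseteq> carrier M"
    using assms by (simp add: padic_open_def)
  then show "x <+\<^bsub>M\<^esub> U \<subseteq> carrier M"
    using assms(2) by (auto simp: a_l_coset_def l_coset_def)
  fix z assume "z \<in> x <+\<^bsub>M\<^esub> U"
  then obtain u where u: "u \<in> U" "z = x \<oplus> u"
    by (auto simp: a_l_coset_def l_coset_def)
  then obtain n where n: "\<And>y. y \<in> carrier M \<Longrightarrow> u \<oplus> add_pow M (p ^ n) y \<in> U"
    using assms(1) unfolding padic_open_def by blast
  have "z \<oplus> add_pow M (p ^ n) y \<in> x <+\<^bsub>M\<^esub> U" if "y \<in> carrier M" for y
  proof -
    have "z \<oplus> add_pow M (p ^ n) y = x \<oplus> (u \<oplus> add_pow M (p ^ n) y)"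
      using u U assms(2) that by (simp add: M.a_assoc subsetD)
    then show ?thesis
      using n[OF that] by (auto simp: a_l_coset_def l_coset_def)
  qed
  then show "\<exists>n. \<forall>y\<in>carrier M. z \<oplus> add_pow M (p ^ n) y \<in> x <+\<^bsub>M\<^esub> U"
    by blast
qed

text \<open>As preimages, translates inherit measurability from the inverse translation map.\<close>

lemma translate_eq_vimage:
  assumes "x \<in> carrier M" "A \<subseteq> carrier M"
  shows "x <+\<^bsub>M\<^esub> A = (\<lambda>y. \<ominus> x \<oplus> y) -` A \<inter> carrier M"
proof
  show "x <+\<^bsub>M\<^esub> A \<subseteq> (\<lambda>y. \<ominus> x \<oplus> y) -` A \<inter> carrier M"
    using assms by (auto simp: a_l_coset_def l_coset_def M.r_neg1 subsetD)
  show "(\<lambda>y. \<ominus> x \<oplus> y) -` A \<inter> carrier M \<subseteq> x <+\<^bsub>M\<^esub> A"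
  proof
    fix y assume "y \<in> (\<lambda>y. \<ominus> x \<oplus> y) -` A \<inter> carrier M"
    then have "\<ominus> x \<oplus> y \<in> A" "y = x \<oplus> (\<ominus> x \<oplus> y)"
      using assms by (auto simp: M.r_neg2)
    then show "y \<in> x <+\<^bsub>M\<^esub> A"
      by (auto simp: a_l_coset_def l_coset_def)
  qed
qed

end

context split_module
begin

definition T where "T = {x \<in> carrier M. \<rho> x = \<zero>\<^bsub>Zp p\<^esub>}"

definition \<tau> where "\<tau> x = x \<ominus> \<rho> x \<odot> e"

lemma finite_T: "finite T"
  using finite_kernel by (simp add: T_def)

lemma rho_zero [simp]: "\<rho> \<zero> = \<zero>\<^bsub>Zp p\<^esub>"
  using rho_smult[of "\<zero>\<^bsub>Zp p\<^esub>" \<zero>] by simp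

lemma rho_minus: "x \<in> carrier M \<Longrightarrow> \<rho> (\<ominus> x) = \<ominus>\<^bsub>Zp p\<^esub> \<rho> x"
  using rho_add[of "\<ominus> x" x] by (simp add: M.l_neg) (metis M.a_inv_closed R.minus_equality rho_closed)

lemma submodule_T: "submodule T (Zp p) M"
  by (rule submoduleI) (auto simp: T_def rho_add rho_smult rho_minus)

lemma tau_in_T [simp]: "x \<in> carrier M \<Longrightarrow> \<tau> x \<in> T"
  by (simp add: T_def \<tau>_def M.minus_eq rho_add rho_smult rho_minus R.r_neg)

lemma T_add [simp]: "s \<in> T \<Longrightarrow> t \<in> T \<Longrightarrow> s \<oplus> t \<in> T"
  and T_minus [simp]: "t \<in> T \<Longrightarrow> \<ominus> t \<in> T"
  and T_smult [simp]: "a \<in> carrier (Zp p) \<Longrightarrow> t \<in> T \<Longrightarrow> a \<odot> t \<in> T"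
  and T_zero [simp]: "\<zero> \<in> T"
  by (simp_all add: T_def rho_add rho_minus rho_smult)

lemma T_closed: "t \<in> T \<Longrightarrow> t \<in> carrier M"
  by (simp add: T_def)

lemma rho_T [simp]: "t \<in> T \<Longrightarrow> \<rho> t = \<zero>\<^bsub>Zp p\<^esub>"
  by (simp add: T_def)

lemma decompose:
  assumes "x \<in> carrier M"
  shows "x = \<rho> x \<odot> e \<oplus> \<tau> x"
proof -
  have "\<rho> x \<odot> e \<oplus> \<tau> x = x \<oplus> (\<rho> x \<odot> e \<oplus> \<ominus> (\<rho> x \<odot> e))"
    unfolding \<tau>_def M.minus_eq using assms by (intro M.a_lcomm) auto
  then show ?thesis
    using assms by (simp add: M.r_neg)
qed

lemma rho_combine [simp]:
  assumes "a \<in> carrier (Zp p)" "t \<in> T"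
  shows "\<rho> (a \<odot> e \<oplus> t) = a"
  using assms T_closed[OF assms(2)] by (simp add: rho_add rho_smult)

lemma tau_combine [simp]:
  assumes "a \<in> carrier (Zp p)" "t \<in> T"
  shows "\<tau> (a \<odot> e \<oplus> t) = t"
proof -
  have "\<tau> (a \<odot> e \<oplus> t) = t \<oplus> (a \<odot> e \<oplus> \<ominus> (a \<odot> e))"
    unfolding \<tau>_def rho_combine[OF assms] M.minus_eq using assms T_closed[OF assms(2)] by (simp add: M.a_ac)
  then show ?thesis
    using assms T_closed[OF assms(2)] by (simp add: M.r_neg)
qed

lemma tau_add:
  assumes "x \<in> carrier M" "y \<in> carrier M"
  shows "\<tau> (x \<oplus> y) = \<tau> x \<oplus> \<tau> y"
  using assms by (simp add: \<tau>_def M.minus_eq rho_add smult_l_distr M.minus_add M.a_ac)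

lemma tau_smult:
  assumes "a \<in> carrier (Zp p)" "x \<in> carrier M"
  shows "\<tau> (a \<odot> x) = a \<odot> \<tau> x"
  using assms by (simp add: \<tau>_def M.minus_eq rho_smult smult_r_distr smult_r_minus smult_assoc1)

text \<open>Torsion is invisible to \<open>\<rho>\<close> because \<open>Zp\<close> is a domain;
  conversely, the finite kernel is killed by a power of \<open>p\<close>. Hence \<open>T\<close>
  does not depend on the splitting and is the set that enters \<open>mu1\<close>.\<close>

lemma torsion_part_eq: "torsion_part (Zp p) M = T"
proof
  interpret D: domain "Zp p"
    by (rule Zp_domain[OF prime_p])
  show "torsion_part (Zp p) M \<subseteq> T"
  proof
    fix x assume "x \<in> torsion_part (Zp p) M"
    then obtain a where a: "x \<in> carrier M" "a \<in> carrier (Zp p)" "a \<noteq> \<zero>\<^bsub>Zp p\<^esub>" "a \<odot> x = \<zero>"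
      by (auto simp: torsion_part_def)
    then have "a \<otimes>\<^bsub>Zp p\<^esub> \<rho> x = \<zero>\<^bsub>Zp p\<^esub>"
      by (simp flip: rho_smult)
    with a show "x \<in> T"
      using D.integral[of a "\<rho> x"] unfolding T_def by simp
  qed
  obtain k where k: "\<And>x. x \<in> T \<Longrightarrow> zp_power p k \<odot> x = \<zero>"
    using finite_submodule_torsion[OF submodule_T finite_T] by blast
  then show "T \<subseteq> torsion_part (Zp p) M"
    using k T_closed zp_power_nonzero[OF prime_p, of k] unfolding torsion_part_def by (auto intro!: bexI[of _ "zp_power p k"])
qed

definition section_map :: "'a \<times> padic \<Rightarrow> 'a"
  where "section_map = (\<lambda>(t, a). t \<oplus> a \<odot> e)"

text \<open>The splitting identifies \<open>M\<close> with \<open>T\<close> times \<open>Zp\<close>,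
  and the product of the uniform measure with \<open>zp_haar\<close> is transported along it. The
  target sigma-algebra is the one that \<open>is_haar_prob\<close> prescribes.\<close>

definition split_haar :: "'a measure"
  where "split_haar = distr (uniform_count_measure T \<Otimes>\<^sub>M zp_haar p)
    (sigma (carrier M) {U. padic_open p M U}) section_map"

lemma space_split_haar: "space split_haar = carrier M"
  unfolding split_haar_def by (auto simp: padic_open_def intro!: space_measure_of)

lemma sets_split_haar: "sets split_haar = sigma_sets (carrier M) {U. padic_open p M U}"
proof -
  have "{U. padic_open p M U} \<subseteq> Pow (carrier M)"
    by (auto simp: padic_open_def)
  then show ?thesis
    by (simp add: split_haar_def sets_measure_of)
qed

text \<open>The slice of an open set is open in \<open>Zp\<close>: changing \<open>a\<close> within
  a residue class modulo \<open>p ^ n\<close> changes \<open>t \<oplus> a \<odot> e\<close> by an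
  element of \<open>p ^ n M\<close>.\<close>

lemma sets_vimage_open:
  assumes U: "padic_open p M U" and t: "t \<in> T"
  shows "(\<lambda>a. t \<oplus> a \<odot> e) -` U \<inter> carrier (Zp p) \<in> sets (zp_haar p)"
proof (insert T_closed[OF t], rule sets_zp_haarI[OF prime_p])
  fix a assume "a \<in> (\<lambda>a. t \<oplus> a \<odot> e) -` U \<inter> carrier (Zp p)"
  then have a: "a \<in> carrier (Zp p)" "t \<oplus> a \<odot> e \<in> U"
    by auto
  then obtain n where n: "\<And>y. y \<in> carrier M \<Longrightarrow> t \<oplus> a \<odot> e \<oplus> add_pow M (p ^ n) y \<in> U"
    using U unfolding padic_open_def by blast
  have "t \<oplus> b \<odot> e \<in> U" if b: "b \<in> carrier (Zp p)" "b n = a n" for b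
  proof -
    obtain c where c: "c \<in> carrier (Zp p)" "b = a \<oplus>\<^bsub>Zp p\<^esub> zp_power p n \<otimes>\<^bsub>Zp p\<^esub> c"
      using Zp_congE[OF prime_p b(1) a(1) b(2)] by blast
    have "t \<oplus> b \<odot> e = t \<oplus> a \<odot> e \<oplus> zp_power p n \<odot> (c \<odot> e)"
      using a c(1) T_closed[OF t] by (simp add: c(2) smult_l_distr smult_assoc1 M.a_assoc)
    also have "zp_power p n \<odot> (c \<odot> e) = add_pow M (p ^ n) (c \<odot> e)"
      using smult_zp_of_int[of "c \<odot> e" "p ^ n"] c by simp
    finally show ?thesis
      using n c by simp
  qed
  then have "zp_cylinder p n (a n) \<subseteq> (\<lambda>a. t \<oplus> a \<odot> e) -` U \<inter> carrier (Zp p)"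
    by (auto simp: zp_cylinder_def)
  then show "\<exists>n. zp_cylinder p n (a n) \<subseteq> (\<lambda>a. t \<oplus> a \<odot> e) -` U \<inter> carrier (Zp p)" ..
qed auto

lemma measurable_section_t:
  assumes "t \<in> T"
  shows "(\<lambda>a. t \<oplus> a \<odot> e) \<in> measurable (zp_haar p) (sigma (carrier M) {U. padic_open p M U})"
  using sets_vimage_open[OF _ assms] T_closed[OF assms]
  by (intro measurable_measure_of) (auto simp: space_zp_haar padic_open_def)

text \<open>As \<open>T\<close> is finite, joint measurability can be checked slice by
  slice.\<close>

lemma measurable_section_map:
  "section_map \<in> measurable (uniform_count_measure T \<Otimes>\<^sub>M zp_haar p) (sigma (carrier M) {U. padic_open p M U})"
proof -
  have "section_map \<in> measurable (count_space T \<Otimes>\<^sub>M zp_haar p) (sigma (carrier M) {U. padic_open p M U})"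
    using measurable_section_t finite_T
    by (intro measurable_pair_measure_countable1) (auto simp: section_map_def countable_finite)
  moreover have "sets (uniform_count_measure T \<Otimes>\<^sub>M zp_haar p) = sets (count_space T \<Otimes>\<^sub>M zp_haar p)"
    by (intro sets_pair_measure_cong) (auto simp: sets_uniform_count_measure)
  ultimately show ?thesis
    using measurable_cong_sets by blast
qed

lemma prob_space_split_haar: "prob_space split_haar"
proof -
  interpret U: prob_space "uniform_count_measure T"
    by (rule prob_space_uniform_count_measure[OF finite_T]) (use T_zero in blast)
  interpret Z: prob_space "zp_haar p"
    by (rule prob_space_zp_haar[OF prime_p])
  interpret P: pair_prob_space "uniform_count_measure T" "zp_haar p" ..
  show ?thesis
    unfolding split_haar_def using measurable_section_map by (rule P.prob_space_distr)
qed

lemma emeasure_split_haar: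
  assumes "A \<in> sets split_haar"
  shows "emeasure split_haar A =
    (\<Sum>t\<in>T. ennreal (1 / real (card T)) * emeasure (zp_haar p) ((\<lambda>a. t \<oplus> a \<odot> e) -` A \<inter> carrier (Zp p)))"
proof -
  interpret Z: prob_space "zp_haar p"
    by (rule prob_space_zp_haar[OF prime_p])
  let ?P = "uniform_count_measure T \<Otimes>\<^sub>M zp_haar p"
  have A: "A \<in> sets (sigma (carrier M) {U. padic_open p M U})"
    using assms by (simp add: split_haar_def)
  have "emeasure split_haar A = emeasure ?P (section_map -` A \<inter> space ?P)"
    unfolding split_haar_def using measurable_section_map A by (rule emeasure_distr)
  also have "\<dots> = (\<integral>\<^sup>+t. emeasure (zp_haar p) (Pair t -` (section_map -` A \<inter> space ?P)) \<partial>uniform_count_measure T)"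
    using measurable_sets[OF measurable_section_map A] by (rule Z.emeasure_pair_measure_alt)
  also have "\<dots> = (\<Sum>t\<in>T. ennreal (1 / real (card T)) * emeasure (zp_haar p) (Pair t -` (section_map -` A \<inter> space ?P)))"
    unfolding uniform_count_measure_def using finite_T by (rule nn_integral_point_measure_finite)
  also have "\<dots> = (\<Sum>t\<in>T. ennreal (1 / real (card T)) * emeasure (zp_haar p) ((\<lambda>a. t \<oplus> a \<odot> e) -` A \<inter> carrier (Zp p)))"
    by (intro sum.cong refl arg_cong2[where f = "(*)"] arg_cong2[where f = emeasure])
      (auto simp: section_map_def space_pair_measure space_zp_haar space_uniform_count_measure)
  finally show ?thesis .
qed

lemma sets_split_haar_translate:
  assumes "A \<in> sets split_haar" and x: "x \<in> carrier M"
  shows "x <+\<^bsub>M\<^esub> A \<in> sets split_haar"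
proof -
  have "(\<lambda>y. \<ominus> x \<oplus> y) \<in> measurable split_haar (sigma (carrier M) {U. padic_open p M U})"
  proof (rule measurable_measure_of)
    show "(\<lambda>y. \<ominus> x \<oplus> y) -` U \<inter> space split_haar \<in> sets split_haar" if "U \<in> {U. padic_open p M U}" for U
    proof -
      have "U \<subseteq> carrier M"
        using that by (auto simp: padic_open_def)
      then have "(\<lambda>y. \<ominus> x \<oplus> y) -` U \<inter> space split_haar = x <+\<^bsub>M\<^esub> U"
        using translate_eq_vimage[OF x] by (simp add: space_split_haar)
      then show ?thesis
        using padic_open_translate[OF _ x] that by (auto simp: sets_split_haar)
    qed
  qed (use x in \<open>auto simp: padic_open_def space_split_haar\<close>)
  moreover have "A \<in> sets (sigma (carrier M) {U. padic_open p M U})"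
    using assms by (simp add: split_haar_def)
  ultimately have "(\<lambda>y. \<ominus> x \<oplus> y) -` A \<inter> space split_haar \<in> sets split_haar"
    by (rule measurable_sets)
  then show ?thesis
    using translate_eq_vimage[OF x] sets.sets_into_space[OF assms(1)] by (simp add: space_split_haar)
qed

text \<open>Translation by \<open>x\<close> permutes the slices through \<open>\<tau> x\<close> and
  translates within each slice through \<open>\<rho> x\<close>. The former is absorbed by the
  uniform weights on \<open>T\<close>, the latter by the invariance of
  \<open>zp_haar\<close>.\<close>

lemma is_haar_prob_split_haar: "is_haar_prob p M split_haar"
  unfolding is_haar_prob_def
proof (intro conjI ballI)
  fix x A assume x: "x \<in> carrier M" and A: "A \<in> sets split_haar"
  have A_sub: "A \<subseteq> carrier M"
    using sets.sets_into_space[OF A] by (simp add: space_split_haar)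
  define L where "L t = emeasure (zp_haar p) ((\<lambda>a. t \<oplus> a \<odot> e) -` A \<inter> carrier (Zp p))" for t
  have "emeasure (zp_haar p) ((\<lambda>a. t \<oplus> a \<odot> e) -` (x <+\<^bsub>M\<^esub> A) \<inter> carrier (Zp p)) = L (\<ominus> \<tau> x \<oplus> t)"
    if t: "t \<in> T" for t
  proof -
    let ?V = "(\<lambda>a. \<ominus> \<tau> x \<oplus> t \<oplus> a \<odot> e) -` A \<inter> carrier (Zp p)"
    have "\<ominus> x \<oplus> (t \<oplus> a \<odot> e) = \<ominus> \<tau> x \<oplus> t \<oplus> (\<ominus>\<^bsub>Zp p\<^esub> \<rho> x \<oplus>\<^bsub>Zp p\<^esub> a) \<odot> e"
      if a: "a \<in> carrier (Zp p)" for a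
    proof -
      have "\<ominus> x = \<ominus> (\<rho> x \<odot> e) \<oplus> \<ominus> \<tau> x"
        using x T_closed[OF tau_in_T[OF x]] by (subst decompose[OF x]) (simp add: M.minus_add)
      then show ?thesis
        using x a T_closed[OF t] T_closed[OF tau_in_T[OF x]] by (simp add: smult_l_distr smult_l_minus M.a_ac)
    qed
    then have "(\<lambda>a. t \<oplus> a \<odot> e) -` (x <+\<^bsub>M\<^esub> A) \<inter> carrier (Zp p)
        = (\<lambda>a. \<ominus>\<^bsub>Zp p\<^esub> \<rho> x \<oplus>\<^bsub>Zp p\<^esub> a) -` ?V \<inter> space (zp_haar p)"
      using x T_closed[OF t] by (auto simp: translate_eq_vimage[OF x A_sub] space_zp_haar)
    moreover have "?V \<in> sets (zp_haar p)"
    proof -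
      have "A \<in> sets (sigma (carrier M) {U. padic_open p M U})"
        using A by (simp add: split_haar_def)
      then show ?thesis
        using measurable_sets[OF measurable_section_t[of "\<ominus> \<tau> x \<oplus> t"], of A] x t
        by (simp add: space_zp_haar)
    qed
    moreover have "emeasure (zp_haar p) ((\<lambda>a. \<ominus>\<^bsub>Zp p\<^esub> \<rho> x \<oplus>\<^bsub>Zp p\<^esub> a) -` ?V \<inter> space (zp_haar p)) = emeasure (zp_haar p) ?V"
      if "?V \<in> sets (zp_haar p)"
      using emeasure_distr[OF measurable_zp_translate[OF prime_p, of "\<ominus>\<^bsub>Zp p\<^esub> \<rho> x"] that]
        zp_haar_translate[OF prime_p, of "\<ominus>\<^bsub>Zp p\<^esub> \<rho> x"] x by simp
    ultimately show ?thesis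
      by (simp add: L_def)
  qed
  then have "emeasure split_haar (x <+\<^bsub>M\<^esub> A) = (\<Sum>t\<in>T. ennreal (1 / real (card T)) * L (\<ominus> \<tau> x \<oplus> t))"
    by (simp add: emeasure_split_haar[OF sets_split_haar_translate[OF A x]])
  also have "\<dots> = (\<Sum>t\<in>T. ennreal (1 / real (card T)) * L t)"
  proof (rule sum.reindex_bij_witness[of _ "\<lambda>t. \<tau> x \<oplus> t" "\<lambda>t. \<ominus> \<tau> x \<oplus> t"])
  qed (use x T_closed in \<open>auto simp: M.r_neg1 M.r_neg2\<close>)
  also have "\<dots> = emeasure split_haar A"
    by (simp add: emeasure_split_haar[OF A] L_def)
  finally show "emeasure split_haar (x <+\<^bsub>M\<^esub> A) = emeasure split_haar A" .
qed (rule space_split_haar sets_split_haar prob_space_split_haar)+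

text \<open>The model \<open>split_haar\<close> makes the choice in \<open>haar\<close> meaningful.
  Later computations are stated for an arbitrary invariant \<open>\<mu>\<close> and so apply to
  whichever measure is chosen.\<close>

lemma is_haar_prob_haar: "is_haar_prob p M (haar p M)"
  unfolding haar_def using is_haar_prob_split_haar by (rule someI)

end

section \<open>Haar measure of the generators of a cyclic kernel\<close>

text \<open>Invariance makes all pieces equally large. It is applied to the kernel inside
  \<open>M\<close>, with index \<open>p ^ n\<close>, and to \<open>p\<close> times the kernel inside
  the kernel, with index \<open>p\<close>.\<close>

lemma (in padic_module) measure_coset_partition:
  assumes \<mu>: "is_haar_prob p M \<mu>" and A: "padic_open p M A"
    and I: "finite I" "\<And>i. i \<in> I \<Longrightarrow> s i \<in> carrier M" "\<And>i. i \<in> I \<Longrightarrow> s i <+\<^bsub>M\<^esub> A \<subseteq> B"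
    and partition: "\<And>x. x \<in> B \<Longrightarrow> \<exists>!i. i \<in> I \<and> x \<in> s i <+\<^bsub>M\<^esub> A"
  shows "measure \<mu> B = real (card I) * measure \<mu> A"
proof -
  interpret prob_space \<mu>
    using \<mu> by (simp add: is_haar_prob_def)
  have sets: "U \<in> sets \<mu>" if "padic_open p M U" for U
    using \<mu> that by (auto simp: is_haar_prob_def)
  have translate: "measure \<mu> (s i <+\<^bsub>M\<^esub> A) = measure \<mu> A" if "i \<in> I" for i
    using \<mu> I(2)[OF that] sets[OF A] by (auto simp: is_haar_prob_def measure_def)
  have "B = (\<Union>i\<in>I. s i <+\<^bsub>M\<^esub> A)"
    using I(3) partition by blast
  moreover have "disjoint_family_on (\<lambda>i. s i <+\<^bsub>M\<^esub> A) I"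
    unfolding disjoint_family_on_def using I(3) partition by blast
  ultimately have "measure \<mu> B = (\<Sum>i\<in>I. measure \<mu> (s i <+\<^bsub>M\<^esub> A))"
    using I sets padic_open_translate[OF A] by (simp only:) (intro finite_measure_finite_Union, auto)
  then show ?thesis
    by (simp add: translate)
qed

locale cyclic_quotient = split_module p M e \<rho> + G: comm_group G
  for p :: nat and M (structure) and e and \<rho> :: "_ \<Rightarrow> padic" and G (structure) +
  fixes n :: nat and q and w
  assumes card_G: "card (carrier G) = p ^ n"
    and q_hom: "q \<in> hom (add_monoid M) G"
    and q_surj: "q ` carrier M = carrier G"
    and w_closed [simp]: "w \<in> carrier M"
    and q_kernel: "{x \<in> carrier M. q x = \<one>\<^bsub>G\<^esub>} = cyclic_submodule w"
begin

lemma finite_G: "finite (carrier G)"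
  using card_G prime_gt_0_nat[OF prime_p] by (intro card_ge_0_finite) simp

lemma q_closed [simp]: "x \<in> carrier M \<Longrightarrow> q x \<in> carrier G"
  using q_surj by blast

lemma q_add [simp]: "x \<in> carrier M \<Longrightarrow> y \<in> carrier M \<Longrightarrow> q (x \<oplus> y) = q x \<otimes>\<^bsub>G\<^esub> q y"
  using q_hom by (simp add: hom_def)

lemma q_zero [simp]: "q \<zero> = \<one>\<^bsub>G\<^esub>"
  using q_add[of \<zero> \<zero>] by (simp del: q_add)

lemma q_minus: "x \<in> carrier M \<Longrightarrow> q (\<ominus> x) = inv\<^bsub>G\<^esub> q x"
  using q_add[of "\<ominus> x" x] by (simp add: M.l_neg G.inv_equality[symmetric] del: q_add)

lemma q_eq_1_iff: "x \<in> carrier M \<Longrightarrow> q x = \<one>\<^bsub>G\<^esub> \<longleftrightarrow> x \<in> cyclic_submodule w"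
  using q_kernel by blast

lemma q_eq_iff:
  assumes "x \<in> carrier M" "y \<in> carrier M"
  shows "q x = q y \<longleftrightarrow> x \<ominus> y \<in> cyclic_submodule w"
proof -
  have "x \<ominus> y \<in> cyclic_submodule w \<longleftrightarrow> q x \<otimes>\<^bsub>G\<^esub> inv\<^bsub>G\<^esub> q y = \<one>\<^bsub>G\<^esub>"
    using assms by (simp add: q_minus M.minus_eq flip: q_eq_1_iff)
  also have "\<dots> \<longleftrightarrow> q x = q y"
    using assms G.inv_equality[of "q x" "inv\<^bsub>G\<^esub> q y"] by (auto simp: G.r_inv)
  finally show ?thesis ..
qed

lemma power_smult_in_kernel:
  assumes "x \<in> carrier M"
  shows "zp_power p n \<odot> x \<in> cyclic_submodule w"
proof -
  have "q (add_pow M k x) = q x [^]\<^bsub>G\<^esub> k" for k :: nat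
    by (induction k) (use assms in auto)
  then have "q (zp_power p n \<odot> x) = \<one>\<^bsub>G\<^esub>"
    using assms smult_zp_of_int[OF assms, of "p ^ n"] G.pow_order_eq_1[of "q x"] card_G
    by (simp add: order_def)
  then show ?thesis
    using assms by (simp add: q_eq_1_iff)
qed

text \<open>With zero free coordinate in \<open>w\<close>, the whole kernel would lie in
  \<open>T\<close>, but it contains \<open>p ^ n e\<close>. Consequently \<open>w\<close> generates
  a free module, which is the content of \<open>smult_w_cancel\<close>.\<close>

lemma rho_w_nonzero: "\<rho> w \<noteq> \<zero>\<^bsub>Zp p\<^esub>"
proof
  assume "\<rho> w = \<zero>\<^bsub>Zp p\<^esub>"
  moreover obtain a where "a \<in> carrier (Zp p)" "zp_power p n \<odot> e = a \<odot> w"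
    using power_smult_in_kernel[of e] by (auto simp: cyclic_submodule_def)
  moreover from this have "zp_power p n = a \<otimes>\<^bsub>Zp p\<^esub> \<rho> w"
    using rho_smult[of a w] rho_smult[of "zp_power p n" e] by simp
  ultimately show False
    using zp_power_nonzero[OF prime_p, of n] by simp
qed

lemma smult_w_cancel:
  assumes "a \<odot> w = b \<odot> w" "a \<in> carrier (Zp p)" "b \<in> carrier (Zp p)"
  shows "a = b"
proof -
  interpret D: domain "Zp p"
    by (rule Zp_domain[OF prime_p])
  have "a \<otimes>\<^bsub>Zp p\<^esub> \<rho> w = b \<otimes>\<^bsub>Zp p\<^esub> \<rho> w"
    using assms by (simp flip: rho_smult)
  then show ?thesis
    using assms rho_w_nonzero by (simp add: D.m_rcancel)
qed

lemma padic_openI: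
  assumes N: "submodule N (Zp p) M" and "\<And>x. x \<in> carrier M \<Longrightarrow> zp_power p m \<odot> x \<in> N"
  shows "padic_open p M N"
  unfolding padic_open_def
proof (intro conjI ballI exI[of _ m])
  show "x \<oplus> add_pow M (p ^ m) y \<in> N" if "x \<in> N" "y \<in> carrier M" for x y
    using submoduleE(5)[OF N that(1) assms(2)[OF that(2)]] smult_zp_of_int[OF that(2), of "p ^ m"] by simp
qed (rule submoduleE(1)[OF N])

lemma padic_open_kernel: "padic_open p M (cyclic_submodule w)"
  using cyclic_submodule_is_submodule[OF w_closed] power_smult_in_kernel by (rule padic_openI)

text \<open>The cosets of the kernel are the fibres of \<open>q\<close>, one for each of the
  \<open>p ^ n\<close> elements of \<open>G\<close>.\<close>

lemma measure_kernel:
  assumes \<mu>: "is_haar_prob p M \<mu>"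
  shows "measure \<mu> (cyclic_submodule w) = 1 / real p ^ n"
proof -
  interpret prob_space \<mu>
    using \<mu> by (simp add: is_haar_prob_def)
  define s where "s = inv_into (carrier M) q"
  have s: "s g \<in> carrier M" "q (s g) = g" if "g \<in> carrier G" for g
    using that q_surj by (auto simp: s_def inv_into_into f_inv_into_f)
  have coset: "x \<in> s g <+\<^bsub>M\<^esub> cyclic_submodule w \<longleftrightarrow> q x = g"
    if "g \<in> carrier G" "x \<in> carrier M" for x g
  proof -
    have "x \<in> s g <+\<^bsub>M\<^esub> cyclic_submodule w \<longleftrightarrow> \<ominus> s g \<oplus> x \<in> cyclic_submodule w"
      using that s(1) submoduleE(1)[OF cyclic_submodule_is_submodule[OF w_closed]]
      by (simp add: translate_eq_vimage)
    also have "\<dots> \<longleftrightarrow> q x = q (s g)"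
      using that s(1) by (simp add: q_eq_iff M.minus_eq M.a_comm)
    finally show ?thesis
      using s(2) that by simp
  qed
  have sub: "s g <+\<^bsub>M\<^esub> cyclic_submodule w \<subseteq> carrier M" if "g \<in> carrier G" for g
    using padic_open_translate[OF padic_open_kernel s(1)[OF that]] by (simp add: padic_open_def)
  have space: "space \<mu> = carrier M"
    using \<mu> by (simp add: is_haar_prob_def)
  have "measure \<mu> (space \<mu>) = real (card (carrier G)) * measure \<mu> (cyclic_submodule w)"
  proof (rule measure_coset_partition[OF \<mu> padic_open_kernel finite_G, of s])
    show "\<exists>!g. g \<in> carrier G \<and> x \<in> s g <+\<^bsub>M\<^esub> cyclic_submodule w" if "x \<in> space \<mu>" for x
      using that coset q_closed unfolding space by (intro ex1I[of _ "q x"]) auto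
  qed (use s(1) sub space in auto)
  then have "1 = real p ^ n * measure \<mu> (cyclic_submodule w)"
    by (simp add: prob_space card_G)
  then show ?thesis
    using prime_gt_0_nat[OF prime_p] by (simp add: nonzero_eq_divide_eq mult.commute)
qed

lemma cyclic_submodule_prime_smult: "cyclic_submodule (zp_power p 1 \<odot> w) = {a \<odot> w |a. a \<in> carrier (Zp p) \<and> a 1 = 0}"
proof -
  have "\<exists>b\<in>carrier (Zp p). a \<odot> w = b \<odot> (zp_power p 1 \<odot> w)" if "a \<in> carrier (Zp p)" "a 1 = 0" for a
  proof -
    obtain b where "b \<in> carrier (Zp p)" "a = zp_power p 1 \<otimes>\<^bsub>Zp p\<^esub> b"
      using Zp_dividesE[OF prime_p \<open>a \<in> carrier (Zp p)\<close> \<open>a 1 = 0\<close>] by blast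
    then show ?thesis
      using R.m_comm[of "zp_power p 1" b] by (intro bexI[of _ b]) (simp_all add: smult_assoc1)
  qed
  moreover have "\<exists>a. b \<odot> (zp_power p 1 \<odot> w) = a \<odot> w \<and> a \<in> carrier (Zp p) \<and> a 1 = 0" if "b \<in> carrier (Zp p)" for b
  proof (intro exI conjI)
    show "b \<odot> (zp_power p 1 \<odot> w) = (b \<otimes>\<^bsub>Zp p\<^esub> zp_power p 1) \<odot> w"
      using that by (simp add: smult_assoc1)
    show "(b \<otimes>\<^bsub>Zp p\<^esub> zp_power p 1) 1 = 0"
      by (simp add: Zp_def zp_of_int_def)
  qed (use that in auto)
  ultimately show ?thesis
    by (auto simp: cyclic_submodule_def)
qed

text \<open>Since \<open>Zp w\<close> is free, \<open>a \<odot> w\<close> generates it iff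
  \<open>a\<close> is a unit, that is, iff \<open>a\<close> has nonzero residue modulo
  \<open>p\<close>.\<close>

lemma generators_eq:
  "{x \<in> carrier M. cyclic_submodule x = cyclic_submodule w} = cyclic_submodule w - cyclic_submodule (zp_power p 1 \<odot> w)"
proof -
  have "cyclic_submodule (a \<odot> w) = cyclic_submodule w \<longleftrightarrow> a 1 \<noteq> 0" if a: "a \<in> carrier (Zp p)" for a
  proof
    assume "cyclic_submodule (a \<odot> w) = cyclic_submodule w"
    then obtain b where b: "b \<in> carrier (Zp p)" "w = b \<odot> (a \<odot> w)"
      using mem_cyclic_submodule[OF w_closed] by (auto simp: cyclic_submodule_def)
    then have "\<one>\<^bsub>Zp p\<^esub> \<odot> w = (b \<otimes>\<^bsub>Zp p\<^esub> a) \<odot> w"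
      using a by (simp add: smult_assoc1)
    then have "\<one>\<^bsub>Zp p\<^esub> = b \<otimes>\<^bsub>Zp p\<^esub> a"
      using a b by (intro smult_w_cancel) auto
    then have "1 mod int p = (b 1 * a 1) mod int p"
      by (auto simp: Zp_def dest: fun_cong[of _ _ 1])
    then show "a 1 \<noteq> 0"
      using prime_gt_1_nat[OF prime_p] by auto
  next
    assume "a 1 \<noteq> 0"
    then have u: "a \<in> Units (Zp p)"
      using Zp_UnitsI[OF prime_p a] by simp
    then have w: "w = inv\<^bsub>Zp p\<^esub> a \<odot> (a \<odot> w)"
      using a by (simp flip: smult_assoc1)
    have "a \<odot> w \<in> cyclic_submodule w" "w \<in> cyclic_submodule (a \<odot> w)"
      using a u w unfolding cyclic_submodule_def by auto
    then show "cyclic_submodule (a \<odot> w) = cyclic_submodule w"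
      using a by (simp add: cyclic_submodule_is_submodule cyclic_submodule_subset_iff subset_antisym)
  qed
  moreover have "x \<in> cyclic_submodule w" if "x \<in> carrier M" "cyclic_submodule x = cyclic_submodule w" for x
    using mem_cyclic_submodule that by blast
  moreover have "a \<odot> w \<in> cyclic_submodule (zp_power p 1 \<odot> w) \<longleftrightarrow> a 1 = 0" if "a \<in> carrier (Zp p)" for a
    unfolding cyclic_submodule_prime_smult using smult_w_cancel that by blast
  moreover have "\<exists>a\<in>carrier (Zp p). x = a \<odot> w" if "x \<in> cyclic_submodule w" for x
    using that by (auto simp: cyclic_submodule_def)
  moreover have "a \<odot> w \<in> cyclic_submodule w" if "a \<in> carrier (Zp p)" for a
    using that by (auto simp: cyclic_submodule_def)
  ultimately have "x \<in> carrier M \<and> cyclic_submodule x = cyclic_submodule w \<longleftrightarrow>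
      x \<in> cyclic_submodule w \<and> x \<notin> cyclic_submodule (zp_power p 1 \<odot> w)" for x
    by (metis smult_closed w_closed)
  then show ?thesis
    by (simp add: set_eq_iff)
qed

lemma measure_generators:
  assumes \<mu>: "is_haar_prob p M \<mu>"
  shows "{x \<in> carrier M. cyclic_submodule x = cyclic_submodule w} \<in> sets \<mu>"
    and "measure \<mu> {x \<in> carrier M. cyclic_submodule x = cyclic_submodule w} = (1 - 1 / real p) / real p ^ n"
proof -
  interpret prob_space \<mu>
    using \<mu> by (simp add: is_haar_prob_def)
  let ?N = "cyclic_submodule w" and ?N' = "cyclic_submodule (zp_power p 1 \<odot> w)"
  have "padic_open p M ?N'"
  proof (rule padic_openI)
    fix x assume x: "x \<in> carrier M"
    obtain a where a: "a \<in> carrier (Zp p)" "zp_power p n \<odot> x = a \<odot> w"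
      using power_smult_in_kernel[OF x] by (auto simp: cyclic_submodule_def)
    have "zp_power p (Suc n) \<odot> x = zp_power p 1 \<odot> (zp_power p n \<odot> x)"
      using x by (simp add: zp_of_int_mult flip: smult_assoc1)
    also have "\<dots> = a \<odot> (zp_power p 1 \<odot> w)"
      using a R.m_comm[of a "zp_power p 1"] by (simp flip: smult_assoc1)
    finally show "zp_power p (Suc n) \<odot> x \<in> ?N'"
      using a by (auto simp: cyclic_submodule_def)
  qed (simp add: cyclic_submodule_is_submodule)
  have sub: "?N \<subseteq> carrier M" "?N' \<subseteq> carrier M"
    by (auto simp: cyclic_submodule_def)
  \<comment> \<open>Representatives of \<open>Zp w\<close> modulo \<open>p Zp w\<close>: the
    integers from 0 to \<open>p - 1\<close> times \<open>w\<close>.\<close>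
  define s where "s j = zp_of_int p (int j) \<odot> w" for j
  have coset: "a \<odot> w \<in> s j <+\<^bsub>M\<^esub> ?N' \<longleftrightarrow> a 1 = int j" if "a \<in> carrier (Zp p)" "j < p" for a j
  proof -
    have "a \<odot> w \<in> s j <+\<^bsub>M\<^esub> ?N' \<longleftrightarrow> \<ominus> s j \<oplus> a \<odot> w \<in> ?N'"
      using that sub by (simp add: translate_eq_vimage s_def)
    also have "\<ominus> s j \<oplus> a \<odot> w = (\<ominus>\<^bsub>Zp p\<^esub> zp_of_int p (int j) \<oplus>\<^bsub>Zp p\<^esub> a) \<odot> w"
      using that by (simp add: s_def smult_l_distr smult_l_minus)
    also have "\<dots> \<in> ?N' \<longleftrightarrow> (\<ominus>\<^bsub>Zp p\<^esub> zp_of_int p (int j) \<oplus>\<^bsub>Zp p\<^esub> a) 1 = 0"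
      unfolding cyclic_submodule_prime_smult using that smult_w_cancel by force
    also have "\<ominus>\<^bsub>Zp p\<^esub> zp_of_int p (int j) = zp_of_int p (- int j)"
      by (intro R.minus_equality) (simp_all add: zp_of_int_add zp_of_int_0)
    also have "(zp_of_int p (- int j) \<oplus>\<^bsub>Zp p\<^esub> a) 1 = (a 1 - int j) mod int p"
      by (simp add: Zp_def zp_of_int_def mod_add_left_eq)
    also have "\<dots> = 0 \<longleftrightarrow> a 1 mod int p = int j mod int p"
      by (simp add: mod_eq_dvd_iff dvd_eq_mod_eq_0)
    also have "\<dots> \<longleftrightarrow> a 1 = int j"
      using Zp_apply_bounds[OF prime_p that(1), of 1] that(2) by simp
    finally show ?thesis .
  qed
  have s_sub: "s j <+\<^bsub>M\<^esub> ?N' \<subseteq> ?N" for j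
  proof
    fix x assume "x \<in> s j <+\<^bsub>M\<^esub> ?N'"
    then obtain a where "a \<in> carrier (Zp p)" "x = s j \<oplus> a \<odot> w"
      unfolding cyclic_submodule_prime_smult by (auto simp: a_l_coset_def l_coset_def)
    then have "x = (zp_of_int p (int j) \<oplus>\<^bsub>Zp p\<^esub> a) \<odot> w"
      by (simp add: s_def smult_l_distr)
    then show "x \<in> ?N"
      using \<open>a \<in> carrier (Zp p)\<close> by (auto simp: cyclic_submodule_def)
  qed
  have "measure \<mu> ?N = real (card {..<p}) * measure \<mu> ?N'"
  proof (rule measure_coset_partition[OF \<mu> \<open>padic_open p M ?N'\<close>, of _ s])
    fix x assume "x \<in> ?N"
    then obtain a where a: "a \<in> carrier (Zp p)" "x = a \<odot> w"
      by (auto simp: cyclic_submodule_def)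
    define j where "j = nat (a 1)"
    have "j < p" "a 1 = int j"
      using Zp_apply_bounds[OF prime_p a(1), of 1] by (auto simp: j_def)
    then show "\<exists>!j. j \<in> {..<p} \<and> x \<in> s j <+\<^bsub>M\<^esub> ?N'"
      using coset[OF a(1)] a(2) by (intro ex1I[of _ j]) auto
  qed (use s_sub in \<open>auto simp: s_def\<close>)
  then have "measure \<mu> ?N = real p * measure \<mu> ?N'"
    by simp
  moreover have sets: "?N \<in> sets \<mu>" "?N' \<in> sets \<mu>"
    using \<mu> padic_open_kernel \<open>padic_open p M ?N'\<close> by (auto simp: is_haar_prob_def)
  moreover have "?N' \<subseteq> ?N"
    unfolding cyclic_submodule_prime_smult by (auto simp: cyclic_submodule_def)
  ultimately show "measure \<mu> {x \<in> carrier M. cyclic_submodule x = ?N} = (1 - 1 / real p) / real p ^ n"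
    unfolding generators_eq using measure_kernel[OF \<mu>] prime_gt_0_nat[OF prime_p]
    by (simp add: finite_measure_Diff field_simps)
  show "{x \<in> carrier M. cyclic_submodule x = ?N} \<in> sets \<mu>"
    unfolding generators_eq using sets by blast
qed

end

text \<open>Positivity of \<open>c\<close> makes the fibres finite, as infinite sets have
  \<open>card\<close> 0; finiteness of \<open>A\<close> is then a conclusion. The set of quotient
  maps is shown to be finite in this way.\<close>

lemma card_fibres:
  assumes fin: "finite (f ` A)" and c: "c > 0" and fib: "\<And>x. x \<in> A \<Longrightarrow> card {y \<in> A. f y = f x} = c"
  shows "finite A" "card A = c * card (f ` A)"
proof -
  have A: "A = (\<Union>z\<in>f ` A. {y \<in> A. f y = z})"
    by auto
  have fin': "finite {y \<in> A. f y = z}" if "z \<in> f ` A" for z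
    using that fib c by (auto intro!: card_ge_0_finite)
  then show "finite A"
    using fin by (subst A) blast
  have "card (\<Union>z\<in>f ` A. {y \<in> A. f y = z}) = (\<Sum>z\<in>f ` A. card {y \<in> A. f y = z})"
    using fin fin' by (intro card_UN_disjoint) auto
  also have "\<dots> = (\<Sum>z\<in>f ` A. c)"
    using fib by (intro sum.cong) auto
  finally show "card A = c * card (f ` A)"
    using A by simp
qed

section \<open>Automorphisms of a split module\<close>

context split_module
begin

definition auto_T where "auto_T = auto (add_monoid (M\<lparr>carrier := T\<rparr>))"

lemma auto_T_iff: "\<alpha> \<in> auto_T \<longleftrightarrow> \<alpha> \<in> extensional T \<and> bij_betw \<alpha> T T \<and> (\<forall>s\<in>T. \<forall>t\<in>T. \<alpha> (s \<oplus> t) = \<alpha> s \<oplus> \<alpha> t)"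
  by (auto simp: auto_T_def auto_def Bij_def hom_def dest: bij_betwE)

lemma auto_T_closed: "\<alpha> \<in> auto_T \<Longrightarrow> t \<in> T \<Longrightarrow> \<alpha> t \<in> T"
  by (auto simp: auto_T_iff dest: bij_betwE)

lemma finite_auto_T: "finite auto_T"
proof (rule finite_subset)
  show "auto_T \<subseteq> (\<Pi>\<^sub>E t\<in>T. T)"
    by (intro subsetI PiE_I) (auto simp: auto_T_closed, auto simp: auto_T_iff extensional_def)
  show "finite (\<Pi>\<^sub>E t\<in>T. T)"
    using finite_T by (intro finite_PiE) auto
qed

lemma auto_T_pos: "card auto_T > 0"
proof -
  have "(\<lambda>t\<in>T. t) \<in> auto_T"
    by (auto simp: auto_T_iff bij_betw_def inj_on_def)
  then show ?thesis
    using finite_auto_T by (auto simp: card_gt_0_iff)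
qed

lemma card_T_pos: "card T > 0"
  by (metis card_gt_0_iff empty_iff finite_T T_zero)

text \<open>In the coordinates of the splitting this is a triangular matrix with diagonal entries
  \<open>u\<close> and \<open>\<alpha>\<close>; the off-diagonal entry \<open>t\<close> is the
  \<open>T\<close>-component of the image of \<open>e\<close>. There is no entry from
  \<open>T\<close> to \<open>Zp\<close>, since torsion cannot map nontrivially to a free
  module.\<close>

definition split_map where "split_map u t \<alpha> x = (\<rho> x \<otimes>\<^bsub>Zp p\<^esub> u) \<odot> e \<oplus> (\<rho> x \<odot> t \<oplus> \<alpha> (\<tau> x))"

text \<open>Elements of \<open>auto_T\<close> are group automorphisms; they are linear because a
  power of \<open>p\<close> kills \<open>T\<close>.\<close>

lemma auto_T_tau_hom:
  assumes "\<alpha> \<in> auto_T"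
  shows "(\<lambda>x. \<alpha> (\<tau> x)) \<in> module_hom (Zp p) M M"
proof -
  obtain k where k: "\<And>x. x \<in> T \<Longrightarrow> zp_power p k \<odot> x = \<zero>"
    using finite_submodule_torsion[OF submodule_T finite_T] by blast
  have \<alpha>: "\<alpha> t \<in> T" if "t \<in> T" for t
    using auto_T_closed[OF assms that] .
  show ?thesis
  proof (rule additive_imp_module_hom[where n = k])
    show "module (Zp p) M" ..
    show "\<alpha> (\<tau> (x \<oplus> y)) = \<alpha> (\<tau> x) \<oplus> \<alpha> (\<tau> y)" if "x \<in> carrier M" "y \<in> carrier M" for x y
      using that assms by (simp add: auto_T_iff tau_add)
  qed (use \<alpha> k T_closed in auto)
qed

lemma
  assumes u: "u \<in> Units (Zp p)" and t: "t \<in> T" and \<alpha>: "\<alpha> \<in> auto_T"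
  shows split_map_iso: "split_map u t \<alpha> \<in> module_iso (Zp p) M M"
    and rho_split_map: "x \<in> carrier M \<Longrightarrow> \<rho> (split_map u t \<alpha> x) = \<rho> x \<otimes>\<^bsub>Zp p\<^esub> u"
    and tau_split_map: "x \<in> carrier M \<Longrightarrow> \<tau> (split_map u t \<alpha> x) = \<rho> x \<odot> t \<oplus> \<alpha> (\<tau> x)"
proof -
  note hom = module_homD[OF auto_T_tau_hom[OF \<alpha>]]
  have \<alpha>T: "\<alpha> s \<in> T" if "s \<in> T" for s
    using auto_T_closed[OF \<alpha> that] .
  have tc: "t \<in> carrier M" and uc: "u \<in> carrier (Zp p)"
    using t u T_closed R.Units_closed by auto
  have rT: "\<rho> x \<odot> t \<oplus> \<alpha> (\<tau> x) \<in> T" if "x \<in> carrier M" for x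
    using that t \<alpha>T by simp
  show rho: "\<rho> (split_map u t \<alpha> x) = \<rho> x \<otimes>\<^bsub>Zp p\<^esub> u" if "x \<in> carrier M" for x
    unfolding split_map_def using that uc rT by (intro rho_combine) auto
  show tau: "\<tau> (split_map u t \<alpha> x) = \<rho> x \<odot> t \<oplus> \<alpha> (\<tau> x)" if "x \<in> carrier M" for x
    unfolding split_map_def using that uc rT by (intro tau_combine) auto
  have closed: "split_map u t \<alpha> x \<in> carrier M" if "x \<in> carrier M" for x
    unfolding split_map_def using that uc T_closed[OF rT[OF that]] by simp
  have ext: "x = y" if "x \<in> carrier M" "y \<in> carrier M" "\<rho> x = \<rho> y" "\<tau> x = \<tau> y" for x y
    using that decompose by metis
  have "split_map u t \<alpha> \<in> module_hom (Zp p) M M"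
  proof (rule module_homI[OF closed])
    show "split_map u t \<alpha> (x \<oplus> y) = split_map u t \<alpha> x \<oplus> split_map u t \<alpha> y" if "x \<in> carrier M" "y \<in> carrier M" for x y
    proof (rule ext)
      show "\<tau> (split_map u t \<alpha> (x \<oplus> y)) = \<tau> (split_map u t \<alpha> x \<oplus> split_map u t \<alpha> y)"
        using that closed tc T_closed[OF \<alpha>T[OF tau_in_T]]
        by (simp add: tau rho_add hom tau_add[of "split_map u t \<alpha> x"] smult_l_distr M.a_ac)
    qed (use that closed uc in \<open>simp_all add: rho rho_add R.l_distr\<close>)
    show "split_map u t \<alpha> (a \<odot> x) = a \<odot> split_map u t \<alpha> x" if "a \<in> carrier (Zp p)" "x \<in> carrier M" for a x
    proof (rule ext)
      show "\<tau> (split_map u t \<alpha> (a \<odot> x)) = \<tau> (a \<odot> split_map u t \<alpha> x)"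
        using that closed tc T_closed[OF \<alpha>T[OF tau_in_T]]
        by (simp add: tau rho_smult hom tau_smult[of a "split_map u t \<alpha> x"] smult_assoc1 smult_r_distr)
    qed (use that closed uc in \<open>simp_all add: rho rho_smult R.m_assoc\<close>)
  qed
  moreover have "inj_on (split_map u t \<alpha>) (carrier M)"
  proof (rule inj_onI)
    fix x y assume xy: "x \<in> carrier M" "y \<in> carrier M" "split_map u t \<alpha> x = split_map u t \<alpha> y"
    then have "\<rho> x \<otimes>\<^bsub>Zp p\<^esub> u = \<rho> y \<otimes>\<^bsub>Zp p\<^esub> u"
      using rho by metis
    then have "(\<rho> x \<otimes>\<^bsub>Zp p\<^esub> u) \<otimes>\<^bsub>Zp p\<^esub> inv\<^bsub>Zp p\<^esub> u = (\<rho> y \<otimes>\<^bsub>Zp p\<^esub> u) \<otimes>\<^bsub>Zp p\<^esub> inv\<^bsub>Zp p\<^esub> u"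
      by simp
    then have r: "\<rho> x = \<rho> y"
      using xy uc u by (simp add: R.m_assoc)
    moreover have "\<rho> x \<odot> t \<oplus> \<alpha> (\<tau> x) = \<rho> y \<odot> t \<oplus> \<alpha> (\<tau> y)"
      using xy tau by metis
    then have "\<alpha> (\<tau> x) = \<alpha> (\<tau> y)"
      using r xy tc T_closed[OF \<alpha>T[OF tau_in_T]] by simp
    then have "\<tau> x = \<tau> y"
      using \<alpha> xy by (auto simp: auto_T_iff bij_betw_def inj_on_def)
    ultimately show "x = y"
      using xy ext by blast
  qed
  moreover have "carrier M \<subseteq> split_map u t \<alpha> ` carrier M"
  proof
    fix y assume y: "y \<in> carrier M"
    \<comment> \<open>Back substitution in the triangular system: the free coordinate fixes
      \<open>r\<close>, after which \<open>\<alpha>\<close> has to hit \<open>\<tau> y\<close> minus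
      the contribution \<open>r \<odot> t\<close>.\<close>
    define r where "r = \<rho> y \<otimes>\<^bsub>Zp p\<^esub> inv\<^bsub>Zp p\<^esub> u"
    have r: "r \<in> carrier (Zp p)" "r \<otimes>\<^bsub>Zp p\<^esub> u = \<rho> y"
      using y u uc by (auto simp: r_def R.m_assoc)
    have "\<ominus> (r \<odot> t) \<oplus> \<tau> y \<in> T"
      using r t y by simp
    then obtain s where s: "s \<in> T" "\<alpha> s = \<ominus> (r \<odot> t) \<oplus> \<tau> y"
      using \<alpha> by (auto simp: auto_T_iff bij_betw_def) (metis imageE)
    let ?x = "r \<odot> e \<oplus> s"
    have x: "?x \<in> carrier M" "\<rho> ?x = r" "\<tau> ?x = s"
      using r s T_closed by auto
    have "split_map u t \<alpha> ?x = y"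
      using x y r s tc T_closed[OF tau_in_T[OF y]] by (simp add: ext closed rho tau M.r_neg2)
    with x show "y \<in> split_map u t \<alpha> ` carrier M"
      by blast
  qed
  ultimately show "split_map u t \<alpha> \<in> module_iso (Zp p) M M"
    using closed by (auto simp: module_iso_def bij_betw_def)
qed

text \<open>These are the automorphisms inducing the identity on \<open>M / T\<close>.
  Extensionality identifies maps that agree on \<open>M\<close>, so that \<open>card\<close> counts
  them correctly.\<close>

definition rho_autos where
  "rho_autos = {\<phi> \<in> extensional (carrier M). \<phi> \<in> module_iso (Zp p) M M \<and> (\<forall>x\<in>carrier M. \<rho> (\<phi> x) = \<rho> x)}"

lemma module_iso_preserves_T:
  assumes \<phi>: "\<phi> \<in> module_iso (Zp p) M M" and t: "t \<in> T"
  shows "\<phi> t \<in> T"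
proof -
  have hom: "\<phi> \<in> module_hom (Zp p) M M"
    using \<phi> by (simp add: module_iso_def)
  obtain a where "a \<in> carrier (Zp p)" "a \<noteq> \<zero>\<^bsub>Zp p\<^esub>" "a \<odot> t = \<zero>"
    using t unfolding torsion_part_eq[symmetric] torsion_part_def by blast
  moreover have "\<phi> \<zero> = \<zero>"
    using module_hom_zero[OF _ _ hom] module_axioms by blast
  ultimately have "\<phi> t \<in> torsion_part (Zp p) M"
    using module_homD[OF hom] T_closed[OF t] unfolding torsion_part_def by (metis (mono_tags, lifting) mem_Collect_eq)
  then show ?thesis
    by (simp add: torsion_part_eq)
qed

text \<open>They are the triangular maps with \<open>u = 1\<close>: \<open>t\<close> is recovered
  from the image of \<open>e\<close>, and \<open>\<alpha>\<close> is the restriction to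
  \<open>T\<close>, which is onto since \<open>T\<close> is finite.\<close>

lemma card_rho_autos: "card rho_autos = card T * card auto_T"
proof -
  let ?F = "\<lambda>(t, \<alpha>). restrict (split_map \<one>\<^bsub>Zp p\<^esub> t \<alpha>) (carrier M)"
  have "bij_betw ?F (T \<times> auto_T) rho_autos"
    unfolding bij_betw_def
  proof
    have tau_e: "\<tau> e = \<zero>"
      using tau_combine[of "\<one>\<^bsub>Zp p\<^esub>" \<zero>] by simp
    have tau_T: "\<tau> t = t" if "t \<in> T" for t
      using tau_combine[of "\<zero>\<^bsub>Zp p\<^esub>" t] that T_closed by simp
    show "inj_on ?F (T \<times> auto_T)"
    proof (rule inj_onI, clarify)
      fix s \<alpha> t \<beta> assume *: "s \<in> T" "\<alpha> \<in> auto_T" "t \<in> T" "\<beta> \<in> auto_T"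
        "restrict (split_map \<one>\<^bsub>Zp p\<^esub> s \<alpha>) (carrier M) = restrict (split_map \<one>\<^bsub>Zp p\<^esub> t \<beta>) (carrier M)"
      then have eq: "split_map \<one>\<^bsub>Zp p\<^esub> s \<alpha> x = split_map \<one>\<^bsub>Zp p\<^esub> t \<beta> x" if "x \<in> carrier M" for x
        using that by (metis restrict_apply')
      have eq': "\<rho> x \<odot> s \<oplus> \<alpha> (\<tau> x) = \<rho> x \<odot> t \<oplus> \<beta> (\<tau> x)" if "x \<in> carrier M" for x
        using tau_split_map[of "\<one>\<^bsub>Zp p\<^esub>" s \<alpha> x] tau_split_map[of "\<one>\<^bsub>Zp p\<^esub>" t \<beta> x] eq[OF that] * that by simp
      have zero: "\<alpha> \<zero> = \<zero>" "\<beta> \<zero> = \<zero>"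
        using module_hom_zero[OF _ _ auto_T_tau_hom[OF *(2)]] module_hom_zero[OF _ _ auto_T_tau_hom[OF *(4)]]
          module_axioms tau_T[of \<zero>] by simp_all
      have "s = t"
        using eq'[of e] * T_closed by (simp add: tau_e zero)
      moreover have "\<alpha> x = \<beta> x" if "x \<in> T" for x
        using eq'[of x] that * T_closed[OF that] T_closed[OF auto_T_closed[OF *(2) that]]
          T_closed[OF auto_T_closed[OF *(4) that]] T_closed[OF *(1)] T_closed[OF *(3)]
        by (simp add: tau_T)
      then have "\<alpha> = \<beta>"
        using * by (intro extensionalityI[of \<alpha> T]) (auto simp: auto_T_iff)
      ultimately show "s = t \<and> \<alpha> = \<beta>"
        by simp
    qed
    show "?F ` (T \<times> auto_T) = rho_autos"
    proof
      show "?F ` (T \<times> auto_T) \<subseteq> rho_autos"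
      proof clarify
        fix t \<alpha> assume *: "t \<in> T" "\<alpha> \<in> auto_T"
        have iso: "split_map \<one>\<^bsub>Zp p\<^esub> t \<alpha> \<in> module_iso (Zp p) M M"
          using split_map_iso[of "\<one>\<^bsub>Zp p\<^esub>"] * by simp
        have "restrict (split_map \<one>\<^bsub>Zp p\<^esub> t \<alpha>) (carrier M) \<in> module_iso (Zp p) M M"
          using iso by (auto simp: module_iso_def module_hom_def hom_def Pi_iff cong: bij_betw_cong)
        then show "restrict (split_map \<one>\<^bsub>Zp p\<^esub> t \<alpha>) (carrier M) \<in> rho_autos"
          using rho_split_map[of "\<one>\<^bsub>Zp p\<^esub>" t \<alpha>] * by (simp add: rho_autos_def)
      qed
      show "rho_autos \<subseteq> ?F ` (T \<times> auto_T)"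
      proof
        fix \<phi> assume "\<phi> \<in> rho_autos"
        then have \<phi>: "\<phi> \<in> extensional (carrier M)" "\<phi> \<in> module_iso (Zp p) M M" "\<And>x. x \<in> carrier M \<Longrightarrow> \<rho> (\<phi> x) = \<rho> x"
          by (auto simp: rho_autos_def)
        have bij: "bij_betw \<phi> (carrier M) (carrier M)"
          using \<phi>(2) by (simp add: module_iso_def)
        note hom = module_homD[of \<phi> "Zp p" M M]
        have \<phi>_hom: "\<phi> \<in> module_hom (Zp p) M M"
          using \<phi>(2) by (simp add: module_iso_def)
        define t where "t = \<tau> (\<phi> e)"
        define \<alpha> where "\<alpha> = restrict \<phi> T"
        have t: "t \<in> T"
          using hom(1)[OF \<phi>_hom] by (simp add: t_def)
        have "bij_betw \<phi> T T"
          unfolding bij_betw_def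
        proof
          show "inj_on \<phi> T"
            using bij T_closed by (auto simp: bij_betw_def intro: inj_on_subset)
          show "\<phi> ` T = T"
            using \<open>inj_on \<phi> T\<close> finite_T module_iso_preserves_T[OF \<phi>(2)] by (intro endo_inj_surj) auto
        qed
        then have \<alpha>: "\<alpha> \<in> auto_T"
          using hom(2)[OF \<phi>_hom] T_closed by (auto simp: \<alpha>_def auto_T_iff cong: bij_betw_cong)
        have "\<phi> x = split_map \<one>\<^bsub>Zp p\<^esub> t \<alpha> x" if x: "x \<in> carrier M" for x
        proof -
          have "\<phi> x = \<phi> (\<rho> x \<odot> e \<oplus> \<tau> x)"
            using decompose[OF x] by simp
          also have "\<dots> = \<rho> x \<odot> \<phi> e \<oplus> \<phi> (\<tau> x)"
            using x T_closed[OF tau_in_T[OF x]] by (simp add: hom[OF \<phi>_hom])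
          also have "\<phi> e = e \<oplus> t"
            using decompose[of "\<phi> e"] \<phi>(3)[of e] hom(1)[OF \<phi>_hom, of e] by (simp add: t_def)
          also have "\<rho> x \<odot> (e \<oplus> t) \<oplus> \<phi> (\<tau> x) = split_map \<one>\<^bsub>Zp p\<^esub> t \<alpha> x"
            using x t T_closed[OF t] T_closed[OF tau_in_T[OF x]] hom(1)[OF \<phi>_hom]
            by (simp add: split_map_def \<alpha>_def smult_r_distr M.a_assoc)
          finally show ?thesis .
        qed
        then have "\<phi> = restrict (split_map \<one>\<^bsub>Zp p\<^esub> t \<alpha>) (carrier M)"
          using \<phi>(1) by (intro extensionalityI[of \<phi> "carrier M"]) auto
        with t \<alpha> show "\<phi> \<in> ?F ` (T \<times> auto_T)"
          by force
      qed
    qed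
  qed
  then show ?thesis
    using bij_betw_same_card card_cartesian_product by metis
qed

end

lemma (in group) card_auto_pos:
  assumes "finite (carrier G)"
  shows "card (auto G) > 0"
proof -
  have "auto G \<subseteq> (\<Pi>\<^sub>E t\<in>carrier G. carrier G)"
    by (intro subsetI PiE_I) (auto simp: auto_def hom_def Bij_def extensional_def)
  moreover have "finite (\<Pi>\<^sub>E t\<in>carrier G. carrier G)"
    using assms by (intro finite_PiE) auto
  ultimately show ?thesis
    using id_in_auto finite_subset by (metis card_gt_0_iff empty_iff)
qed

section \<open>Counting quotients with cyclic kernel\<close>

locale quotient_count = split_module p M e \<rho> + G: comm_group G
  for p :: nat and M (structure) and e and \<rho> :: "_ \<Rightarrow> padic" and G (structure) +
  fixes n :: nat
  assumes card_G: "card (carrier G) = p ^ n"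
begin

text \<open>The set that both transition probabilities count. Maps are extensional for the sake of
  cardinalities; a generator of the kernel is only asserted to exist, as it is determined only up to
  units.\<close>

definition Q where "Q = {q \<in> extensional (carrier M). q \<in> hom (add_monoid M) G \<and> q ` carrier M = carrier G \<and>
    (\<exists>w\<in>carrier M. {x \<in> carrier M. q x = \<one>\<^bsub>G\<^esub>} = cyclic_submodule w)}"

definition ker where "ker q = {x \<in> carrier M. q x = \<one>\<^bsub>G\<^esub>}"

text \<open>
  The generators of \<open>ker q\<close> differ by units, and exactly one of them has a power of \<open>p\<close> as its
  \<open>\<rho>\<close>-coordinate.
\<close>

definition normalized_generator where
  "normalized_generator q w \<longleftrightarrow> w \<in> carrier M \<and> ker q = cyclic_submodule w \<and> (\<exists>k. \<rho> w = zp_power p k)"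

definition gen where "gen q = (SOME w. normalized_generator q w)"

lemma finite_G: "finite (carrier G)"
  using card_G prime_gt_0_nat[OF prime_p] by (intro card_ge_0_finite) simp

lemma cyclic_quotientI:
  assumes "q \<in> Q" "w \<in> carrier M" "ker q = cyclic_submodule w"
  shows "cyclic_quotient p M e \<rho> G n q w"
  using assms card_G by unfold_locales (auto simp: Q_def ker_def)

lemma QI:
  assumes "q \<in> extensional (carrier M)" "q \<in> hom (add_monoid M) G" "q ` carrier M = carrier G"
    "w \<in> carrier M" "ker q = cyclic_submodule w"
  shows "q \<in> Q"
  using assms by (auto simp: Q_def ker_def)

text \<open>Divide the given generator by the unit part of its
  \<open>\<rho>\<close>-coordinate.\<close>

lemma normalized_generator_exists:
  assumes q: "q \<in> hom (add_monoid M) G" "q ` carrier M = carrier G" and w: "w \<in> carrier M" "ker q = cyclic_submodule w"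
  obtains v where "v \<in> Units (Zp p)" "normalized_generator q (v \<odot> w)"
proof -
  interpret cyclic_quotient p M e \<rho> G n q w
    using assms card_G by unfold_locales (auto simp: ker_def)
  obtain k u where u: "u \<in> Units (Zp p)" "\<rho> w = zp_power p k \<otimes>\<^bsub>Zp p\<^esub> u"
    using Zp_factorE[OF prime_p rho_closed[OF w(1)] rho_w_nonzero] by blast
  let ?v = "inv\<^bsub>Zp p\<^esub> u"
  have uc: "u \<in> carrier (Zp p)"
    using u by (simp add: R.Units_closed)
  have "\<rho> (?v \<odot> w) = zp_power p k"
    using u uc w R.m_lcomm[of ?v "zp_power p k" u] by (simp add: rho_smult)
  moreover have "cyclic_submodule (?v \<odot> w) = cyclic_submodule w"
  proof -
    have "w = u \<odot> (?v \<odot> w)"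
      using u uc w by (simp flip: smult_assoc1)
    then have "w \<in> cyclic_submodule (?v \<odot> w)" "?v \<odot> w \<in> cyclic_submodule w"
      using u uc w unfolding cyclic_submodule_def by auto
    then show ?thesis
      using u w by (simp add: cyclic_submodule_is_submodule cyclic_submodule_subset_iff subset_antisym)
  qed
  ultimately have "normalized_generator q (?v \<odot> w)"
    using u w by (auto simp: normalized_generator_def)
  with u show ?thesis
    using that[of ?v] by simp
qed

text \<open>Two generators differ by a unit; if it carries one power of \<open>p\<close> to another,
  it is 1 by uniqueness of the valuation.\<close>

lemma normalized_generator_unique:
  assumes q: "q \<in> Q" and w: "normalized_generator q w" and w': "normalized_generator q w'"
  shows "w = w'"
proof -
  interpret cyclic_quotient p M e \<rho> G n q w
    using w by (intro cyclic_quotientI[OF q]) (auto simp: normalized_generator_def)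
  obtain k l where k: "\<rho> w = zp_power p k" and l: "\<rho> w' = zp_power p l"
    using w w' by (auto simp: normalized_generator_def)
  have wc: "w' \<in> carrier M" and eq: "cyclic_submodule w' = cyclic_submodule w"
    using w w' by (auto simp: normalized_generator_def)
  obtain a where a: "a \<in> carrier (Zp p)" "w' = a \<odot> w"
    using mem_cyclic_submodule[OF wc] eq by (auto simp: cyclic_submodule_def)
  obtain b where b: "b \<in> carrier (Zp p)" "w = b \<odot> w'"
    using mem_cyclic_submodule[OF w_closed] eq by (auto simp: cyclic_submodule_def)
  have "b \<odot> (a \<odot> w) = w"
    using a(2) b(2) by metis
  then have "\<one>\<^bsub>Zp p\<^esub> \<odot> w = (b \<otimes>\<^bsub>Zp p\<^esub> a) \<odot> w"
    using a(1) b(1) by (simp add: smult_assoc1)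
  then have "a \<otimes>\<^bsub>Zp p\<^esub> b = \<one>\<^bsub>Zp p\<^esub>"
    using a(1) b(1) smult_w_cancel[of "\<one>\<^bsub>Zp p\<^esub>" "b \<otimes>\<^bsub>Zp p\<^esub> a"] by (simp add: R.m_comm)
  moreover have "zp_power p k \<otimes>\<^bsub>Zp p\<^esub> a = zp_power p l"
    using a k l by (simp add: rho_smult R.m_comm)
  ultimately have "a = \<one>\<^bsub>Zp p\<^esub>"
    using Zp_power_eq_Units_mult(1)[OF prime_p a(1) b(1)] by blast
  with a show ?thesis
    by simp
qed

lemma gen:
  assumes "q \<in> Q"
  shows "normalized_generator q (gen q)"
proof -
  obtain w where w: "w \<in> carrier M" "ker q = cyclic_submodule w"
    using assms by (auto simp: Q_def ker_def)
  have q: "q \<in> hom (add_monoid M) G" "q ` carrier M = carrier G"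
    using assms by (auto simp: Q_def)
  obtain v where "normalized_generator q v"
    using normalized_generator_exists[OF q w] by blast
  then show ?thesis
    unfolding gen_def by (rule someI)
qed

lemma gen_eqI:
  assumes "q \<in> Q" "normalized_generator q w"
  shows "gen q = w"
  using assms gen normalized_generator_unique by blast

lemma gen_closed: "q \<in> Q \<Longrightarrow> gen q \<in> carrier M"
  using gen by (simp add: normalized_generator_def)

lemma ker_eq_gen: "q \<in> Q \<Longrightarrow> ker q = cyclic_submodule (gen q)"
  using gen by (simp add: normalized_generator_def)

lemma cyclic_quotient_gen: "q \<in> Q \<Longrightarrow> cyclic_quotient p M e \<rho> G n q (gen q)"
  by (rule cyclic_quotientI) (auto simp: gen_closed ker_eq_gen)

text \<open>Two quotient maps are equivalent if they define equivalent extensions of \<open>G\<close>.\<close>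

definition equivalent where "equivalent q q' \<longleftrightarrow>
  (\<exists>\<phi>\<in>module_iso (Zp p) M M. \<phi> (gen q) = gen q' \<and> (\<forall>x\<in>carrier M. q' (\<phi> x) = q x))"

text \<open>An automorphism preserves \<open>T\<close> and therefore multiplies
  \<open>\<rho>\<close> by the constant \<open>\<rho> (\<phi> e)\<close>, a unit. Taking a
  normalized generator to a normalized generator, this unit carries a power of \<open>p\<close> to a
  power of \<open>p\<close>, so it is 1.\<close>

lemma equivalent_imp_rho_eq:
  assumes q: "q \<in> Q" "q' \<in> Q" and \<phi>: "\<phi> \<in> module_iso (Zp p) M M" "\<phi> (gen q) = gen q'" and x: "x \<in> carrier M"
  shows "\<rho> (\<phi> x) = \<rho> x"
proof -
  have scale: "\<rho> (\<psi> x) = \<rho> x \<otimes>\<^bsub>Zp p\<^esub> \<rho> (\<psi> e)" if \<psi>: "\<psi> \<in> module_iso (Zp p) M M" and x: "x \<in> carrier M" for \<psi> x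
  proof -
    have hom: "\<psi> \<in> module_hom (Zp p) M M"
      using \<psi> by (simp add: module_iso_def)
    have tc: "\<tau> x \<in> carrier M" "\<psi> (\<tau> x) \<in> T"
      using x T_closed[OF tau_in_T[OF x]] module_iso_preserves_T[OF \<psi>] by auto
    have "\<psi> x = \<psi> (\<rho> x \<odot> e \<oplus> \<tau> x)"
      using decompose[OF x] by simp
    also have "\<dots> = \<rho> x \<odot> \<psi> e \<oplus> \<psi> (\<tau> x)"
      using x tc by (simp add: module_homD[OF hom])
    finally show ?thesis
      using x tc T_closed[OF tc(2)] module_homD(1)[OF hom] by (simp add: rho_add rho_smult)
  qed
  have hom: "\<phi> \<in> module_hom (Zp p) M M" and bij: "bij_betw \<phi> (carrier M) (carrier M)"
    using \<phi>(1) by (auto simp: module_iso_def)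
  define \<psi> where "\<psi> = inv_into (carrier M) \<phi>"
  have \<psi>: "\<psi> \<in> module_iso (Zp p) M M"
    unfolding \<psi>_def using \<phi>(1) module_axioms by (rule module_iso_inv_into[rotated])
  have \<psi>_closed: "\<psi> e \<in> carrier M" and \<phi>_closed: "\<phi> e \<in> carrier M"
    using module_homD(1)[of \<psi> "Zp p" M M] module_homD(1)[OF hom] \<psi> by (auto simp: module_iso_def)
  have "\<psi> (\<phi> e) = e"
    using bij by (simp add: \<psi>_def bij_betw_def)
  then have inv: "\<rho> (\<phi> e) \<otimes>\<^bsub>Zp p\<^esub> \<rho> (\<psi> e) = \<one>\<^bsub>Zp p\<^esub>"
    using scale[OF \<psi> \<phi>_closed] by simp
  obtain k l where "\<rho> (gen q) = zp_power p k" "\<rho> (gen q') = zp_power p l"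
    using gen[OF q(1)] gen[OF q(2)] unfolding normalized_generator_def by blast
  then have "zp_power p k \<otimes>\<^bsub>Zp p\<^esub> \<rho> (\<phi> e) = zp_power p l"
    using scale[OF \<phi>(1) gen_closed[OF q(1)]] \<phi>(2) by simp
  then have "\<rho> (\<phi> e) = \<one>\<^bsub>Zp p\<^esub>"
    using Zp_power_eq_Units_mult(1)[OF prime_p _ _ inv] \<phi>_closed \<psi>_closed by simp
  then show ?thesis
    using scale[OF \<phi>(1) x] x by simp
qed

text \<open>The equivalence class of \<open>q0\<close> is its orbit under \<open>rho_autos\<close>,
  acting by composition, and the action is free. So the class is as large as
  \<open>rho_autos\<close>.\<close>

lemma card_equivalent:
  assumes q0: "q0 \<in> Q"
  shows "card {q \<in> Q. equivalent q q0} = card T * card auto_T"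
proof -
  interpret q0: cyclic_quotient p M e \<rho> G n q0 "gen q0"
    using cyclic_quotient_gen[OF q0] .
  let ?F = "\<lambda>\<phi>. restrict (q0 \<circ> \<phi>) (carrier M)"
  \<comment> \<open>Preserving \<open>\<rho>\<close> keeps a generator normalized, so the preimage
    of \<open>gen q0\<close> is the canonical generator of the new kernel.\<close>
  have props: "?F \<phi> \<in> Q \<and> \<phi> (gen (?F \<phi>)) = gen q0" if "\<phi> \<in> rho_autos" for \<phi>
  proof -
    have \<phi>: "\<phi> \<in> module_iso (Zp p) M M" "\<And>x. x \<in> carrier M \<Longrightarrow> \<rho> (\<phi> x) = \<rho> x"
      using that by (auto simp: rho_autos_def)
    have hom: "\<phi> \<in> module_hom (Zp p) M M" and bij: "bij_betw \<phi> (carrier M) (carrier M)"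
      using \<phi>(1) by (auto simp: module_iso_def)
    note hom = module_homD[OF hom]
    have surj: "\<phi> ` carrier M = carrier M" and inj: "inj_on \<phi> (carrier M)"
      using bij by (auto simp: bij_betw_def)
    obtain w where w: "w \<in> carrier M" "\<phi> w = gen q0"
      using surj gen_closed[OF q0] by (metis imageE)
    have img: "?F \<phi> ` carrier M = carrier G"
    proof -
      have "?F \<phi> ` carrier M = q0 ` \<phi> ` carrier M"
        by (simp add: image_image)
      then show ?thesis
        using surj q0.q_surj by simp
    qed
    have ker: "ker (?F \<phi>) = cyclic_submodule w"
    proof -
      have "q0 (\<phi> x) = \<one>\<^bsub>G\<^esub> \<longleftrightarrow> x \<in> cyclic_submodule w" if x: "x \<in> carrier M" for x
      proof -
        have "q0 (\<phi> x) = \<one>\<^bsub>G\<^esub> \<longleftrightarrow> (\<exists>a\<in>carrier (Zp p). \<phi> x = \<phi> (a \<odot> w))"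
          using x w hom by (auto simp: q0.q_eq_1_iff cyclic_submodule_def)
        also have "\<dots> \<longleftrightarrow> (\<exists>a\<in>carrier (Zp p). x = a \<odot> w)"
          using x w inj_on_eq_iff[OF inj] by simp
        finally show ?thesis
          by (auto simp: cyclic_submodule_def)
      qed
      moreover have "cyclic_submodule w \<subseteq> carrier M"
        using w by (auto simp: cyclic_submodule_def)
      ultimately show ?thesis
        by (auto simp: ker_def)
    qed
    have "?F \<phi> \<in> hom (add_monoid M) G"
      using hom by (auto simp: hom_def)
    then have in_Q: "?F \<phi> \<in> Q"
      using img ker w by (intro QI[where w = w]) auto
    moreover have "normalized_generator (?F \<phi>) w"
      using w ker \<phi>(2)[OF w(1)] gen[OF q0] by (auto simp: normalized_generator_def)
    ultimately show ?thesis
      using gen_eqI w by metis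
  qed
  have "bij_betw ?F rho_autos {q \<in> Q. equivalent q q0}"
    unfolding bij_betw_def
  proof
    show "inj_on ?F rho_autos"
    proof (rule inj_onI)
      fix \<phi> \<psi> assume *: "\<phi> \<in> rho_autos" "\<psi> \<in> rho_autos" "?F \<phi> = ?F \<psi>"
      have homs: "\<phi> \<in> module_hom (Zp p) M M" "\<psi> \<in> module_hom (Zp p) M M"
        using * by (auto simp: rho_autos_def module_iso_def)
      note hom = module_homD[OF homs(1)] module_homD[OF homs(2)]
      define w where "w = gen (?F \<phi>)"
      have w: "w \<in> carrier M" "\<phi> w = gen q0" "\<psi> w = gen q0"
        using props[OF *(1)] props[OF *(2)] *(3) gen_closed by (auto simp: w_def)
      \<comment> \<open>Freeness: \<open>\<phi> x\<close> and \<open>\<psi> x\<close> differ by a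
        multiple of \<open>gen q0\<close>. This difference is killed by \<open>p ^ n\<close>,
        because \<open>p ^ n x\<close> is a multiple of \<open>w\<close>, where both maps agree; but
        nonzero multiples of \<open>gen q0\<close> are not torsion.\<close>
      have "\<phi> x = \<psi> x" if x: "x \<in> carrier M" for x
      proof -
        have "q0 (\<phi> x) = q0 (\<psi> x)"
          using fun_cong[OF *(3), of x] x by simp
        then obtain a where a: "a \<in> carrier (Zp p)" "\<phi> x \<ominus> \<psi> x = a \<odot> gen q0"
          using x hom by (auto simp: q0.q_eq_iff cyclic_submodule_def)
        interpret F: cyclic_quotient p M e \<rho> G n "?F \<phi>" w
          unfolding w_def using props[OF *(1)] by (intro cyclic_quotient_gen) simp
        obtain b where b: "b \<in> carrier (Zp p)" "zp_power p n \<odot> x = b \<odot> w"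
          using F.power_smult_in_kernel[OF x] by (auto simp: cyclic_submodule_def)
        have "zp_power p n \<odot> \<phi> x = zp_power p n \<odot> \<psi> x"
          using hom(3)[of "zp_power p n" x] hom(6)[of "zp_power p n" x] hom(3)[of b w] hom(6)[of b w] b x w by simp
        then have "zp_power p n \<odot> (\<phi> x \<ominus> \<psi> x) = \<zero>"
          using x hom by (simp add: M.minus_eq smult_r_distr smult_r_minus M.r_neg)
        then have "(zp_power p n \<otimes>\<^bsub>Zp p\<^esub> a) \<odot> gen q0 = \<zero>\<^bsub>Zp p\<^esub> \<odot> gen q0"
          using a by (simp add: smult_assoc1)
        then have "zp_power p n \<otimes>\<^bsub>Zp p\<^esub> a = \<zero>\<^bsub>Zp p\<^esub>"
          using a by (intro q0.smult_w_cancel) auto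
        then have "a = \<zero>\<^bsub>Zp p\<^esub>"
          using Zp_power_mult_eq_0[OF prime_p a(1)] by blast
        then have "\<phi> x \<ominus> \<psi> x = \<zero>"
          using a by simp
        moreover have "\<phi> x = (\<phi> x \<ominus> \<psi> x) \<oplus> \<psi> x"
          using x hom by (simp add: M.minus_eq M.a_assoc M.l_neg)
        ultimately show ?thesis
          using x hom by simp
      qed
      then show "\<phi> = \<psi>"
        using * by (intro extensionalityI[of \<phi> "carrier M"]) (auto simp: rho_autos_def)
    qed
    show "?F ` rho_autos = {q \<in> Q. equivalent q q0}"
    proof
      show "?F ` rho_autos \<subseteq> {q \<in> Q. equivalent q q0}"
        using props by (auto simp: equivalent_def rho_autos_def)
      show "{q \<in> Q. equivalent q q0} \<subseteq> ?F ` rho_autos"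
      proof clarify
        fix q assume q: "q \<in> Q" "equivalent q q0"
        then obtain \<phi> where \<phi>: "\<phi> \<in> module_iso (Zp p) M M" "\<phi> (gen q) = gen q0" "\<And>x. x \<in> carrier M \<Longrightarrow> q0 (\<phi> x) = q x"
          by (auto simp: equivalent_def)
        let ?\<phi> = "restrict \<phi> (carrier M)"
        have "?\<phi> \<in> module_iso (Zp p) M M"
          using \<phi>(1) by (auto simp: module_iso_def module_hom_def hom_def Pi_iff cong: bij_betw_cong)
        then have "?\<phi> \<in> rho_autos"
          using equivalent_imp_rho_eq[OF q(1) q0 \<phi>(1,2)] by (simp add: rho_autos_def)
        moreover have "q = ?F ?\<phi>"
          using q(1) \<phi>(3) by (intro extensionalityI[of q "carrier M"]) (auto simp: Q_def)
        ultimately show "q \<in> ?F ` rho_autos"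
          by blast
      qed
    qed
  qed
  then have "card rho_autos = card {q \<in> Q. equivalent q q0}"
    by (rule bij_betw_same_card)
  then show ?thesis
    by (simp add: card_rho_autos)
qed

text \<open>Surjections with a common kernel differ by an automorphism of \<open>G\<close>, which is
  unique because \<open>q0\<close> is onto.\<close>

lemma card_same_kernel:
  assumes q0: "q0 \<in> Q"
  shows "card {q \<in> Q. ker q = ker q0} = card (auto G)"
proof -
  interpret q0: cyclic_quotient p M e \<rho> G n q0 "gen q0"
    using cyclic_quotient_gen[OF q0] .
  let ?F = "\<lambda>\<beta>. restrict (\<beta> \<circ> q0) (carrier M)"
  have auto: "\<beta> \<in> auto G \<longleftrightarrow> \<beta> \<in> extensional (carrier G) \<and> \<beta> \<in> hom G G \<and> bij_betw \<beta> (carrier G) (carrier G)" for \<beta>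
    by (auto simp: auto_def Bij_def)
  have "bij_betw ?F (auto G) {q \<in> Q. ker q = ker q0}"
    unfolding bij_betw_def
  proof
    show "inj_on ?F (auto G)"
    proof (rule inj_onI)
      fix \<beta> \<gamma> assume *: "\<beta> \<in> auto G" "\<gamma> \<in> auto G" "?F \<beta> = ?F \<gamma>"
      have "\<beta> g = \<gamma> g" if g: "g \<in> carrier G" for g
      proof -
        have "g \<in> q0 ` carrier M"
          using g q0.q_surj by simp
        then obtain x where "x \<in> carrier M" "q0 x = g"
          by auto
        then show ?thesis
          using fun_cong[OF *(3), of x] by simp
      qed
      then show "\<beta> = \<gamma>"
        using * by (intro extensionalityI[of \<beta> "carrier G"]) (auto simp: auto)
    qed
    show "?F ` auto G = {q \<in> Q. ker q = ker q0}"
    proof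
      show "?F ` auto G \<subseteq> {q \<in> Q. ker q = ker q0}"
      proof clarify
        fix \<beta> assume "\<beta> \<in> auto G"
        then have \<beta>: "\<beta> \<in> hom G G" "bij_betw \<beta> (carrier G) (carrier G)"
          by (auto simp: auto)
        have one: "\<beta> \<one>\<^bsub>G\<^esub> = \<one>\<^bsub>G\<^esub>"
          using \<beta>(1) hom_one G.is_group by blast
        have "\<beta> (q0 x) = \<one>\<^bsub>G\<^esub> \<longleftrightarrow> q0 x = \<one>\<^bsub>G\<^esub>" if "x \<in> carrier M" for x
          using inj_on_eq_iff[OF bij_betw_imp_inj_on[OF \<beta>(2)], of "q0 x" "\<one>\<^bsub>G\<^esub>"] one that by simp
        then have ker: "ker (?F \<beta>) = ker q0"
          by (auto simp: ker_def)
        have "?F \<beta> ` carrier M = carrier G"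
        proof -
          have "?F \<beta> ` carrier M = \<beta> ` q0 ` carrier M"
            by (simp add: image_image)
          then show ?thesis
            using \<beta>(2) q0.q_surj by (simp add: bij_betw_def)
        qed
        moreover have "?F \<beta> \<in> hom (add_monoid M) G"
          using \<beta>(1) by (auto simp: hom_def)
        ultimately have "?F \<beta> \<in> Q"
          using ker ker_eq_gen[OF q0] gen_closed[OF q0] by (intro QI[where w = "gen q0"]) auto
        with ker show "?F \<beta> \<in> Q \<and> ker (?F \<beta>) = ker q0"
          by simp
      qed
      show "{q \<in> Q. ker q = ker q0} \<subseteq> ?F ` auto G"
      proof clarify
        fix q assume q: "q \<in> Q" "ker q = ker q0"
        interpret q: cyclic_quotient p M e \<rho> G n q "gen q"
          using cyclic_quotient_gen[OF q(1)] .
        have eq: "q x = q y \<longleftrightarrow> q0 x = q0 y" if "x \<in> carrier M" "y \<in> carrier M" for x y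
          using that q ker_eq_gen[OF q0] ker_eq_gen[OF q(1)] by (simp add: q.q_eq_iff q0.q_eq_iff)
        \<comment> \<open>The automorphism is \<open>q\<close> after a set-theoretic section of
          \<open>q0\<close>; equality of the kernels makes it independent of the section.\<close>
        define s where "s = inv_into (carrier M) q0"
        have s: "s g \<in> carrier M" "q0 (s g) = g" if "g \<in> carrier G" for g
          using that q0.q_surj by (auto simp: s_def inv_into_into f_inv_into_f)
        define \<beta> where "\<beta> = restrict (q \<circ> s) (carrier G)"
        have \<beta>q: "\<beta> (q0 x) = q x" if "x \<in> carrier M" for x
          using that s by (simp add: \<beta>_def eq)
        have "\<beta> \<in> hom G G"
        proof (rule homI)
          fix g h assume gh: "g \<in> carrier G" "h \<in> carrier G"
          have "\<beta> (g \<otimes>\<^bsub>G\<^esub> h) = q (s g) \<otimes>\<^bsub>G\<^esub> q (s h)"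
            using \<beta>q[of "s g \<oplus> s h"] gh s by simp
          then show "\<beta> (g \<otimes>\<^bsub>G\<^esub> h) = \<beta> g \<otimes>\<^bsub>G\<^esub> \<beta> h"
            using gh by (simp add: \<beta>_def)
        qed (use s in \<open>simp add: \<beta>_def\<close>)
        moreover have "bij_betw \<beta> (carrier G) (carrier G)"
        proof -
          have "\<beta> ` carrier G = carrier G"
          proof -
            have "\<beta> ` q0 ` carrier M = q ` carrier M"
              using \<beta>q by (simp add: image_image cong: image_cong)
            then show ?thesis
              using q.q_surj q0.q_surj by simp
          qed
          then show ?thesis
            using finite_G by (simp add: bij_betw_def eq_card_imp_inj_on)
        qed
        moreover have "\<beta> \<in> extensional (carrier G)"
          by (simp add: \<beta>_def)
        ultimately have "\<beta> \<in> auto G"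
          by (simp add: auto)
        moreover have "q = ?F \<beta>"
          using q(1) \<beta>q by (intro extensionalityI[of q "carrier M"]) (auto simp: Q_def)
        ultimately show "q \<in> ?F ` auto G"
          by blast
      qed
    qed
  qed
  then have "card (auto G) = card {q \<in> Q. ker q = ker q0}"
    by (rule bij_betw_same_card)
  then show ?thesis ..
qed

text \<open>An isomorphism onto \<open>G\<close> composed with the coset map is an element of
  \<open>Q\<close>; conversely, the first isomorphism theorem applies. The event behind
  \<open>d_op\<close> thus says that \<open>x\<close> generates one of the kernels.\<close>

lemma quotient_iso_iff:
  assumes x: "x \<in> carrier M"
  shows "M A_Mod module_span (Zp p) M {x} \<cong> G \<longleftrightarrow> cyclic_submodule x \<in> ker ` Q"
proof -
  interpret N: submodule "cyclic_submodule x" "Zp p" M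
    using x by (rule cyclic_submodule_is_submodule)
  have norm: "cyclic_submodule x \<lhd> add_monoid M"
    using N.subgroup_axioms M.a_comm_group by (simp add: comm_group.subgroup_imp_normal)
  interpret N: normal "cyclic_submodule x" "add_monoid M"
    using norm .
  show ?thesis
    unfolding module_span_singleton[OF x] A_FactGroup_def
  proof
    assume "add_monoid M Mod cyclic_submodule x \<cong> G"
    then obtain \<theta> where \<theta>: "\<theta> \<in> iso (add_monoid M Mod cyclic_submodule x) G"
      by (auto simp: is_iso_def)
    let ?c = "\<lambda>y. cyclic_submodule x #>\<^bsub>add_monoid M\<^esub> y"
    define q where "q = restrict (\<theta> \<circ> ?c) (carrier M)"
    have carr: "carrier (add_monoid M Mod cyclic_submodule x) = ?c ` carrier M"
      by (auto simp: FactGroup_def RCOSETS_def)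
    have \<theta>_hom: "\<theta> \<in> hom (add_monoid M Mod cyclic_submodule x) G"
      and \<theta>_bij: "bij_betw \<theta> (?c ` carrier M) (carrier G)"
      using \<theta> carr by (auto simp: iso_def)
    have "\<theta> \<circ> ?c \<in> hom (add_monoid M) G"
      using N.r_coset_hom_Mod \<theta>_hom by (rule hom_compose)
    then have "q \<in> hom (add_monoid M) G"
      by (auto simp: q_def hom_def)
    moreover have "q ` carrier M = carrier G"
    proof -
      have "q ` carrier M = \<theta> ` ?c ` carrier M"
        unfolding q_def by (simp only: image_comp) (rule image_cong, simp_all)
      then show ?thesis
        using \<theta>_bij by (simp add: bij_betw_def)
    qed
    moreover have ker: "ker q = cyclic_submodule x"
    proof -
      have "\<theta> (?c y) = \<one>\<^bsub>G\<^esub> \<longleftrightarrow> y \<in> cyclic_submodule x" if y: "y \<in> carrier M" for y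
      proof -
        have "\<theta> \<one>\<^bsub>add_monoid M Mod cyclic_submodule x\<^esub> = \<one>\<^bsub>G\<^esub>"
          using \<theta>_hom N.factorgroup_is_group G.is_group by (rule hom_one)
        then have one: "\<theta> (cyclic_submodule x) = \<one>\<^bsub>G\<^esub>"
          by (simp add: FactGroup_def)
        have c0: "cyclic_submodule x = ?c \<zero>"
          using group.coset_join2[OF M.a_group, of \<zero>] N.subgroup_axioms N.one_closed by simp
        then have "cyclic_submodule x \<in> ?c ` carrier M"
          by blast
        then have "\<theta> (?c y) = \<one>\<^bsub>G\<^esub> \<longleftrightarrow> ?c y = cyclic_submodule x"
          using one inj_on_eq_iff[OF bij_betw_imp_inj_on[OF \<theta>_bij], of "?c y" "cyclic_submodule x"] y by simp
        also have "\<dots> \<longleftrightarrow> y \<in> cyclic_submodule x"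
          using group.coset_join1[OF M.a_group, of "cyclic_submodule x" y] group.coset_join2[OF M.a_group, of y] y N.subgroup_axioms by auto
        finally show ?thesis .
      qed
      then show ?thesis
        using N.subset by (auto simp: ker_def q_def)
    qed
    ultimately have "q \<in> Q"
      using x by (intro QI[where w = x]) (auto simp: q_def)
    with ker show "cyclic_submodule x \<in> ker ` Q"
      by blast
  next
    assume "cyclic_submodule x \<in> ker ` Q"
    then obtain q where q: "q \<in> Q" "cyclic_submodule x = ker q"
      by blast
    interpret h: group_hom "add_monoid M" G q
      using q M.a_group by (auto simp: Q_def group_hom_def group_hom_axioms_def)
    have "kernel (add_monoid M) G q = cyclic_submodule x"
      using q by (simp add: kernel_def ker_def)
    then show "add_monoid M Mod cyclic_submodule x \<cong> G"
      using h.FactGroup_iso q by (auto simp: Q_def)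
  qed
qed

text \<open>Splitting the event by the kernel that \<open>x\<close> generates gives finitely many
  disjoint pieces of equal Haar measure.\<close>

lemma measure_quotient_iso:
  assumes fin: "finite Q" and \<mu>: "is_haar_prob p M \<mu>"
  shows "measure \<mu> {x \<in> carrier M. M A_Mod module_span (Zp p) M {x} \<cong> G}
    = real (card (ker ` Q)) * ((1 - 1 / real p) / real p ^ n)"
proof -
  interpret prob_space \<mu>
    using \<mu> by (simp add: is_haar_prob_def)
  let ?A = "\<lambda>N. {x \<in> carrier M. cyclic_submodule x = N}"
  have "{x \<in> carrier M. M A_Mod module_span (Zp p) M {x} \<cong> G} = (\<Union>N\<in>ker ` Q. ?A N)"
    by (auto simp: quotient_iso_iff) blast
  moreover have "?A N \<in> sets \<mu> \<and> measure \<mu> (?A N) = (1 - 1 / real p) / real p ^ n" if N: "N \<in> ker ` Q" for N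
  proof -
    obtain q where q: "q \<in> Q" "N = ker q"
      using N by blast
    interpret cyclic_quotient p M e \<rho> G n q "gen q"
      using cyclic_quotient_gen[OF q(1)] .
    show ?thesis
      using measure_generators[OF \<mu>] q ker_eq_gen by simp
  qed
  moreover have "disjoint_family_on ?A (ker ` Q)"
    by (auto simp: disjoint_family_on_def)
  ultimately have "measure \<mu> {x \<in> carrier M. M A_Mod module_span (Zp p) M {x} \<cong> G} = (\<Sum>N\<in>ker ` Q. measure \<mu> (?A N))"
    using fin by (simp only:) (intro finite_measure_finite_Union, auto)
  also have "\<dots> = (\<Sum>N\<in>ker ` Q. (1 - 1 / real p) / real p ^ n)"
    using \<open>\<And>N. N \<in> ker ` Q \<Longrightarrow> ?A N \<in> sets \<mu> \<and> measure \<mu> (?A N) = (1 - 1 / real p) / real p ^ n\<close>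
    by (intro sum.cong) auto
  finally show ?thesis
    by simp
qed

end

section \<open>Characters of finite abelian p-groups\<close>

text \<open>Homomorphisms from \<open>G\<close> to the integers modulo \<open>m\<close>, with values
  represented in \<open>{0..<m}\<close>. For \<open>m = p ^ n\<close> these are the residues that
  elements of \<open>Zp\<close> have at level \<open>n\<close>, which turns the fibre product
  condition in \<open>character_module\<close> into a plain equation.\<close>

definition characters :: "nat \<Rightarrow> ('a, 'm) monoid_scheme \<Rightarrow> ('a \<Rightarrow> int) set"
  where "characters m G = {\<xi> \<in> (\<Pi>\<^sub>E x\<in>carrier G. {0..<int m}).
    \<forall>x\<in>carrier G. \<forall>y\<in>carrier G. \<xi> (x \<otimes>\<^bsub>G\<^esub> y) = (\<xi> x + \<xi> y) mod int m}"

lemma charactersD: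
  assumes "\<xi> \<in> characters m G"
  shows "x \<in> carrier G \<Longrightarrow> 0 \<le> \<xi> x" "x \<in> carrier G \<Longrightarrow> \<xi> x < int m"
    and "x \<in> carrier G \<Longrightarrow> y \<in> carrier G \<Longrightarrow> \<xi> (x \<otimes>\<^bsub>G\<^esub> y) = (\<xi> x + \<xi> y) mod int m"
    and "\<xi> \<in> extensional (carrier G)"
proof -
  have "\<xi> \<in> (\<Pi>\<^sub>E x\<in>carrier G. {0..<int m})"
    using assms by (simp add: characters_def)
  then show "x \<in> carrier G \<Longrightarrow> 0 \<le> \<xi> x" "x \<in> carrier G \<Longrightarrow> \<xi> x < int m" "\<xi> \<in> extensional (carrier G)"
    using PiE_mem[of \<xi> "carrier G" "\<lambda>_. {0..<int m}" x] by (simp_all add: PiE_def)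
qed (use assms in \<open>simp add: characters_def\<close>)

lemma (in group) character_one:
  assumes "\<xi> \<in> characters m G"
  shows "\<xi> \<one> = 0"
proof -
  have *: "\<xi> \<one> = (\<xi> \<one> + \<xi> \<one>) mod int m" "0 \<le> \<xi> \<one>" "\<xi> \<one> < int m"
    using charactersD(1,2)[OF assms, of \<one>] charactersD(3)[OF assms, of \<one> \<one>] by simp_all
  have "(\<xi> \<one> + \<xi> \<one>) mod int m = (\<xi> \<one> + 0) mod int m"
    using * by simp
  then have "int m dvd \<xi> \<one>"
    by (simp add: mod_eq_dvd_iff)
  then show ?thesis
    using * zdvd_imp_le[of "int m" "\<xi> \<one>"] by linarith
qed

lemma (in group) character_pow:
  assumes "\<xi> \<in> characters m G" "x \<in> carrier G"
  shows "\<xi> (x [^] (k::nat)) = (int k * \<xi> x) mod int m"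
proof (induction k)
  case 0
  then show ?case
    using assms by (simp add: character_one)
next
  case (Suc k)
  have "\<xi> (x [^] Suc k) = ((int k * \<xi> x) mod int m + \<xi> x) mod int m"
    using assms Suc by (simp add: charactersD)
  also have "\<dots> = (int k * \<xi> x + \<xi> x) mod int m"
    by (rule mod_add_left_eq)
  also have "\<dots> = (int (Suc k) * \<xi> x) mod int m"
    by (simp add: algebra_simps)
  finally show ?case .
qed

lemma (in comm_group) subgroup_is_comm_group:
  assumes "subgroup K G"
  shows "comm_group (G\<lparr>carrier := K\<rparr>)"
proof (rule group.group_comm_groupI)
  show "group (G\<lparr>carrier := K\<rparr>)"
    using assms by (rule subgroup.subgroup_is_group) (rule is_group)
qed (use assms in \<open>simp add: m_comm subgroup.mem_carrier\<close>)

text \<open>\<open>G\<close> modulo \<open>K\<close> has prime order, so \<open>g\<close> generates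
  it. The decomposition of \<open>x\<close> is obtained by counting: the \<open>p * p ^ n\<close>
  products with exponent below \<open>p\<close> are distinct.\<close>

lemma (in comm_group) p_power_index_prime:
  assumes p: "prime p" and card: "card (carrier G) = p ^ Suc n" and K: "subgroup K G" "card K = p ^ n"
    and g: "g \<in> carrier G" "g \<notin> K"
  shows "g [^] m \<in> K \<longleftrightarrow> p dvd (m::nat)"
    and "x \<in> carrier G \<Longrightarrow> \<exists>i::nat. \<exists>k\<in>K. x = g [^] i \<otimes> k"
proof -
  interpret K: normal K G
    using K(1) by (rule subgroup_imp_normal)
  have fin: "finite (carrier G)"
    using card prime_gt_0_nat[OF p] by (intro card_ge_0_finite) simp
  have "card (rcosets K) * p ^ n = p ^ Suc n"
    using lagrange[OF K(1)] K(2) card by (simp add: order_def)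
  then have index: "order (G Mod K) = p"
    using prime_gt_0_nat[OF p] by (simp add: order_def FactGroup_def)
  have "(K #> g) [^]\<^bsub>G Mod K\<^esub> order (G Mod K) = \<one>\<^bsub>G Mod K\<^esub>"
    using g by (intro group.pow_order_eq_1 K.factorgroup_is_group) (auto simp: FactGroup_def RCOSETS_def)
  moreover have "\<one>\<^bsub>G Mod K\<^esub> = K"
    by (simp add: FactGroup_def)
  ultimately have "K #> (g [^] p) = K"
    unfolding index using K.FactGroup_pow[OF g(1), of p] by simp
  then have gp: "g [^] p \<in> K"
    using coset_join1[of K "g [^] p"] g K(1) by simp
  have pow_K: "k [^] (j::nat) \<in> K" if "k \<in> K" for k j
    by (induction j) (use that in auto)
  show dvd: "g [^] m \<in> K \<longleftrightarrow> p dvd m" for m :: nat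
  proof
    assume gm: "g [^] m \<in> K"
    show "p dvd m"
    proof (rule ccontr)
      assume "\<not> p dvd m"
      then have "coprime m p"
        using p by (metis coprime_commute prime_imp_coprime)
      moreover have "m \<noteq> 0"
        using \<open>\<not> p dvd m\<close> by (metis dvd_0_right)
      ultimately obtain a b where ab: "m * a = p * b + 1"
        using bezout_nat[of m p] by (metis coprime_imp_gcd_eq_1)
      have "g [^] (p * b) \<otimes> g = (g [^] m) [^] a"
        using g ab by (simp add: nat_pow_pow)
      moreover have "g [^] (p * b) = (g [^] p) [^] b"
        using g by (simp add: nat_pow_pow)
      ultimately have "(g [^] p) [^] b \<otimes> g \<in> K" "(g [^] p) [^] b \<in> K"
        using pow_K gm gp by simp_all
      then have "inv ((g [^] p) [^] b) \<otimes> ((g [^] p) [^] b \<otimes> g) \<in> K"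
        by blast
      then show False
        using g by (simp add: inv_solve_left' m_assoc[symmetric])
    qed
  next
    assume "p dvd m"
    then show "g [^] m \<in> K"
      using g pow_K[OF gp] by (auto simp: nat_pow_pow[symmetric])
  qed
  have inj: "inj_on (\<lambda>(i, k). g [^] i \<otimes> k) ({..<p} \<times> K)"
  proof -
    have lt: False if "i < j" "j < p" "k \<in> K" "k' \<in> K" "g [^] i \<otimes> k = g [^] j \<otimes> k'" for i j :: nat and k k'
    proof -
      have kc: "k \<in> carrier G" "k' \<in> carrier G"
        using that K.mem_carrier by auto
      have "g [^] j = g [^] i \<otimes> g [^] (j - i)"
        using g that by (simp add: nat_pow_mult)
      then have "g [^] i \<otimes> k = g [^] i \<otimes> (g [^] (j - i) \<otimes> k')"
        using that g kc by (simp add: m_assoc)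
      then have "k = g [^] (j - i) \<otimes> k'"
        using g kc by simp
      then have "g [^] (j - i) = k \<otimes> inv k'"
        using g kc by (simp add: m_assoc)
      then have "g [^] (j - i) \<in> K"
        using that by simp
      then have "p dvd j - i"
        by (simp add: dvd)
      then show False
        using that by (auto dest: dvd_imp_le)
    qed
    show ?thesis
    proof (rule inj_onI, clarsimp)
      fix i k j k' assume *: "i < p" "k \<in> K" "j < p" "k' \<in> K" "g [^] i \<otimes> k = g [^] j \<otimes> k'"
      then have "i = j"
        using lt[of i j k k'] lt[of j i k' k] by (cases i j rule: linorder_cases) auto
      then show "i = j \<and> k = k'"
        using * g K.mem_carrier by simp
    qed
  qed
  have "(\<lambda>(i, k). g [^] i \<otimes> k) ` ({..<p} \<times> K) = carrier G"
  proof (rule card_subset_eq[OF fin])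
    show "(\<lambda>(i, k). g [^] i \<otimes> k) ` ({..<p} \<times> K) \<subseteq> carrier G"
      using g K.mem_carrier by auto
    show "card ((\<lambda>(i, k). g [^] i \<otimes> k) ` ({..<p} \<times> K)) = card (carrier G)"
      using card_image[OF inj] K(2) card by (simp add: card_cartesian_product)
  qed
  then show "\<exists>i::nat. \<exists>k\<in>K. x = g [^] i \<otimes> k" if "x \<in> carrier G"
    using that by fastforce
qed

text \<open>The solutions are \<open>c / p + j * p ^ N\<close> with
  \<open>0 \<le> j < p\<close>.\<close>

lemma card_linear_congruence:
  assumes p: "prime p" and c: "0 \<le> c" "c < int p ^ Suc N" "int p dvd c"
  shows "card {y \<in> {0..<int p ^ Suc N}. (int p * y) mod int p ^ Suc N = c} = p"
proof -
  obtain d where d: "c = int p * d"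
    using c by auto
  have pos: "int p > 0"
    using prime_gt_0_nat[OF p] by simp
  have d_bounds: "0 \<le> d" "d < int p ^ N"
    using c pos by (auto simp: d zero_le_mult_iff)
  have "{y \<in> {0..<int p ^ Suc N}. (int p * y) mod int p ^ Suc N = c} = (\<lambda>j. d + j * int p ^ N) ` {0..<int p}"
  proof (intro equalityI subsetI)
    fix y assume y: "y \<in> {y \<in> {0..<int p ^ Suc N}. (int p * y) mod int p ^ Suc N = c}"
    then have "int p * (y mod int p ^ N) = int p * d"
      using mult_mod_right[of "int p" y "int p ^ N"] by (simp add: d)
    then have "y mod int p ^ N = d"
      using pos by simp
    then have "y = d + y div int p ^ N * int p ^ N"
      by (metis add.commute div_mult_mod_eq)
    moreover have "y div int p ^ N \<in> {0..<int p}"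
    proof -
      have "int p ^ N * (y div int p ^ N) \<le> y"
        using mult_div_mod_eq[of "int p ^ N" y] pos_mod_sign[of "int p ^ N" y] zero_less_power[OF pos, of N] by linarith
      also have "y < int p ^ N * int p"
        using y by (simp add: mult.commute)
      finally show ?thesis
        using y pos by (simp add: mult_less_cancel_left_pos pos_imp_zdiv_nonneg_iff)
    qed
    ultimately show "y \<in> (\<lambda>j. d + j * int p ^ N) ` {0..<int p}"
      by blast
  next
    fix y assume "y \<in> (\<lambda>j. d + j * int p ^ N) ` {0..<int p}"
    then obtain j where j: "y = d + j * int p ^ N" "0 \<le> j" "j < int p"
      by auto
    have "j * int p ^ N \<le> (int p - 1) * int p ^ N"
      using j pos by (intro mult_right_mono) auto
    then have "y < int p ^ Suc N"
      using d_bounds by (simp add: j algebra_simps)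
    moreover have "(int p * y) mod int p ^ Suc N = int p * (y mod int p ^ N)"
      by (simp only: mult_mod_right power_Suc)
    moreover have "y mod int p ^ N = d"
      using d_bounds by (simp add: j)
    ultimately show "y \<in> {y \<in> {0..<int p ^ Suc N}. (int p * y) mod int p ^ Suc N = c}"
      using j d_bounds pos by (simp add: d)
  qed
  moreover have "inj_on (\<lambda>j. d + j * int p ^ N) {0..<int p}"
    using pos by (auto intro!: inj_onI)
  ultimately show ?thesis
    by (simp add: card_image)
qed

text \<open>An extension of \<open>\<psi>\<close> is determined by \<open>y = \<xi> g\<close>, and
  the only condition is \<open>p y = \<psi> (g ^ p)\<close> modulo \<open>p ^ Suc N\<close>. It has
  \<open>p\<close> solutions once \<open>p\<close> divides the right-hand side.\<close>

lemma (in comm_group) card_character_extensions: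
  assumes p: "prime p" and card: "card (carrier G) = p ^ Suc n" and N: "n \<le> N"
    and K: "subgroup K G" "card K = p ^ n" and \<psi>: "\<psi> \<in> characters (p ^ Suc N) (G\<lparr>carrier := K\<rparr>)"
  shows "card {\<xi> \<in> characters (p ^ Suc N) G. restrict \<xi> K = \<psi>} = p"
proof -
  interpret K: subgroup K G
    by (rule K(1))
  interpret GK: comm_group "G\<lparr>carrier := K\<rparr>"
    by (rule subgroup_is_comm_group[OF K(1)])
  let ?m = "p ^ Suc N"
  have "card K < card (carrier G)"
    using K(2) card prime_gt_1_nat[OF p] by simp
  then obtain g where g: "g \<in> carrier G" "g \<notin> K"
    by (metis K.subset less_irrefl subsetI subset_antisym)
  note dvd = p_power_index_prime(1)[OF p card K g]
  note cover = p_power_index_prime(2)[OF p card K g]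
  note \<psi>D = charactersD[OF \<psi>, simplified]
  have gp: "g [^] p \<in> K"
    by (simp add: dvd)
  have powK: "x [^]\<^bsub>G\<lparr>carrier := K\<rparr>\<^esub> (j::nat) = x [^] j" for x j
    by (simp add: nat_pow_def)
  define c where "c = \<psi> (g [^] p)"
  \<comment> \<open>The order of \<open>g ^ p\<close> divides \<open>card K = p ^ n\<close>, so
    \<open>p ^ n * c\<close> vanishes modulo \<open>p ^ Suc N\<close>; as \<open>n \<le> N\<close>,
    at least one factor \<open>p\<close> is left over for \<open>c\<close>.\<close>
  have "int ?m dvd int (p ^ n) * c"
  proof -
    have "(g [^] p) [^] (p ^ n) = \<one>"
      using GK.pow_order_eq_1[of "g [^] p"] gp K(2) by (simp add: order_def powK)
    then have "(int (p ^ n) * c) mod int ?m = 0"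
      using GK.character_pow[OF \<psi>, of "g [^] p" "p ^ n"] GK.character_one[OF \<psi>] gp by (simp add: powK c_def)
    then show ?thesis
      by (simp add: dvd_eq_mod_eq_0)
  qed
  moreover have "int ?m = int (p ^ n) * int p ^ Suc (N - n)"
    using N by (simp flip: power_add)
  ultimately have "int p ^ Suc (N - n) dvd c"
    using prime_gt_0_nat[OF p] by simp
  then have "int p dvd c"
    by (metis dvd_mult_left power_Suc)
  then have count: "card {y \<in> {0..<int ?m}. (int p * y) mod int ?m = c} = p"
    using card_linear_congruence[OF p, of c N] \<psi>D(1,2)[OF gp] by (simp add: c_def)
  have "bij_betw (\<lambda>\<xi>. \<xi> g) {\<xi> \<in> characters ?m G. restrict \<xi> K = \<psi>} {y \<in> {0..<int ?m}. (int p * y) mod int ?m = c}"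
    unfolding bij_betw_def
  proof
    have val: "\<xi> (g [^] i \<otimes> k) = (int i * \<xi> g + \<psi> k) mod int ?m"
      if "\<xi> \<in> characters ?m G" "restrict \<xi> K = \<psi>" "k \<in> K" for \<xi> k and i :: nat
    proof -
      have "\<xi> k = \<psi> k"
        using that by (metis restrict_apply')
      then show ?thesis
        using that g charactersD(3)[OF that(1), of "g [^] i" k] character_pow[OF that(1) g(1), of i]
        by (simp add: mod_add_left_eq)
    qed
    show "inj_on (\<lambda>\<xi>. \<xi> g) {\<xi> \<in> characters ?m G. restrict \<xi> K = \<psi>}"
    proof (rule inj_onI, clarify)
      fix \<xi> \<xi>' assume *: "\<xi> \<in> characters ?m G" "\<psi> = restrict \<xi> K" "\<xi>' \<in> characters ?m G" "restrict \<xi>' K = restrict \<xi> K" "\<xi> g = \<xi>' g"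
      have "\<xi> x = \<xi>' x" if "x \<in> carrier G" for x
        using cover[OF that] val[OF *(1)] val[OF *(3)] * by auto
      then show "\<xi> = \<xi>'"
        using charactersD(4)[OF *(1)] charactersD(4)[OF *(3)] by (intro extensionalityI[of \<xi> "carrier G"])
    qed
    show "(\<lambda>\<xi>. \<xi> g) ` {\<xi> \<in> characters ?m G. restrict \<xi> K = \<psi>} = {y \<in> {0..<int ?m}. (int p * y) mod int ?m = c}"
    proof (intro equalityI subsetI)
      fix y assume "y \<in> (\<lambda>\<xi>. \<xi> g) ` {\<xi> \<in> characters ?m G. restrict \<xi> K = \<psi>}"
      then obtain \<xi> where \<xi>: "y = \<xi> g" "\<xi> \<in> characters ?m G" "restrict \<xi> K = \<psi>"
        by auto
      have "c = \<xi> (g [^] p)"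
        using \<xi>(3) gp by (metis c_def restrict_apply')
      then show "y \<in> {y \<in> {0..<int ?m}. (int p * y) mod int ?m = c}"
        using \<xi> g charactersD(1,2)[OF \<xi>(2) g(1)] character_pow[OF \<xi>(2) g(1), of p] by simp
    next
      fix y assume y: "y \<in> {y \<in> {0..<int ?m}. (int p * y) mod int ?m = c}"
      \<comment> \<open>The value prescribed for a product depends on the product only: two
        representations differ by a power of \<open>g\<close> lying in \<open>K\<close>, that is, by
        a power of \<open>g ^ p\<close>, where the choice of \<open>y\<close> agrees with
        \<open>\<psi>\<close>.\<close>
      have wd: "(int i * y + \<psi> k) mod int ?m = (int j * y + \<psi> l) mod int ?m"
        if "k \<in> K" "l \<in> K" "g [^] i \<otimes> k = g [^] j \<otimes> l" "i \<le> j" for i j k l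
      proof -
        have kl: "k \<in> carrier G" "l \<in> carrier G"
          using that K.mem_carrier by auto
        have "g [^] j = g [^] i \<otimes> g [^] (j - i)"
          using g that by (simp add: nat_pow_mult)
        then have "g [^] i \<otimes> k = g [^] i \<otimes> (g [^] (j - i) \<otimes> l)"
          using that g kl by (simp add: m_assoc)
        then have k: "k = g [^] (j - i) \<otimes> l"
          using g kl by simp
        then have "g [^] (j - i) = k \<otimes> inv l"
          using g kl by (simp add: m_assoc)
        then have "g [^] (j - i) \<in> K"
          using that by simp
        then obtain b where b: "j - i = p * b"
          using dvd by blast
        have "g [^] (j - i) = (g [^] p) [^] b"
          using g by (simp add: b nat_pow_pow)
        then have "\<psi> (g [^] (j - i)) = (int b * c) mod int ?m"
          using GK.character_pow[OF \<psi>, of "g [^] p" b] gp by (simp add: powK c_def)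
        also have "\<dots> = (int b * ((int p * y) mod int ?m)) mod int ?m"
          using y by simp
        also have "\<dots> = (int (j - i) * y) mod int ?m"
          by (simp add: b mod_mult_right_eq mult_ac)
        finally have "\<psi> k = (int (j - i) * y + \<psi> l) mod int ?m"
          using \<psi>D(3)[of "g [^] (j - i)" l] \<open>g [^] (j - i) \<in> K\<close> that(2) by (simp add: k mod_add_left_eq)
        then have "(int i * y + \<psi> k) mod int ?m = (int i * y + (int (j - i) * y + \<psi> l)) mod int ?m"
          by (simp add: mod_add_right_eq)
        also have "int i * y + (int (j - i) * y + \<psi> l) = int j * y + \<psi> l"
          using that by (simp add: of_nat_diff algebra_simps)
        finally show ?thesis .
      qed
      define I where "I x = (SOME i::nat. \<exists>k\<in>K. x = g [^] i \<otimes> k)" for x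
      define L where "L x = (SOME k. k \<in> K \<and> x = g [^] I x \<otimes> k)" for x
      have IL: "L x \<in> K \<and> x = g [^] I x \<otimes> L x" if "x \<in> carrier G" for x
      proof -
        have "\<exists>k\<in>K. x = g [^] I x \<otimes> k"
          unfolding I_def using cover[OF that] by (rule someI_ex)
        then have "\<exists>k. k \<in> K \<and> x = g [^] I x \<otimes> k"
          by blast
        then show ?thesis
          unfolding L_def by (rule someI_ex)
      qed
      define \<xi> where "\<xi> = (\<lambda>x\<in>carrier G. (int (I x) * y + \<psi> (L x)) mod int ?m)"
      have \<xi>: "\<xi> (g [^] i \<otimes> k) = (int i * y + \<psi> k) mod int ?m" if k: "k \<in> K" for i k
      proof -
        let ?x = "g [^] i \<otimes> k"
        have x: "?x \<in> carrier G"
          using g k K.mem_carrier by simp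
        have "(int (I ?x) * y + \<psi> (L ?x)) mod int ?m = (int i * y + \<psi> k) mod int ?m"
          using IL[OF x] k wd[of "L ?x" k "I ?x" i] wd[of k "L ?x" i "I ?x"] by (cases "I ?x \<le> i") auto
        then show ?thesis
          using x by (simp add: \<xi>_def)
      qed
      have m_pos: "int ?m > 0"
        using prime_gt_0_nat[OF p] by simp
      have "\<xi> (x \<otimes> z) = (\<xi> x + \<xi> z) mod int ?m" if xz: "x \<in> carrier G" "z \<in> carrier G" for x z
      proof -
        obtain i k where x: "x = g [^] (i::nat) \<otimes> k" "k \<in> K"
          using cover[OF xz(1)] by blast
        obtain j l where z: "z = g [^] (j::nat) \<otimes> l" "l \<in> K"
          using cover[OF xz(2)] by blast
        have "x \<otimes> z = g [^] (i + j) \<otimes> (k \<otimes> l)"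
          using g x z K.mem_carrier by (simp add: nat_pow_mult[symmetric] m_ac)
        then have "\<xi> (x \<otimes> z) = (int (i + j) * y + \<psi> (k \<otimes> l)) mod int ?m"
          using \<xi>[of "k \<otimes> l" "i + j"] x z by simp
        also have "\<dots> = (int (i + j) * y + (\<psi> k + \<psi> l)) mod int ?m"
          using \<psi>D(3)[of k l] x z by (simp add: mod_add_right_eq)
        also have "int (i + j) * y + (\<psi> k + \<psi> l) = (int i * y + \<psi> k) + (int j * y + \<psi> l)"
          by (simp add: algebra_simps)
        also have "\<dots> mod int ?m = (\<xi> x + \<xi> z) mod int ?m"
          using x z \<xi> by (simp add: mod_add_eq)
        finally show ?thesis .
      qed
      moreover have "\<xi> \<in> (\<Pi>\<^sub>E x\<in>carrier G. {0..<int ?m})"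
        using m_pos by (auto simp: \<xi>_def)
      ultimately have "\<xi> \<in> characters ?m G"
        by (simp add: characters_def)
      moreover have "restrict \<xi> K = \<psi>"
      proof (rule extensionalityI[of _ K])
        show "\<psi> \<in> extensional K"
          using \<psi>D(4) .
        show "restrict \<xi> K k = \<psi> k" if "k \<in> K" for k
          using \<xi>[OF that, of 0] that K.mem_carrier[OF that] \<psi>D(1,2)[OF that] by simp
      qed simp
      moreover have "\<xi> g = y"
      proof -
        have "\<psi> \<one> = 0"
          using GK.character_one[OF \<psi>] by simp
        then show ?thesis
          using \<xi>[of \<one> 1] g y by simp
      qed
      ultimately show "y \<in> (\<lambda>\<xi>. \<xi> g) ` {\<xi> \<in> characters ?m G. restrict \<xi> K = \<psi>}"
        by blast
    qed
  qed
  then show ?thesis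
    using count by (simp add: bij_betw_same_card)
qed

text \<open>Induction along a subgroup of index \<open>p\<close>, from which every character extends
  in \<open>p\<close> ways. The modulus stays \<open>p ^ N\<close> while the order of the group
  drops, hence two exponents.\<close>

theorem card_characters:
  assumes "prime p" "comm_group G" "card (carrier G) = p ^ n" "n \<le> N"
  shows "card (characters (p ^ N) G) = p ^ n"
  using assms
proof (induction n arbitrary: G N)
  case 0
  interpret comm_group G
    by fact
  have one: "carrier G = {\<one>\<^bsub>G\<^esub>}"
    using 0 by (metis card_1_singletonE one_closed power_0 singletonD)
  have m_pos: "int (p ^ N) > 0"
    using prime_gt_0_nat[OF \<open>prime p\<close>] by simp
  have "characters (p ^ N) G = {\<lambda>x\<in>carrier G. 0}"
  proof (intro equalityI subsetI)
    fix \<xi> assume \<xi>: "\<xi> \<in> characters (p ^ N) G"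
    have "\<xi> = (\<lambda>x\<in>carrier G. 0)"
      using charactersD(4)[OF \<xi>] character_one[OF \<xi>] one
      by (intro extensionalityI[of \<xi> "carrier G"]) auto
    then show "\<xi> \<in> {\<lambda>x\<in>carrier G. 0}"
      by simp
  qed (use m_pos in \<open>auto simp: characters_def\<close>)
  then show ?case
    by simp
next
  case (Suc n)
  interpret comm_group G
    by fact
  obtain N' where N': "N = Suc N'" "n \<le> N'"
    using Suc.prems(4) by (cases N) auto
  have "finite (carrier G)"
    using Suc.prems(3) prime_gt_0_nat[OF \<open>prime p\<close>] by (intro card_ge_0_finite) simp
  \<comment> \<open>The Sylow theorem is applied to the factorization of the order as
    \<open>p ^ n * p\<close>, so the subgroup has index \<open>p\<close>.\<close>
  then obtain K where K: "subgroup K G" "card K = p ^ n"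
    using sylow_thm[OF \<open>prime p\<close>, of G n p] Suc.prems(3) is_group by (auto simp: order_def)
  interpret K: subgroup K G
    by (rule K(1))
  have "comm_group (G\<lparr>carrier := K\<rparr>)"
    by (rule subgroup_is_comm_group[OF K(1)])
  then have IH: "card (characters (p ^ N) (G\<lparr>carrier := K\<rparr>)) = p ^ n"
    using Suc.IH[of "G\<lparr>carrier := K\<rparr>" N] Suc.prems(1,4) K(2) by simp
  let ?r = "\<lambda>\<xi>. restrict \<xi> K"
  have fib: "card {\<xi> \<in> characters (p ^ N) G. ?r \<xi> = \<psi>} = p" if "\<psi> \<in> characters (p ^ N) (G\<lparr>carrier := K\<rparr>)" for \<psi>
    using card_character_extensions[OF \<open>prime p\<close> Suc.prems(3) N'(2) K] that by (simp add: N')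
  have img: "?r ` characters (p ^ N) G = characters (p ^ N) (G\<lparr>carrier := K\<rparr>)"
  proof
    show "?r ` characters (p ^ N) G \<subseteq> characters (p ^ N) (G\<lparr>carrier := K\<rparr>)"
      using K.mem_carrier by (auto simp: characters_def PiE_iff)
    show "characters (p ^ N) (G\<lparr>carrier := K\<rparr>) \<subseteq> ?r ` characters (p ^ N) G"
    proof
      fix \<psi> assume "\<psi> \<in> characters (p ^ N) (G\<lparr>carrier := K\<rparr>)"
      then have "card {\<xi> \<in> characters (p ^ N) G. ?r \<xi> = \<psi>} > 0"
        using fib prime_gt_0_nat[OF \<open>prime p\<close>] by simp
      then show "\<psi> \<in> ?r ` characters (p ^ N) G"
        by (auto simp: card_gt_0_iff)
    qed
  qed
  have "card (characters (p ^ N) G) = p * card (?r ` characters (p ^ N) G)"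
  proof (rule card_fibres(2))
    show "finite (?r ` characters (p ^ N) G)"
      unfolding img using IH prime_gt_0_nat[OF \<open>prime p\<close>] by (intro card_ge_0_finite) simp
    show "card {\<psi> \<in> characters (p ^ N) G. ?r \<psi> = ?r \<xi>} = p" if "\<xi> \<in> characters (p ^ N) G" for \<xi>
      using fib img that by blast
  qed (use prime_gt_0_nat[OF \<open>prime p\<close>] in simp)
  then show ?case
    by (simp add: img IH)
qed

section \<open>Extensions by the p-adic integers\<close>

lemma p_group_module_simps [simp]:
  "carrier (p_group_module p G) = carrier G" "add (p_group_module p G) = mult G" "zero (p_group_module p G) = one G"
  by (simp_all add: p_group_module_def)

lemma extensionsD:
  assumes "(E, i, q) \<in> extensions p G"
  shows "module (Zp p) E" "i \<in> module_hom (Zp p) (self_module (Zp p)) E" "q \<in> module_hom (Zp p) E (p_group_module p G)"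
    "inj_on i (carrier (Zp p))" "q ` carrier E = carrier G"
    "i ` carrier (Zp p) = {x \<in> carrier E. q x = \<one>\<^bsub>G\<^esub>}"
  using assms by (auto simp: extensions_def a_kernel_def kernel_def)

lemma extensionsI:
  assumes "module (Zp p) E" "i \<in> module_hom (Zp p) (self_module (Zp p)) E" "q \<in> module_hom (Zp p) E (p_group_module p G)"
    "inj_on i (carrier (Zp p))" "q ` carrier E = carrier G"
    "i ` carrier (Zp p) = {x \<in> carrier E. q x = \<one>\<^bsub>G\<^esub>}"
  shows "(E, i, q) \<in> extensions p G"
  using assms by (auto simp: extensions_def a_kernel_def kernel_def)

definition ext_rel where
  "ext_rel p G = {(\<epsilon>, \<epsilon>'). \<epsilon> \<in> extensions p G \<and> \<epsilon>' \<in> extensions p G \<and> equivalent_extensions p \<epsilon> \<epsilon>'}"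

lemma Ext_eq: "Ext p G = extensions p G // ext_rel p G"
  by (simp add: Ext_def ext_rel_def)

lemma equivalent_extensionsI:
  assumes "\<phi> \<in> module_iso (Zp p) E E'" "\<And>a. a \<in> carrier (Zp p) \<Longrightarrow> \<phi> (i a) = i' a"
    "\<And>x. x \<in> carrier E \<Longrightarrow> q' (\<phi> x) = q x"
  shows "equivalent_extensions p (E, i, q) (E', i', q')"
  unfolding equivalent_extensions_def prod.case using assms by blast

lemma equivalent_extensionsE:
  assumes "equivalent_extensions p (E, i, q) (E', i', q')"
  obtains \<phi> where "\<phi> \<in> module_iso (Zp p) E E'" "\<And>a. a \<in> carrier (Zp p) \<Longrightarrow> \<phi> (i a) = i' a"
    "\<And>x. x \<in> carrier E \<Longrightarrow> q' (\<phi> x) = q x"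
  using assms by (auto simp: equivalent_extensions_def)

lemma equiv_ext_rel: "equiv (extensions p G) (ext_rel p G)"
proof (rule equivI)
  show "ext_rel p G \<subseteq> extensions p G \<times> extensions p G"
    by (auto simp: ext_rel_def)
  show "refl_on (extensions p G) (ext_rel p G)"
    by (rule refl_onI) (auto simp: ext_rel_def intro!: equivalent_extensionsI[OF module_iso_refl])
  show "sym (ext_rel p G)"
  proof (rule symI)
    fix \<epsilon> \<epsilon>' assume *: "(\<epsilon>, \<epsilon>') \<in> ext_rel p G"
    obtain E i q E' i' q' where e: "\<epsilon> = (E, i, q)" "\<epsilon>' = (E', i', q')"
      by (metis prod_cases3)
    have ext: "(E, i, q) \<in> extensions p G" "(E', i', q') \<in> extensions p G"
      using * by (auto simp: ext_rel_def e)
    obtain \<phi> where \<phi>: "\<phi> \<in> module_iso (Zp p) E E'" "\<And>a. a \<in> carrier (Zp p) \<Longrightarrow> \<phi> (i a) = i' a"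
      "\<And>x. x \<in> carrier E \<Longrightarrow> q' (\<phi> x) = q x"
      using * by (auto simp: ext_rel_def e elim: equivalent_extensionsE)
    have bij: "bij_betw \<phi> (carrier E) (carrier E')"
      using \<phi>(1) by (simp add: module_iso_def)
    let ?\<psi> = "inv_into (carrier E) \<phi>"
    have "equivalent_extensions p (E', i', q') (E, i, q)"
    proof (rule equivalent_extensionsI)
      show "?\<psi> \<in> module_iso (Zp p) E' E"
        using extensionsD(1)[OF ext(1)] \<phi>(1) by (rule module_iso_inv_into)
      show "?\<psi> (i' a) = i a" if "a \<in> carrier (Zp p)" for a
      proof -
        have "i a \<in> carrier E"
          using extensionsD(6)[OF ext(1)] that by blast
        then show ?thesis
          using bij that by (simp add: bij_betw_def flip: \<phi>(2))
      qed
      show "q (?\<psi> y) = q' y" if "y \<in> carrier E'" for y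
        using bij that \<phi>(3)[of "?\<psi> y"] by (simp add: bij_betw_def inv_into_into f_inv_into_f)
    qed
    then show "(\<epsilon>', \<epsilon>) \<in> ext_rel p G"
      using ext by (simp add: ext_rel_def e)
  qed
  show "trans (ext_rel p G)"
  proof (rule transI)
    fix \<epsilon> \<epsilon>' \<epsilon>'' assume *: "(\<epsilon>, \<epsilon>') \<in> ext_rel p G" "(\<epsilon>', \<epsilon>'') \<in> ext_rel p G"
    obtain E i q E' i' q' E'' i'' q'' where e: "\<epsilon> = (E, i, q)" "\<epsilon>' = (E', i', q')" "\<epsilon>'' = (E'', i'', q'')"
      by (metis prod_cases3)
    obtain \<phi> where \<phi>: "\<phi> \<in> module_iso (Zp p) E E'" "\<And>a. a \<in> carrier (Zp p) \<Longrightarrow> \<phi> (i a) = i' a"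
      "\<And>x. x \<in> carrier E \<Longrightarrow> q' (\<phi> x) = q x"
      using *(1) by (auto simp: ext_rel_def e elim: equivalent_extensionsE)
    obtain \<psi> where \<psi>: "\<psi> \<in> module_iso (Zp p) E' E''" "\<And>a. a \<in> carrier (Zp p) \<Longrightarrow> \<psi> (i' a) = i'' a"
      "\<And>x. x \<in> carrier E' \<Longrightarrow> q'' (\<psi> x) = q' x"
      using *(2) by (auto simp: ext_rel_def e elim: equivalent_extensionsE)
    have "\<phi> x \<in> carrier E'" if "x \<in> carrier E" for x
      using \<phi>(1) that by (auto simp: module_iso_def dest: module_homD)
    then have "equivalent_extensions p (E, i, q) (E'', i'', q'')"
      using \<phi>(2,3) \<psi>(2,3) by (intro equivalent_extensionsI[OF module_iso_compose[OF \<phi>(1) \<psi>(1)]]) auto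
    then show "(\<epsilon>, \<epsilon>'') \<in> ext_rel p G"
      using * by (simp add: ext_rel_def e)
  qed
qed

text \<open>
  The pullback of \<open>Zp\<close> along a character \<open>\<xi>\<close> of \<open>G\<close> with values in \<open>Zp / p ^ n\<close>; the fields
  \<open>mult\<close> and \<open>one\<close> are junk.
\<close>

definition character_module :: "nat \<Rightarrow> nat \<Rightarrow> (nat, 'm) monoid_scheme \<Rightarrow> (nat \<Rightarrow> int) \<Rightarrow> zp_module"
  where "character_module p n G \<xi> =
    \<lparr>carrier = {(a, g). a \<in> carrier (Zp p) \<and> g \<in> carrier G \<and> a n = \<xi> g},
     mult = (\<lambda>x y. x), one = (\<zero>\<^bsub>Zp p\<^esub>, \<one>\<^bsub>G\<^esub>), zero = (\<zero>\<^bsub>Zp p\<^esub>, \<one>\<^bsub>G\<^esub>),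
     add = (\<lambda>(a, g) (b, h). (a \<oplus>\<^bsub>Zp p\<^esub> b, g \<otimes>\<^bsub>G\<^esub> h)),
     smult = (\<lambda>c (a, g). (c \<otimes>\<^bsub>Zp p\<^esub> a, c \<odot>\<^bsub>p_group_module p G\<^esub> g))\<rparr>"

text \<open>In the pullback, the kernel of the projection to \<open>G\<close> consists of the
  multiples of \<open>p ^ n\<close>, so \<open>Zp\<close> is embedded by multiplication with
  \<open>p ^ n\<close>.\<close>

definition character_extension :: "nat \<Rightarrow> nat \<Rightarrow> nat monoid \<Rightarrow> (nat \<Rightarrow> int) \<Rightarrow> extension"
  where "character_extension p n G \<xi> =
    (character_module p n G \<xi>, \<lambda>a. (zp_power p n \<otimes>\<^bsub>Zp p\<^esub> a, \<one>\<^bsub>G\<^esub>), snd)"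

lemma Zp_add_apply: "(a \<oplus>\<^bsub>Zp p\<^esub> b) n = (a n + b n) mod int p ^ n"
  and Zp_mult_apply: "(a \<otimes>\<^bsub>Zp p\<^esub> b) n = (a n * b n) mod int p ^ n"
  and Zp_zero_apply: "\<zero>\<^bsub>Zp p\<^esub> n = 0"
  by (simp_all add: Zp_def)

locale ext_group = G: comm_group G for p :: nat and G :: "nat monoid" (structure) +
  fixes n :: nat
  assumes prime_p: "prime p" and card_G: "card (carrier G) = p ^ n"
begin

lemma finite_abelian_p_group: "is_finite_abelian_p_group p G"
  unfolding is_finite_abelian_p_group_def using card_G prime_gt_0_nat[OF prime_p] G.comm_group_axioms
  by (auto intro!: card_ge_0_finite)

sublocale PG: module "Zp p" "p_group_module p G"
  by (rule p_group_module_is_module[OF prime_p finite_abelian_p_group])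

lemma smult_PG: "a \<odot>\<^bsub>p_group_module p G\<^esub> g = g [^] a n"
  using multiplicity_same_power[of p n] prime_p card_G
  by (simp add: p_group_module_def not_prime_unit)

lemma PG_closed [simp]: "a \<in> carrier (Zp p) \<Longrightarrow> g \<in> carrier G \<Longrightarrow> a \<odot>\<^bsub>p_group_module p G\<^esub> g \<in> carrier G"
  using PG.smult_closed by simp

lemma character_smult:
  assumes \<xi>: "\<xi> \<in> characters (p ^ n) G" and a: "a \<in> carrier (Zp p)" and g: "g \<in> carrier G"
  shows "\<xi> (a \<odot>\<^bsub>p_group_module p G\<^esub> g) = (a n * \<xi> g) mod int p ^ n"
proof -
  obtain k where k: "a n = int k"
    using Zp_apply_bounds(1)[OF prime_p a, of n] nonneg_int_cases by blast
  show ?thesis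
    using G.character_pow[OF \<xi> g, of k] by (simp add: smult_PG k int_pow_int)
qed

lemma module_character_module:
  assumes \<xi>: "\<xi> \<in> characters (p ^ n) G"
  shows "module (Zp p) (character_module p n G \<xi>)"
proof (rule moduleI[OF Zp_cring])
  let ?E = "character_module p n G \<xi>"
  note [simp] = character_module_def
  have smult: "c \<odot>\<^bsub>?E\<^esub> x \<in> carrier ?E" if "c \<in> carrier (Zp p)" "x \<in> carrier ?E" for c x
    using that character_smult[OF \<xi>] by (auto simp: Zp_mult_apply)
  then show "c \<odot>\<^bsub>?E\<^esub> x \<in> carrier ?E" if "c \<in> carrier (Zp p)" "x \<in> carrier ?E" for c x
    using that .
  show "abelian_group ?E"
  proof (rule abelian_groupI)
    show "x \<oplus>\<^bsub>?E\<^esub> y \<in> carrier ?E" if "x \<in> carrier ?E" "y \<in> carrier ?E" for x y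
      using that charactersD(3)[OF \<xi>] by (auto simp: Zp_add_apply)
    show "\<zero>\<^bsub>?E\<^esub> \<in> carrier ?E"
      using G.character_one[OF \<xi>] by (simp add: Zp_zero_apply)
    show "\<exists>y\<in>carrier ?E. y \<oplus>\<^bsub>?E\<^esub> x = \<zero>\<^bsub>?E\<^esub>" if "x \<in> carrier ?E" for x
    \<comment> \<open>The negative is taken as the scalar multiple by -1, whose membership in the
      carrier is already known.\<close>
    proof (rule bexI)
      have "(\<ominus>\<^bsub>Zp p\<^esub> \<one>\<^bsub>Zp p\<^esub>) \<odot>\<^bsub>p_group_module p G\<^esub> g \<oplus>\<^bsub>p_group_module p G\<^esub> g = \<one>\<^bsub>G\<^esub>" if "g \<in> carrier G" for g
        using that PG.smult_l_minus[of "\<one>\<^bsub>Zp p\<^esub>" g] PG.M.l_neg[of g] PG.smult_one[of g] by simp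
      then show "((\<ominus>\<^bsub>Zp p\<^esub> \<one>\<^bsub>Zp p\<^esub>) \<odot>\<^bsub>?E\<^esub> x) \<oplus>\<^bsub>?E\<^esub> x = \<zero>\<^bsub>?E\<^esub>"
        using that by (auto simp: PG.R.l_minus PG.R.l_neg)
      show "(\<ominus>\<^bsub>Zp p\<^esub> \<one>\<^bsub>Zp p\<^esub>) \<odot>\<^bsub>?E\<^esub> x \<in> carrier ?E"
        using that by (intro smult) auto
    qed
  qed (auto simp: PG.R.a_ac G.m_ac)
  show "(a \<oplus>\<^bsub>Zp p\<^esub> b) \<odot>\<^bsub>?E\<^esub> x = a \<odot>\<^bsub>?E\<^esub> x \<oplus>\<^bsub>?E\<^esub> b \<odot>\<^bsub>?E\<^esub> x"
    if "a \<in> carrier (Zp p)" "b \<in> carrier (Zp p)" "x \<in> carrier ?E" for a b x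
    using that PG.smult_l_distr by (auto simp: PG.R.l_distr)
  show "a \<odot>\<^bsub>?E\<^esub> (x \<oplus>\<^bsub>?E\<^esub> y) = a \<odot>\<^bsub>?E\<^esub> x \<oplus>\<^bsub>?E\<^esub> a \<odot>\<^bsub>?E\<^esub> y"
    if "a \<in> carrier (Zp p)" "x \<in> carrier ?E" "y \<in> carrier ?E" for a x y
    using that PG.smult_r_distr by (auto simp: PG.R.r_distr)
  show "(a \<otimes>\<^bsub>Zp p\<^esub> b) \<odot>\<^bsub>?E\<^esub> x = a \<odot>\<^bsub>?E\<^esub> (b \<odot>\<^bsub>?E\<^esub> x)"
    if "a \<in> carrier (Zp p)" "b \<in> carrier (Zp p)" "x \<in> carrier ?E" for a b x
    using that PG.smult_assoc1 by (auto simp: PG.R.m_assoc)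
  show "\<one>\<^bsub>Zp p\<^esub> \<odot>\<^bsub>?E\<^esub> x = x" if "x \<in> carrier ?E" for x
    using that PG.smult_one by auto
qed

lemma character_extension_in_extensions:
  assumes \<xi>: "\<xi> \<in> characters (p ^ n) G"
  shows "character_extension p n G \<xi> \<in> extensions p G"
  unfolding character_extension_def
proof (rule extensionsI[OF module_character_module[OF \<xi>]])
  let ?E = "character_module p n G \<xi>" and ?i = "\<lambda>a. (zp_power p n \<otimes>\<^bsub>Zp p\<^esub> a, \<one>\<^bsub>G\<^esub>)"
  have one: "\<xi> \<one>\<^bsub>G\<^esub> = 0"
    by (rule G.character_one[OF \<xi>])
  have power_n: "(zp_power p n \<otimes>\<^bsub>Zp p\<^esub> a) n = 0" for a
    by (simp add: Zp_mult_apply zp_of_int_apply)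
  show "?i \<in> module_hom (Zp p) (self_module (Zp p)) ?E"
  proof (rule module_homI)
    show "?i (a \<odot>\<^bsub>self_module (Zp p)\<^esub> x) = a \<odot>\<^bsub>?E\<^esub> ?i x" if "a \<in> carrier (Zp p)" "x \<in> carrier (self_module (Zp p))" for a x
      using that PG.smult_r_null[of a] PG.R.m_lcomm[of a "zp_power p n" x] by (simp add: self_module_def character_module_def)
  qed (use one power_n in \<open>auto simp: self_module_def character_module_def PG.R.r_distr\<close>)
  show "snd \<in> module_hom (Zp p) ?E (p_group_module p G)"
    by (rule module_homI) (auto simp: character_module_def)
  show "inj_on ?i (carrier (Zp p))"
  proof (rule inj_onI, simp)
    interpret D: domain "Zp p"
      by (rule Zp_domain[OF prime_p])
    fix a b assume "a \<in> carrier (Zp p)" "b \<in> carrier (Zp p)" "zp_power p n \<otimes>\<^bsub>Zp p\<^esub> a = zp_power p n \<otimes>\<^bsub>Zp p\<^esub> b"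
    then show "a = b"
      using zp_power_nonzero[OF prime_p, of n] by (simp add: D.m_lcancel)
  qed
  show "snd ` carrier ?E = carrier G"
  proof
    show "carrier G \<subseteq> snd ` carrier ?E"
    proof
      fix g assume g: "g \<in> carrier G"
      then have "(zp_of_int p (\<xi> g), g) \<in> carrier ?E"
        using charactersD(1,2)[OF \<xi> g] by (simp add: character_module_def zp_of_int_apply)
      then show "g \<in> snd ` carrier ?E"
        by force
    qed
  qed (auto simp: character_module_def)
  show "?i ` carrier (Zp p) = {x \<in> carrier ?E. snd x = \<one>\<^bsub>G\<^esub>}"
  proof
    show "{x \<in> carrier ?E. snd x = \<one>\<^bsub>G\<^esub>} \<subseteq> ?i ` carrier (Zp p)"
    proof
      fix x assume "x \<in> {x \<in> carrier ?E. snd x = \<one>\<^bsub>G\<^esub>}"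
      then obtain a where a: "x = (a, \<one>\<^bsub>G\<^esub>)" "a \<in> carrier (Zp p)" "a n = 0"
        using one by (auto simp: character_module_def)
      then obtain b where "b \<in> carrier (Zp p)" "a = zp_power p n \<otimes>\<^bsub>Zp p\<^esub> b"
        using Zp_dividesE[OF prime_p a(2,3)] by blast
      with a show "x \<in> ?i ` carrier (Zp p)"
        by simp
    qed
  qed (use one power_n in \<open>auto simp: character_module_def\<close>)
qed

text \<open>The element \<open>p ^ n (a, g)\<close> lies in the embedded \<open>Zp\<close>, which an
  equivalence fixes pointwise. As \<open>p ^ n\<close> can be cancelled, an equivalence cannot
  change the coordinate \<open>a\<close>, whose residue is the value of the character at
  \<open>g\<close>.\<close>

lemma equivalent_character_extensions:
  assumes \<xi>: "\<xi> \<in> characters (p ^ n) G" and \<xi>': "\<xi>' \<in> characters (p ^ n) G"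
    and "equivalent_extensions p (character_extension p n G \<xi>) (character_extension p n G \<xi>')"
  shows "\<xi> = \<xi>'"
proof -
  let ?E = "character_module p n G \<xi>" and ?E' = "character_module p n G \<xi>'"
  obtain \<phi> where \<phi>: "\<phi> \<in> module_iso (Zp p) ?E ?E'"
    "\<And>a. a \<in> carrier (Zp p) \<Longrightarrow> \<phi> (zp_power p n \<otimes>\<^bsub>Zp p\<^esub> a, \<one>\<^bsub>G\<^esub>) = (zp_power p n \<otimes>\<^bsub>Zp p\<^esub> a, \<one>\<^bsub>G\<^esub>)"
    "\<And>x. x \<in> carrier ?E \<Longrightarrow> snd (\<phi> x) = snd x"
    using assms(3) unfolding character_extension_def by (rule equivalent_extensionsE) (rule that; assumption)
  have hom: "\<phi> \<in> module_hom (Zp p) ?E ?E'"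
    using \<phi>(1) by (simp add: module_iso_def)
  interpret D: domain "Zp p"
    by (rule Zp_domain[OF prime_p])
  have "\<xi> g = \<xi>' g" if g: "g \<in> carrier G" for g
  proof -
    define a where "a = zp_of_int p (\<xi> g)"
    have a: "(a, g) \<in> carrier ?E" "a \<in> carrier (Zp p)" "a n = \<xi> g"
      using g charactersD(1,2)[OF \<xi> g] by (auto simp: character_module_def zp_of_int_apply a_def)
    obtain b where b: "\<phi> (a, g) = (b, g)" "b \<in> carrier (Zp p)" "b n = \<xi>' g"
      using module_homD(1)[OF hom a(1)] \<phi>(3)[OF a(1)] by (cases "\<phi> (a, g)") (auto simp: character_module_def)
    have kill: "zp_power p n \<odot>\<^bsub>p_group_module p G\<^esub> g = \<one>\<^bsub>G\<^esub>"
      by (simp add: smult_PG zp_of_int_apply)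
    have "\<phi> (zp_power p n \<odot>\<^bsub>?E\<^esub> (a, g)) = zp_power p n \<odot>\<^bsub>?E'\<^esub> (b, g)"
      using module_homD(3)[OF hom _ a(1)] b by simp
    then have "zp_power p n \<otimes>\<^bsub>Zp p\<^esub> a = zp_power p n \<otimes>\<^bsub>Zp p\<^esub> b"
      using \<phi>(2)[OF a(2)] by (simp add: character_module_def kill)
    then have "a = b"
      using a(2) b(2) zp_power_nonzero[OF prime_p, of n] by (simp add: D.m_lcancel)
    then show ?thesis
      using a b by simp
  qed
  then show ?thesis
    using charactersD(4)[OF \<xi>] charactersD(4)[OF \<xi>'] by (intro extensionalityI[of \<xi> "carrier G"])
qed

text \<open>
  Multiplication by \<open>p ^ n\<close> maps the middle term \<open>E\<close> into \<open>Zp\<close>; together with \<open>q\<close> it embeds \<open>E\<close>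
  into the product of \<open>Zp\<close> and \<open>G\<close>.
\<close>

lemma extension_equivalent_character_extension:
  assumes ext: "(E, i, q) \<in> extensions p G"
  obtains \<xi> where "\<xi> \<in> characters (p ^ n) G" "equivalent_extensions p (E, i, q) (character_extension p n G \<xi>)"
proof -
  note extD = extensionsD[OF ext]
  interpret E: padic_module p E
    using extD(1) prime_p by (simp add: padic_module_def padic_module_axioms_def)
  note q = module_homD[OF extD(3), simplified]
  have i: "i a \<in> carrier E" "i (a \<oplus>\<^bsub>Zp p\<^esub> b) = i a \<oplus>\<^bsub>E\<^esub> i b" "i (b \<otimes>\<^bsub>Zp p\<^esub> a) = b \<odot>\<^bsub>E\<^esub> i a"
    if "a \<in> carrier (Zp p)" "b \<in> carrier (Zp p)" for a b
    using that module_homD[OF extD(2)] by (auto simp: self_module_def)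
  have qi: "q (i a) = \<one>\<^bsub>G\<^esub>" if "a \<in> carrier (Zp p)" for a
    using extD(6) that by blast
  have "\<exists>a\<in>carrier (Zp p). zp_power p n \<odot>\<^bsub>E\<^esub> x = i a" if x: "x \<in> carrier E" for x
  proof -
    have "q (zp_power p n \<odot>\<^bsub>E\<^esub> x) = \<one>\<^bsub>G\<^esub>"
      using x by (simp add: q(3) smult_PG zp_of_int_apply)
    then have "zp_power p n \<odot>\<^bsub>E\<^esub> x \<in> i ` carrier (Zp p)"
      unfolding extD(6) using x by simp
    then show ?thesis
      by auto
  qed
  then obtain r where r: "\<And>x. x \<in> carrier E \<Longrightarrow> r x \<in> carrier (Zp p)"
    "\<And>x. x \<in> carrier E \<Longrightarrow> zp_power p n \<odot>\<^bsub>E\<^esub> x = i (r x)"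
    by metis
  have i_cancel: "a = b" if "i a = i b" "a \<in> carrier (Zp p)" "b \<in> carrier (Zp p)" for a b
    using that extD(4) by (auto dest: inj_onD)
  have r_add: "r (x \<oplus>\<^bsub>E\<^esub> y) = r x \<oplus>\<^bsub>Zp p\<^esub> r y" if "x \<in> carrier E" "y \<in> carrier E" for x y
  proof (rule i_cancel)
    have "i (r (x \<oplus>\<^bsub>E\<^esub> y)) = zp_power p n \<odot>\<^bsub>E\<^esub> x \<oplus>\<^bsub>E\<^esub> zp_power p n \<odot>\<^bsub>E\<^esub> y"
      using that r(2)[of "x \<oplus>\<^bsub>E\<^esub> y"] by (simp add: E.smult_r_distr)
    also have "\<dots> = i (r x \<oplus>\<^bsub>Zp p\<^esub> r y)"
      using that r i by simp
    finally show "i (r (x \<oplus>\<^bsub>E\<^esub> y)) = i (r x \<oplus>\<^bsub>Zp p\<^esub> r y)" .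
  qed (use that r in auto)
  have r_smult: "r (a \<odot>\<^bsub>E\<^esub> x) = a \<otimes>\<^bsub>Zp p\<^esub> r x" if "a \<in> carrier (Zp p)" "x \<in> carrier E" for a x
  proof (rule i_cancel)
    have "i (r (a \<odot>\<^bsub>E\<^esub> x)) = (zp_power p n \<otimes>\<^bsub>Zp p\<^esub> a) \<odot>\<^bsub>E\<^esub> x"
      using that r(2)[of "a \<odot>\<^bsub>E\<^esub> x"] by (simp add: E.smult_assoc1)
    also have "\<dots> = a \<odot>\<^bsub>E\<^esub> (zp_power p n \<odot>\<^bsub>E\<^esub> x)"
      using that PG.R.m_comm[of a "zp_power p n"] by (simp flip: E.smult_assoc1)
    also have "\<dots> = i (a \<otimes>\<^bsub>Zp p\<^esub> r x)"
      using that r i by simp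
    finally show "i (r (a \<odot>\<^bsub>E\<^esub> x)) = i (a \<otimes>\<^bsub>Zp p\<^esub> r x)" .
  qed (use that r in auto)
  have r_i: "r (i a) = zp_power p n \<otimes>\<^bsub>Zp p\<^esub> a" if "a \<in> carrier (Zp p)" for a
    using that i r by (intro i_cancel) simp_all
  have same_q: "\<exists>a\<in>carrier (Zp p). x = y \<oplus>\<^bsub>E\<^esub> i a" if xy: "x \<in> carrier E" "y \<in> carrier E" "q x = q y" for x y
  proof -
    have q_minus: "q (\<ominus>\<^bsub>E\<^esub> y) \<otimes>\<^bsub>G\<^esub> q y = \<one>\<^bsub>G\<^esub>"
      using q(2)[of "\<ominus>\<^bsub>E\<^esub> y" y] xy module_hom_zero[OF extD(1) PG.module_axioms extD(3)] by (simp add: E.M.l_neg)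
    then have "\<ominus>\<^bsub>E\<^esub> y \<oplus>\<^bsub>E\<^esub> x \<in> {x \<in> carrier E. q x = \<one>\<^bsub>G\<^esub>}"
      using xy by (simp add: q)
    then obtain a where a: "a \<in> carrier (Zp p)" "\<ominus>\<^bsub>E\<^esub> y \<oplus>\<^bsub>E\<^esub> x = i a"
      unfolding extD(6)[symmetric] by blast
    have "x = y \<oplus>\<^bsub>E\<^esub> (\<ominus>\<^bsub>E\<^esub> y \<oplus>\<^bsub>E\<^esub> x)"
      using xy by (simp add: E.M.r_neg2)
    with a show ?thesis
      by auto
  qed
  define s where "s = inv_into (carrier E) q"
  have s: "s g \<in> carrier E" "q (s g) = g" if "g \<in> carrier G" for g
    using that extD(5) by (auto simp: s_def inv_into_into f_inv_into_f)
  \<comment> \<open>The value at \<open>g\<close> is the residue of \<open>r\<close> at any lift of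
    \<open>g\<close>: another lift differs by some \<open>i a\<close>, and
    \<open>r (i a) = p ^ n a\<close> has residue 0.\<close>
  define \<xi> where "\<xi> = (\<lambda>g\<in>carrier G. r (s g) n)"
  have \<xi>q: "\<xi> (q x) = r x n" if x: "x \<in> carrier E" for x
  proof -
    have qx: "q x \<in> carrier G"
      using q(1)[OF x] .
    obtain a where a: "a \<in> carrier (Zp p)" "s (q x) = x \<oplus>\<^bsub>E\<^esub> i a"
      using same_q[of "s (q x)" x] s[OF qx] x by auto
    have "r (s (q x)) = r x \<oplus>\<^bsub>Zp p\<^esub> zp_power p n \<otimes>\<^bsub>Zp p\<^esub> a"
      using a x i r_i by (simp add: r_add)
    then have "r (s (q x)) n = r x n mod int p ^ n"
      by (simp add: Zp_add_apply Zp_mult_apply zp_of_int_apply)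
    then show ?thesis
      using qx r(1)[OF x] by (simp add: \<xi>_def)
  qed
  have \<xi>_char: "\<xi> \<in> characters (p ^ n) G"
    unfolding characters_def
  proof (intro CollectI conjI ballI)
    show "\<xi> \<in> (\<Pi>\<^sub>E x\<in>carrier G. {0..<int (p ^ n)})"
      using s r(1) Zp_apply_bounds[OF prime_p, of "r (s _)" n] by (auto simp: \<xi>_def)
    fix g h assume gh: "g \<in> carrier G" "h \<in> carrier G"
    have "\<xi> (g \<otimes>\<^bsub>G\<^esub> h) = r (s g \<oplus>\<^bsub>E\<^esub> s h) n"
      using \<xi>q[of "s g \<oplus>\<^bsub>E\<^esub> s h"] gh s q by simp
    also have "\<dots> = (\<xi> g + \<xi> h) mod int (p ^ n)"
      using gh s by (simp add: r_add Zp_add_apply \<xi>_def)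
    finally show "\<xi> (g \<otimes>\<^bsub>G\<^esub> h) = (\<xi> g + \<xi> h) mod int (p ^ n)" .
  qed
  let ?E = "character_module p n G \<xi>" and ?\<phi> = "\<lambda>x. (r x, q x)"
  have hom: "?\<phi> \<in> module_hom (Zp p) E ?E"
    by (rule module_homI) (simp_all add: character_module_def r \<xi>q r_add r_smult q)
  have inj: "inj_on ?\<phi> (carrier E)"
  proof (rule inj_onI)
    fix x y assume xy: "x \<in> carrier E" "y \<in> carrier E" "?\<phi> x = ?\<phi> y"
    then obtain a where a: "a \<in> carrier (Zp p)" "x = y \<oplus>\<^bsub>E\<^esub> i a"
      using same_q[of x y] by auto
    then have "r y \<oplus>\<^bsub>Zp p\<^esub> zp_power p n \<otimes>\<^bsub>Zp p\<^esub> a = r y"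
      using xy r_add[of y "i a"] r_i i by simp
    then have "zp_power p n \<otimes>\<^bsub>Zp p\<^esub> a = \<zero>\<^bsub>Zp p\<^esub>"
      using a(1) r(1)[OF xy(2)] PG.R.add.r_cancel_one[of "r y"] by simp
    then have "a = \<zero>\<^bsub>Zp p\<^esub>"
      using Zp_power_mult_eq_0[OF prime_p a(1)] by blast
    moreover have "i \<zero>\<^bsub>Zp p\<^esub> = \<zero>\<^bsub>E\<^esub>"
      using i(3)[of "\<zero>\<^bsub>Zp p\<^esub>" "\<zero>\<^bsub>Zp p\<^esub>"] i(1)[of "\<zero>\<^bsub>Zp p\<^esub>" "\<zero>\<^bsub>Zp p\<^esub>"] by simp
    ultimately show "x = y"
      using a xy by simp
  qed
  have surj: "carrier ?E \<subseteq> ?\<phi> ` carrier E"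
  proof
    fix z assume "z \<in> carrier ?E"
    then obtain a g where z: "z = (a, g)" "a \<in> carrier (Zp p)" "g \<in> carrier G" "a n = \<xi> g"
      by (auto simp: character_module_def)
    let ?x = "s g"
    have x: "?x \<in> carrier E" "q ?x = g" "r ?x n = a n"
      using s[OF z(3)] z by (auto simp: \<xi>_def)
    \<comment> \<open>First coordinates over \<open>g\<close> agree with \<open>r (s g)\<close>
      modulo \<open>p ^ n\<close>; the multiple of \<open>p ^ n\<close> in between is realized by
      adding \<open>i b\<close> to the lift.\<close>
    obtain b where b: "b \<in> carrier (Zp p)" "a = r ?x \<oplus>\<^bsub>Zp p\<^esub> zp_power p n \<otimes>\<^bsub>Zp p\<^esub> b"
      using Zp_congE[OF prime_p z(2) r(1)[OF x(1)]] x(3) by metis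
    have "r (?x \<oplus>\<^bsub>E\<^esub> i b) = a"
      using x b(1) i r_i by (simp add: r_add b(2))
    then have "?\<phi> (?x \<oplus>\<^bsub>E\<^esub> i b) = z"
      using x b(1) i qi q z(3) by (simp add: z(1))
    moreover have "?x \<oplus>\<^bsub>E\<^esub> i b \<in> carrier E"
      using x b(1) i by simp
    ultimately show "z \<in> ?\<phi> ` carrier E"
      by blast
  qed
  have "?\<phi> \<in> module_iso (Zp p) E ?E"
    using hom inj surj module_homD(1)[OF hom] by (auto simp: module_iso_def bij_betw_def)
  then have "equivalent_extensions p (E, i, q) (character_extension p n G \<xi>)"
    unfolding character_extension_def by (rule equivalent_extensionsI) (simp_all add: r_i qi)
  with \<xi>_char show ?thesis
    by (rule that)
qed

theorem card_Ext: "card (Ext p G) = p ^ n"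
proof -
  let ?F = "\<lambda>\<xi>. ext_rel p G `` {character_extension p n G \<xi>}"
  have "bij_betw ?F (characters (p ^ n) G) (Ext p G)"
    unfolding bij_betw_def
  proof
    show "inj_on ?F (characters (p ^ n) G)"
    proof (rule inj_onI)
      fix \<xi> \<xi>' assume *: "\<xi> \<in> characters (p ^ n) G" "\<xi>' \<in> characters (p ^ n) G" "?F \<xi> = ?F \<xi>'"
      then have "(character_extension p n G \<xi>, character_extension p n G \<xi>') \<in> ext_rel p G"
        using eq_equiv_class[OF _ equiv_ext_rel] character_extension_in_extensions by blast
      then show "\<xi> = \<xi>'"
        using * equivalent_character_extensions by (auto simp: ext_rel_def)
    qed
    show "?F ` characters (p ^ n) G = Ext p G"
    proof
      show "?F ` characters (p ^ n) G \<subseteq> Ext p G"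
        using character_extension_in_extensions by (auto simp: Ext_eq intro: quotientI)
      show "Ext p G \<subseteq> ?F ` characters (p ^ n) G"
      proof
        fix \<epsilon> assume "\<epsilon> \<in> Ext p G"
        then obtain E i q where e: "(E, i, q) \<in> extensions p G" "\<epsilon> = ext_rel p G `` {(E, i, q)}"
          by (auto simp: Ext_eq elim!: quotientE)
        obtain \<xi> where \<xi>: "\<xi> \<in> characters (p ^ n) G" "equivalent_extensions p (E, i, q) (character_extension p n G \<xi>)"
          using extension_equivalent_character_extension[OF e(1)] by blast
        then have "((E, i, q), character_extension p n G \<xi>) \<in> ext_rel p G"
          using e(1) character_extension_in_extensions by (simp add: ext_rel_def)
        then have "\<epsilon> = ?F \<xi>"
          unfolding e(2) using equiv_class_eq[OF equiv_ext_rel] by blast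
        with \<xi>(1) show "\<epsilon> \<in> ?F ` characters (p ^ n) G"
          by blast
      qed
    qed
  qed
  then show ?thesis
    using bij_betw_same_card[of ?F] card_characters[OF prime_p G.comm_group_axioms card_G, of n] by simp
qed

end

section \<open>Extensions with a prescribed middle term\<close>

lemma rep_quotient:
  assumes "equiv A r" "C \<in> A // r"
  shows "rep C \<in> A" "C = r `` {rep C}"
proof -
  have "C \<noteq> {}"
    using assms by (rule in_quotient_imp_non_empty)
  then have "rep C \<in> C"
    unfolding rep_def by (rule some_in_eq[THEN iffD2])
  then show "rep C \<in> A"
    using in_quotient_imp_subset[OF assms] by blast
  obtain x where "x \<in> A" "C = r `` {x}"
    using assms(2) by (rule quotientE)
  then show "C = r `` {rep C}"
    using \<open>rep C \<in> C\<close> equiv_class_eq[OF assms(1)] by blast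
qed

locale ext_count = quotient_count p M e \<rho> G n
  for p :: nat and M :: zp_module (structure) and e and \<rho> :: "_ \<Rightarrow> padic" and G :: "nat monoid" (structure) and n
begin

sublocale ext_group p G n
  by unfold_locales (rule prime_p card_G)+

text \<open>The surjection alone leaves the embedding of \<open>Zp\<close> open; it is fixed by
  sending 1 to the normalized generator.\<close>

definition ext_of :: "(padic \<times> nat \<Rightarrow> nat) \<Rightarrow> extension" where "ext_of q = (M, \<lambda>a. a \<odot> gen q, q)"

lemma ext_of_in_extensions:
  assumes q: "q \<in> Q"
  shows "ext_of q \<in> Defs.extensions p G"
  unfolding ext_of_def
proof (rule extensionsI)
  interpret q: cyclic_quotient p M e \<rho> G n q "gen q"
    using cyclic_quotient_gen[OF q] .
  show "module (Zp p) M" ..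
  show "(\<lambda>a. a \<odot> gen q) \<in> module_hom (Zp p) (self_module (Zp p)) M"
    using gen_closed[OF q] by (intro module_homI) (auto simp: self_module_def smult_l_distr smult_assoc1)
  show "q \<in> module_hom (Zp p) M (p_group_module p G)"
    by (rule additive_imp_module_hom[where n = n]) (simp_all add: PG.module_axioms smult_PG zp_of_int_apply)
  show "inj_on (\<lambda>a. a \<odot> gen q) (carrier (Zp p))"
    using q.smult_w_cancel by (auto intro: inj_onI)
  show "q ` carrier M = carrier G"
    by (rule q.q_surj)
  show "(\<lambda>a. a \<odot> gen q) ` carrier (Zp p) = {x \<in> carrier M. q x = \<one>\<^bsub>G\<^esub>}"
    unfolding q.q_kernel by (simp add: cyclic_submodule_def)
qed

text \<open>The embeddings are linear, so compatibility with them amounts to the single condition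
  that \<open>gen q\<close> goes to \<open>gen q'\<close>.\<close>

lemma equivalent_ext_of:
  assumes q: "q \<in> Q" "q' \<in> Q"
  shows "equivalent_extensions p (ext_of q) (ext_of q') \<longleftrightarrow> equivalent q q'"
proof
  assume "equivalent_extensions p (ext_of q) (ext_of q')"
  then obtain \<phi> where \<phi>: "\<phi> \<in> module_iso (Zp p) M M" "\<And>a. a \<in> carrier (Zp p) \<Longrightarrow> \<phi> (a \<odot> gen q) = a \<odot> gen q'"
    "\<And>x. x \<in> carrier M \<Longrightarrow> q' (\<phi> x) = q x"
    unfolding ext_of_def by (rule equivalent_extensionsE) (rule that; assumption)
  have "\<phi> (gen q) = gen q'"
    using \<phi>(2)[of "\<one>\<^bsub>Zp p\<^esub>"] gen_closed q by simp
  then show "equivalent q q'"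
    using \<phi>(1,3) unfolding equivalent_def by blast
next
  assume "equivalent q q'"
  then obtain \<phi> where \<phi>: "\<phi> \<in> module_iso (Zp p) M M" "\<phi> (gen q) = gen q'" "\<And>x. x \<in> carrier M \<Longrightarrow> q' (\<phi> x) = q x"
    unfolding equivalent_def by blast
  then have "\<phi> (a \<odot> gen q) = a \<odot> gen q'" if "a \<in> carrier (Zp p)" for a
    using that gen_closed[OF q(1)] module_homD(3)[of \<phi> "Zp p" M M a "gen q"] by (simp add: module_iso_def)
  then show "equivalent_extensions p (ext_of q) (ext_of q')"
    unfolding ext_of_def using \<phi>(1,3) by (intro equivalent_extensionsI) auto
qed

lemma transport_extension:
  assumes ext: "(E, i, q) \<in> Defs.extensions p G" and \<theta>: "\<theta> \<in> module_iso (Zp p) E M"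
  defines "q' \<equiv> \<lambda>y\<in>carrier M. q (inv_into (carrier E) \<theta> y)"
  shows "q' \<in> hom (add_monoid M) G" "q' ` carrier M = carrier G" "\<theta> (i \<one>\<^bsub>Zp p\<^esub>) \<in> carrier M"
    "ker q' = cyclic_submodule (\<theta> (i \<one>\<^bsub>Zp p\<^esub>))"
    "\<And>x. x \<in> carrier E \<Longrightarrow> q' (\<theta> x) = q x"
    "\<And>a. a \<in> carrier (Zp p) \<Longrightarrow> \<theta> (i a) = a \<odot> \<theta> (i \<one>\<^bsub>Zp p\<^esub>)"
proof -
  note extD = extensionsD[OF ext]
  have hom: "\<theta> \<in> module_hom (Zp p) E M" and bij: "bij_betw \<theta> (carrier E) (carrier M)"
    using \<theta> by (auto simp: module_iso_def)
  let ?\<theta>' = "inv_into (carrier E) \<theta>"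
  have "?\<theta>' \<in> module_iso (Zp p) M E"
    using extD(1) \<theta> by (rule module_iso_inv_into)
  then have hom': "?\<theta>' \<in> module_hom (Zp p) M E" and bij': "bij_betw ?\<theta>' (carrier M) (carrier E)"
    by (auto simp: module_iso_def)
  have inv: "?\<theta>' (\<theta> x) = x" if "x \<in> carrier E" for x
    using that bij by (simp add: bij_betw_def)
  have inv': "\<theta> (?\<theta>' y) = y" if "y \<in> carrier M" for y
    using that bij by (simp add: bij_betw_def f_inv_into_f)
  note q = module_homD[OF extD(3), simplified]
  have i1: "i a \<in> carrier E" if "a \<in> carrier (Zp p)" for a
    using that extD(6) by blast
  show "q' \<in> hom (add_monoid M) G"
    using module_homD[OF hom'] q by (auto simp: q'_def hom_def)
  have "q' ` carrier M = q ` ?\<theta>' ` carrier M"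
    by (simp add: q'_def image_image)
  then show "q' ` carrier M = carrier G"
    using bij' extD(5) by (simp add: bij_betw_def)
  show closed: "\<theta> (i \<one>\<^bsub>Zp p\<^esub>) \<in> carrier M"
    using module_homD(1)[OF hom] i1 by simp
  show lin: "\<theta> (i a) = a \<odot> \<theta> (i \<one>\<^bsub>Zp p\<^esub>)" if "a \<in> carrier (Zp p)" for a
    using that module_homD(3)[OF extD(2), of a "\<one>\<^bsub>Zp p\<^esub>"] module_homD(3)[OF hom, of a "i \<one>\<^bsub>Zp p\<^esub>"] i1
    by (simp add: self_module_def)
  show "q' (\<theta> x) = q x" if "x \<in> carrier E" for x
    using that inv module_homD(1)[OF hom] by (simp add: q'_def)
  have "q' y = \<one>\<^bsub>G\<^esub> \<longleftrightarrow> y \<in> cyclic_submodule (\<theta> (i \<one>\<^bsub>Zp p\<^esub>))" if y: "y \<in> carrier M" for y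
  proof -
    have c: "?\<theta>' y \<in> carrier E"
      using module_homD(1)[OF hom' y] .
    have "q' y = \<one>\<^bsub>G\<^esub> \<longleftrightarrow> ?\<theta>' y \<in> i ` carrier (Zp p)"
      unfolding extD(6) using y c by (simp add: q'_def)
    also have "\<dots> \<longleftrightarrow> y \<in> (\<lambda>a. \<theta> (i a)) ` carrier (Zp p)"
    proof -
      have "?\<theta>' y = i a \<longleftrightarrow> y = \<theta> (i a)" if "a \<in> carrier (Zp p)" for a
        using inv[OF i1[OF that]] inv'[OF y] by metis
      then show ?thesis
        by (auto simp: image_iff)
    qed
    also have "(\<lambda>a. \<theta> (i a)) ` carrier (Zp p) = cyclic_submodule (\<theta> (i \<one>\<^bsub>Zp p\<^esub>))"
      unfolding cyclic_submodule_def by (rule image_cong[OF refl]) (rule lin)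
    finally show ?thesis .
  qed
  moreover have "cyclic_submodule (\<theta> (i \<one>\<^bsub>Zp p\<^esub>)) \<subseteq> carrier M"
    using closed by (auto simp: cyclic_submodule_def)
  ultimately show "ker q' = cyclic_submodule (\<theta> (i \<one>\<^bsub>Zp p\<^esub>))"
    by (auto simp: ker_def)
qed

text \<open>Transport to \<open>M\<close> yields a generator of the kernel that need not be
  normalized. Replacing it by a unit multiple could change the class of the extension, so the
  identification of \<open>E\<close> with \<open>M\<close> is corrected instead, by an automorphism
  of \<open>M\<close> that scales \<open>e\<close>.\<close>

lemma extension_equivalent_ext_of:
  assumes ext: "(E, i, q) \<in> Defs.extensions p G" and \<psi>: "\<psi> \<in> module_iso (Zp p) E M"
  obtains q' where "q' \<in> Q" "equivalent_extensions p (E, i, q) (ext_of q')"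
proof -
  note t = transport_extension[OF ext \<psi>]
  obtain v where v: "v \<in> Units (Zp p)"
    "normalized_generator (\<lambda>y\<in>carrier M. q (inv_into (carrier E) \<psi> y)) (v \<odot> \<psi> (i \<one>\<^bsub>Zp p\<^esub>))"
    using normalized_generator_exists[OF t(1-4)] by blast
  \<comment> \<open>This map fixes \<open>T\<close> and multiplies \<open>\<rho>\<close> by
    \<open>v\<close>, so the image of 1 receives the same \<open>\<rho>\<close>-coordinate as the
    normalized generator obtained from \<open>v\<close>.\<close>
  define \<sigma> where "\<sigma> = split_map v \<zero> (\<lambda>t\<in>T. t)"
  have id: "(\<lambda>t\<in>T. t) \<in> auto_T"
    by (auto simp: auto_T_iff bij_betw_def inj_on_def)
  define \<theta> where "\<theta> x = \<sigma> (\<psi> x)" for x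
  have \<theta>: "\<theta> \<in> module_iso (Zp p) E M"
    unfolding \<theta>_def using \<psi> split_map_iso[OF v(1) T_zero id] by (simp add: \<sigma>_def module_iso_compose)
  note t' = transport_extension[OF ext \<theta>]
  define q' where "q' = (\<lambda>y\<in>carrier M. q (inv_into (carrier E) \<theta> y))"
  have q'_Q: "q' \<in> Q"
    unfolding q'_def by (rule QI[OF _ t'(1-4)]) simp
  obtain k where k: "\<rho> (v \<odot> \<psi> (i \<one>\<^bsub>Zp p\<^esub>)) = zp_power p k"
    using v(2) by (auto simp: normalized_generator_def)
  have "\<rho> (\<theta> (i \<one>\<^bsub>Zp p\<^esub>)) = \<rho> (\<psi> (i \<one>\<^bsub>Zp p\<^esub>)) \<otimes>\<^bsub>Zp p\<^esub> v"
    unfolding \<theta>_def \<sigma>_def using t(3) by (rule rho_split_map[OF v(1) T_zero id])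
  also have "\<dots> = zp_power p k"
    using k v(1) t(3) by (simp add: rho_smult R.Units_closed R.m_comm)
  finally have "normalized_generator q' (\<theta> (i \<one>\<^bsub>Zp p\<^esub>))"
    using t'(3,4) by (auto simp: normalized_generator_def q'_def)
  then have gen: "gen q' = \<theta> (i \<one>\<^bsub>Zp p\<^esub>)"
    using gen_eqI[OF q'_Q] by blast
  have "equivalent_extensions p (E, i, q) (ext_of q')"
    unfolding ext_of_def
  proof (rule equivalent_extensionsI[OF \<theta>])
    show "\<theta> (i a) = a \<odot> gen q'" if "a \<in> carrier (Zp p)" for a
      unfolding gen using that by (rule t'(6))
    show "q' (\<theta> x) = q x" if "x \<in> carrier E" for x
      unfolding q'_def using that by (rule t'(5))
  qed
  with q'_Q show ?thesis
    by (rule that)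
qed

definition middle_iso where "middle_iso = {\<epsilon> \<in> Ext p G. module_iso (Zp p) (fst (rep \<epsilon>)) M \<noteq> {}}"

lemma finite_Ext: "finite (Ext p G)"
  using card_Ext prime_gt_0_nat[OF prime_p] by (intro card_ge_0_finite) simp

lemma image_ext_of: "(\<lambda>q. ext_rel p G `` {ext_of q}) ` Q = middle_iso"
proof (intro equalityI subsetI)
  fix \<epsilon> assume "\<epsilon> \<in> (\<lambda>q. ext_rel p G `` {ext_of q}) ` Q"
  then obtain q where q: "q \<in> Q" "\<epsilon> = ext_rel p G `` {ext_of q}"
    by blast
  have \<epsilon>: "\<epsilon> \<in> Ext p G"
    unfolding q(2) Ext_eq using ext_of_in_extensions[OF q(1)] by (rule quotientI)
  have "\<epsilon> = ext_rel p G `` {rep \<epsilon>}" "rep \<epsilon> \<in> Defs.extensions p G"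
    using rep_quotient[OF equiv_ext_rel] \<epsilon> by (simp_all add: Ext_eq)
  then have "(rep \<epsilon>, ext_of q) \<in> ext_rel p G"
    using q eq_equiv_class[OF _ equiv_ext_rel] ext_of_in_extensions by metis
  then have "equivalent_extensions p (rep \<epsilon>) (M, \<lambda>a. a \<odot> gen q, q)"
    by (simp add: ext_rel_def ext_of_def)
  then have "module_iso (Zp p) (fst (rep \<epsilon>)) M \<noteq> {}"
    by (cases "rep \<epsilon>") (auto elim: equivalent_extensionsE)
  with \<epsilon> show "\<epsilon> \<in> middle_iso"
    by (simp add: middle_iso_def)
next
  fix \<epsilon> assume "\<epsilon> \<in> middle_iso"
  then have \<epsilon>: "\<epsilon> \<in> Defs.extensions p G // ext_rel p G" and ne: "module_iso (Zp p) (fst (rep \<epsilon>)) M \<noteq> {}"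
    by (auto simp: middle_iso_def Ext_eq)
  obtain E i q where Eiq: "rep \<epsilon> = (E, i, q)"
    by (metis prod_cases3)
  have ext: "(E, i, q) \<in> Defs.extensions p G" "\<epsilon> = ext_rel p G `` {(E, i, q)}"
    using rep_quotient[OF equiv_ext_rel \<epsilon>] by (simp_all add: Eiq)
  obtain \<psi> where "\<psi> \<in> module_iso (Zp p) E M"
    using ne by (auto simp: Eiq)
  then obtain q' where q': "q' \<in> Q" "equivalent_extensions p (E, i, q) (ext_of q')"
    using extension_equivalent_ext_of[OF ext(1)] by blast
  then have "((E, i, q), ext_of q') \<in> ext_rel p G"
    using ext(1) ext_of_in_extensions by (simp add: ext_rel_def)
  then have "\<epsilon> = ext_rel p G `` {ext_of q'}"
    unfolding ext(2) using equiv_class_eq[OF equiv_ext_rel] by blast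
  with q'(1) show "\<epsilon> \<in> (\<lambda>q. ext_rel p G `` {ext_of q}) ` Q"
    by blast
qed

text \<open>The fibres of \<open>Q\<close> over the extension classes with middle term
  \<open>M\<close> are the equivalence classes of quotient maps, all of the same positive size.
  Since \<open>Ext\<close> is finite, finiteness of \<open>Q\<close> comes with the count.\<close>

lemma finite_Q: "finite Q" and card_Q_eq_ext: "card Q = card T * card auto_T * card middle_iso"
proof -
  let ?F = "\<lambda>q. ext_rel p G `` {ext_of q}"
  have fin: "finite (?F ` Q)"
    unfolding image_ext_of middle_iso_def using finite_Ext by simp
  have fib: "card {q \<in> Q. ?F q = ?F q0} = card T * card auto_T" if q0: "q0 \<in> Q" for q0
  proof -
    have "?F q = ?F q0 \<longleftrightarrow> equivalent q q0" if "q \<in> Q" for q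
      using eq_equiv_class_iff[OF equiv_ext_rel ext_of_in_extensions[OF that] ext_of_in_extensions[OF q0]]
        equivalent_ext_of[OF that q0] ext_of_in_extensions that q0 by (simp add: ext_rel_def)
    then have "{q \<in> Q. ?F q = ?F q0} = {q \<in> Q. equivalent q q0}"
      by blast
    then show ?thesis
      using card_equivalent[OF q0] by simp
  qed
  have pos: "card T * card auto_T > 0"
    using card_T_pos auto_T_pos by simp
  show "finite Q"
    using fin pos fib by (rule card_fibres(1))
  have "card Q = card T * card auto_T * card (?F ` Q)"
    using fin pos fib by (rule card_fibres(2))
  then show "card Q = card T * card auto_T * card middle_iso"
    unfolding image_ext_of .
qed

lemma card_Q_eq_kernels: "card Q = card (auto G) * card (ker ` Q)"
  by (rule card_fibres(2)) (auto simp: finite_Q G.card_auto_pos finite_G card_same_kernel)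

lemma prob_middle_iso:
  "measure_pmf.prob (pmf_of_set (Ext p G)) {\<epsilon>. module_iso (Zp p) (fst (rep \<epsilon>)) M \<noteq> {}} = real (card middle_iso) / real p ^ n"
proof -
  have "Ext p G \<noteq> {}"
    using card_Ext prime_gt_0_nat[OF prime_p] by fastforce
  moreover have "Ext p G \<inter> {\<epsilon>. module_iso (Zp p) (fst (rep \<epsilon>)) M \<noteq> {}} = middle_iso"
    by (auto simp: middle_iso_def)
  ultimately show ?thesis
    using finite_Ext by (simp add: measure_pmf_of_set card_Ext)
qed

text \<open>\<open>c\<close> stands for \<open>c_1\<close>, so that \<open>(1 - 1/p) c\<close> is
  \<open>c_0\<close>. Expressed through \<open>card Q\<close>, both sides equal
  \<open>c (1 - 1/p) / p ^ n\<close> times \<open>card Q / (|Aut(G)| |T| |Aut(T)|)\<close>.\<close>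

lemma detailed_balance:
  "(1 - 1 / real p) * c / real (card (auto G)) *
      measure_pmf.prob (pmf_of_set (Ext p G)) {\<epsilon>. module_iso (Zp p) (fst (rep \<epsilon>)) M \<noteq> {}} =
   c / (real (card T) * real (card auto_T)) *
      measure (haar p M) {x \<in> carrier M. M A_Mod module_span (Zp p) M {x} \<cong> G}"
proof -
  have "real (card (auto G)) * real (card (ker ` Q)) = real (card T) * real (card auto_T) * real (card middle_iso)"
    using card_Q_eq_ext card_Q_eq_kernels by (metis of_nat_mult)
  then have eq: "real (card middle_iso) / real (card (auto G)) = real (card (ker ` Q)) / (real (card T) * real (card auto_T))"
    using G.card_auto_pos[OF finite_G] auto_T_pos card_T_pos by (simp add: field_simps)
  have "(1 - 1 / real p) * c / real (card (auto G)) * (real (card middle_iso) / real p ^ n)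
      = (1 - 1 / real p) * c / real p ^ n * (real (card middle_iso) / real (card (auto G)))"
    by simp
  also have "\<dots> = c / (real (card T) * real (card auto_T)) * (real (card (ker ` Q)) * ((1 - 1 / real p) / real p ^ n))"
    unfolding eq by (simp add: ac_simps)
  finally show ?thesis
    unfolding prob_middle_iso measure_quotient_iso[OF finite_Q is_haar_prob_haar] .
qed

end

section \<open>Detailed balance on isomorphism classes\<close>

text \<open>The group axioms serve to invert an isomorphism from the quotient to \<open>G\<close>
  when the rows of \<open>d_op\<close> are bounded.\<close>

lemma (in module) group_quotient_by_span:
  assumes "x \<in> carrier M"
  shows "group (M A_Mod module_span R M {x})"
proof -
  interpret N: submodule "cyclic_submodule x" R M
    using assms by (rule cyclic_submodule_is_submodule)
  have "cyclic_submodule x \<lhd> add_monoid M"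
    using N.subgroup_axioms M.a_comm_group by (simp add: comm_group.subgroup_imp_normal)
  then show ?thesis
    unfolding module_span_singleton[OF assms] A_FactGroup_def by (rule normal.factorgroup_is_group)
qed

lemma equiv_finite_abelian_p_groups:
  "equiv {G. is_finite_abelian_p_group p G}
    {(G, G'). is_finite_abelian_p_group p G \<and> is_finite_abelian_p_group p G' \<and> G \<cong> G'}"
  (is "equiv _ ?R")
proof (rule equivI)
  show "sym ?R"
    by (auto intro!: symI intro: group.iso_sym simp: is_finite_abelian_p_group_def comm_group_def)
  show "trans ?R"
    by (auto intro!: transI intro: iso_trans)
qed (auto intro!: refl_onI iso_refl)

lemma equiv_fg_Zp_modules_of_rank_1:
  "equiv {H :: zp_module. is_fg_Zp_module_of_rank_1 p H}
    {(H, H'). is_fg_Zp_module_of_rank_1 p H \<and> is_fg_Zp_module_of_rank_1 p H' \<and> module_iso (Zp p) H H' \<noteq> {}}"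
  (is "equiv _ ?R")
proof (rule equivI)
  show "sym ?R"
    using module_iso_inv_into[where R = "Zp p"] by (fastforce intro!: symI simp: is_fg_Zp_module_of_rank_1_def)
  show "trans ?R"
    using module_iso_compose[where R = "Zp p"] by (fastforce intro!: transI)
qed (use module_iso_refl in \<open>fastforce intro!: refl_onI\<close>)+

lemma X0_rep: "g \<in> X0 p \<Longrightarrow> is_finite_abelian_p_group p (rep g)"
  unfolding X0_def using rep_quotient(1)[OF equiv_finite_abelian_p_groups] by blast

lemma X1_rep: "h \<in> X1 p \<Longrightarrow> is_fg_Zp_module_of_rank_1 p (rep h)"
  unfolding X1_def using rep_quotient(1)[OF equiv_fg_Zp_modules_of_rank_1] by blast

lemma X0_eqI:
  assumes "g \<in> X0 p" "g' \<in> X0 p" "rep g \<cong> rep g'"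
  shows "g = g'"
proof -
  note equiv = equiv_finite_abelian_p_groups[of p]
  have "(rep g, rep g') \<in> {(G, G'). is_finite_abelian_p_group p G \<and> is_finite_abelian_p_group p G' \<and> G \<cong> G'}"
    using assms X0_rep by blast
  from equiv_class_eq[OF equiv this] show ?thesis
    using rep_quotient(2)[OF equiv assms(1)[unfolded X0_def]] rep_quotient(2)[OF equiv assms(2)[unfolded X0_def]]
    by simp
qed

lemma X1_eqI:
  assumes "h \<in> X1 p" "h' \<in> X1 p" "module_iso (Zp p) (rep h) (rep h') \<noteq> {}"
  shows "h = h'"
proof -
  note equiv = equiv_fg_Zp_modules_of_rank_1[of p]
  have "(rep h, rep h') \<in> {(H, H'). is_fg_Zp_module_of_rank_1 p H \<and> is_fg_Zp_module_of_rank_1 p H' \<and> module_iso (Zp p) H H' \<noteq> {}}"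
    using assms X1_rep by blast
  from equiv_class_eq[OF equiv this] show ?thesis
    using rep_quotient(2)[OF equiv assms(1)[unfolded X1_def]] rep_quotient(2)[OF equiv assms(2)[unfolded X1_def]]
    by simp
qed

context
  fixes p :: nat
  assumes prime_p: "prime p"
begin

lemma X1_split:
  assumes "h \<in> X1 p"
  obtains e \<rho> where "split_module p (rep h) e \<rho>"
proof -
  have "is_fg_Zp_module_of_rank_1 p (rep h)"
    using assms by (rule X1_rep)
  then have H: "module (Zp p) (rep h)" "finitely_generated_module (Zp p) (rep h)" "has_rank (Zp p) (rep h) 1"
    by (auto simp: is_fg_Zp_module_of_rank_1_def)
  interpret padic_module p "rep h"
    using H(1) prime_p by (simp add: padic_module_def padic_module_axioms_def)
  show ?thesis
    using rank_1_imp_split[OF H(2,3)] that by blast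
qed

lemma X0_ext_group:
  assumes "g \<in> X0 p"
  obtains n where "ext_group p (rep g) n"
  using X0_rep[OF assms] prime_p
  by (auto simp: is_finite_abelian_p_group_def ext_group_def ext_group_axioms_def)

lemma mu0_pos:
  assumes "g \<in> X0 p"
  shows "mu0 p g > 0"
proof -
  obtain n where "ext_group p (rep g) n"
    using X0_ext_group[OF assms] .
  then interpret ext_group p "rep g" n .
  have "card (auto (rep g)) > 0"
    using finite_abelian_p_group by (intro G.card_auto_pos) (simp add: is_finite_abelian_p_group_def)
  moreover have "1 - 1 / real p > 0"
    using prime_gt_1_nat[OF prime_p] by simp
  ultimately show ?thesis
    using prodinf_one_minus_inverse_powers[OF prime_ge_2_nat[OF prime_p]] by (simp add: mu0_def)
qed

lemma mu1_pos:
  assumes "h \<in> X1 p"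
  shows "mu1 p h > 0"
proof -
  obtain e \<rho> where "split_module p (rep h) e \<rho>"
    using X1_split[OF assms] .
  then interpret split_module p "rep h" e \<rho> .
  show ?thesis
    using prodinf_one_minus_inverse_powers(1)[OF prime_ge_2_nat[OF prime_p]] card_T_pos auto_T_pos
    by (simp add: mu1_def torsion_part_eq auto_T_def Let_def)
qed

lemma mu0_dstar_op_eq_mu1_d_op:
  assumes "g \<in> X0 p" "h \<in> X1 p"
  shows "mu0 p g * dstar_op p g h = mu1 p h * d_op p h g"
proof -
  obtain e \<rho> where split: "split_module p (rep h) e \<rho>"
    using X1_split[OF assms(2)] .
  obtain n where G: "ext_group p (rep g) n"
    using X0_ext_group[OF assms(1)] .
  interpret ext_count p "rep h" e \<rho> "rep g" n
    using split G by (simp add: ext_count_def quotient_count_def quotient_count_axioms_def ext_group_def ext_group_axioms_def)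
  show ?thesis
    using detailed_balance[of "prodinf (\<lambda>i. 1 - 1 / real p ^ (i + 2))"]
    unfolding mu0_def mu1_def dstar_op_def d_op_def Let_def torsion_part_eq
      prodinf_one_minus_inverse_powers(2)[OF prime_ge_2_nat[OF prime_p]] auto_T_def .
qed

text \<open>By symmetry and transitivity of isomorphism, a quotient belongs to at most one class, so
  the events are disjoint.\<close>

lemma
  assumes h: "h \<in> X1 p"
  shows d_op_summable: "d_op p h summable_on X0 p"
    and d_op_le_1: "infsum (d_op p h) (X0 p) \<le> 1"
proof -
  obtain e \<rho> where "split_module p (rep h) e \<rho>"
    using X1_split[OF h] .
  then interpret split_module p "rep h" e \<rho> .
  let ?A = "\<lambda>g. {x \<in> carrier (rep h). rep h A_Mod module_span (Zp p) (rep h) {x} \<cong> rep g}"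
  have prob: "prob_space (haar p (rep h))"
    using is_haar_prob_haar by (simp add: is_haar_prob_def)
  have "disjoint_family_on ?A (X0 p)"
    unfolding disjoint_family_on_def
  proof (intro ballI impI)
    fix g g' assume g: "g \<in> X0 p" "g' \<in> X0 p" "g \<noteq> g'"
    have False if x: "x \<in> carrier (rep h)"
      "rep h A_Mod module_span (Zp p) (rep h) {x} \<cong> rep g" "rep h A_Mod module_span (Zp p) (rep h) {x} \<cong> rep g'" for x
    proof -
      have "rep g \<cong> rep g'"
        using group.iso_sym[OF group_quotient_by_span[OF x(1)] x(2)] x(3) by (rule iso_trans)
      then show False
        using X0_eqI g by blast
    qed
    then show "?A g \<inter> ?A g' = {}"
      by blast
  qed
  with prob show "d_op p h summable_on X0 p" "infsum (d_op p h) (X0 p) \<le> 1"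
    unfolding d_op_def[abs_def] by (rule summable_on_measure_disjoint, rule infsum_measure_disjoint_le_1)
qed

lemma
  assumes g: "g \<in> X0 p"
  shows dstar_op_summable: "dstar_op p g summable_on X1 p"
    and dstar_op_le_1: "infsum (dstar_op p g) (X1 p) \<le> 1"
proof -
  obtain n where "ext_group p (rep g) n"
    using X0_ext_group[OF g] .
  then interpret ext_group p "rep g" n .
  have Ext: "finite (Ext p (rep g))" "Ext p (rep g) \<noteq> {}"
    using card_Ext prime_gt_0_nat[OF prime_p] by (auto intro: card_ge_0_finite simp: card_gt_0_iff)
  \<comment> \<open>Intersecting with the support \<open>Ext\<close> keeps the probability; outside
    of it \<open>rep \<epsilon>\<close> need not be a module, and an isomorphism starting from it
    could not be inverted.\<close>
  let ?A = "\<lambda>h. {\<epsilon>. module_iso (Zp p) (fst (rep \<epsilon>)) (rep h) \<noteq> {}} \<inter> Ext p (rep g)"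
  have dstar: "dstar_op p g = (\<lambda>h. measure_pmf.prob (pmf_of_set (Ext p (rep g))) (?A h))"
    unfolding dstar_op_def[abs_def] using measure_Int_set_pmf[of "pmf_of_set (Ext p (rep g))"] Ext by simp
  have "disjoint_family_on ?A (X1 p)"
    unfolding disjoint_family_on_def
  proof (intro ballI impI)
    fix h h' assume h: "h \<in> X1 p" "h' \<in> X1 p" "h \<noteq> h'"
    have False if \<epsilon>: "\<epsilon> \<in> Ext p (rep g)"
      "\<phi> \<in> module_iso (Zp p) (fst (rep \<epsilon>)) (rep h)" "\<psi> \<in> module_iso (Zp p) (fst (rep \<epsilon>)) (rep h')" for \<epsilon> \<phi> \<psi>
    proof -
      have "rep \<epsilon> \<in> extensions p (rep g)"
        using rep_quotient(1)[OF equiv_ext_rel] \<epsilon>(1) by (simp add: Ext_eq)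
      then have "module (Zp p) (fst (rep \<epsilon>))"
        by (cases "rep \<epsilon>") (auto dest: extensionsD(1))
      then have "module_iso (Zp p) (rep h) (rep h') \<noteq> {}"
        using module_iso_compose[OF module_iso_inv_into[OF _ \<epsilon>(2)] \<epsilon>(3)] by blast
      then show False
        using X1_eqI h by blast
    qed
    then show "?A h \<inter> ?A h' = {}"
      by blast
  qed
  with measure_pmf.prob_space_axioms
  show "dstar_op p g summable_on X1 p" "infsum (dstar_op p g) (X1 p) \<le> 1"
    unfolding dstar by (rule summable_on_measure_disjoint, rule infsum_measure_disjoint_le_1)
qed

end

theorem mainTheorem3:
  fixes p :: nat
  assumes "prime p"
  shows "self_adjoint_wrt (X0 p) (mu0 p) (dd_star p) \<and>
         self_adjoint_wrt (X1 p) (mu1 p) (d_star_d p)"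
proof
  have nonneg: "dstar_op p g h \<ge> 0" "d_op p h g \<ge> 0" for g h
    by (simp_all add: dstar_op_def d_op_def)
  note facts = mu0_pos[OF assms] mu1_pos[OF assms] nonneg dstar_op_summable[OF assms] dstar_op_le_1[OF assms]
    d_op_summable[OF assms] d_op_le_1[OF assms]
  show "self_adjoint_wrt (X0 p) (mu0 p) (dd_star p)"
    unfolding dd_star_def
    using facts mu0_dstar_op_eq_mu1_d_op[OF assms] by (intro self_adjoint_wrt_op_comp[where m = "mu1 p"]) auto
  show "self_adjoint_wrt (X1 p) (mu1 p) (d_star_d p)"
    unfolding d_star_d_def
    using facts mu0_dstar_op_eq_mu1_d_op[OF assms, symmetric]
    by (intro self_adjoint_wrt_op_comp[where m = "mu0 p"]) auto
qed

end
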